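(* There exists an absolute constant $c>0$ for which the following holds. Let $X \ge 10$ and let $A\subseteq \{1,\dots,X\}$ be a set such that there are no $a_1,a_2\in A$ and positive integer $n$ with $a_1-a_2 = n^2$. Then \[|A|\le X\exp\big(-c(\log X)^{1/4}(\log\log X)^{-1/2}\big).\] *)

theory Defs
  imports Complex_Main
begin

end

theory Submission
  imports Defs "HOL-Analysis.Analysis"
begin

text \<open>
  The proof is a density increment. Let \<open>A\<close> have density \<open>\<alpha>\<close> in an interval of length \<open>X\<close> and no
  square differences, and put \<open>L = ln (1 / \<alpha>)\<close>. By the circle method, with Weyl's inequality as an
  upper bound for the exponential sum over squares, on average over short windows of length \<open>N\<close> the
  weighted energy of \<open>A\<close>, the sum over reduced fractions \<open>a / q\<close> with \<open>q \<le> Q = \<alpha> powr (- O(1))\<close> of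
  the squared Fourier coefficients at \<open>a / q\<close> times \<open>1 / sqrt q\<close>, exceeds \<open>(1 + c) * \<alpha>\<^sup>2\<close>.

  Conversely, suppose that \<open>A\<close> has density at most \<open>\<beta> = (1 + \<epsilon>) * \<alpha>\<close> on all progressions of length
  \<open>N / q\<close> with difference \<open>q \<le> exp (O(L ^ 3 * ln L))\<close>. The weights \<open>1 / sqrt q\<close> are dominated by the
  multipliers of an operator \<open>T\<close> that averages the conditional densities of \<open>A\<close> modulo a random
  modulus containing each prime \<open>p\<close> above \<open>O(L\<^sup>2)\<close> independently with probability \<open>1 / sqrt p\<close>. In the \<open>k\<close>-th
  moment of \<open>T 1\<^sub>A\<close>, with \<open>k\<close> of order \<open>L\<close>, a prime occurring in only one of the \<open>k\<close> random moduli can be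
  averaged out; the primes occurring twice are few (about \<open>k\<^sup>2 * (\<Sum>p. 1 / p)\<close>), so
  all surviving conditional densities are at most \<open>\<beta>\<close>, whence the moment is at most \<open>2 * \<beta> ^ k\<close>.
  A convexity inequality then bounds the weighted energy by \<open>(1 + \<epsilon>) * \<beta>\<^sup>2\<close>, a contradiction. Hence
  the density increases by a constant factor on a progression whose difference may be taken to be a square, and
  iterating this \<open>O(L)\<close> times gives \<open>ln X \<le> O(L ^ 4 * (ln L)\<^sup>2)\<close>.
\<close>

section \<open>Exponential sums and Parseval\<close>

text \<open>The exponent 1/4 is dictated by the length of the windows. The energy is the pairing of
  the indicator of the set with its image under \<open>T\<close>, so Hoelder's inequality bounds it
  through the k-th moment at a loss of (3 / \<beta>) ^ (1 / k); this is as small as 1 + \<epsilon>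
  only once k is of order L. Two of k random moduli share a given prime p with probability at most
  k^2 / p, because the 1 / sqrt p of Weyl's inequality gets squared. As the sum of 1 / p up to Q =
  exp (O(L)) is of order ln L, about D = L^2 * ln L shared primes must be allowed for, each carrying
  a prime power up to Q. This gives differences up to exp (O(L^3 * ln L)). The moment, however, is
  computed over full periods, while the set lives in a window. A product of k densities of degree at
  most D can have a period near Q ^ (k * D) = exp (O(L^4 * ln L)), one factor k more in the
  exponent, and the window has to be longer than that. Densities must therefore be truncated in
  degree, which destroys their positivity; this is why even moments and crude bounds of the form 3 ^
  card enter.\<close>

definition e2pi :: "real \<Rightarrow> complex" where
  "e2pi t = cis (2 * pi * t)"

lemma e2pi_add: "e2pi (s + t) = e2pi s * e2pi t"
  by (simp add: e2pi_def distrib_left cis_mult)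

lemma e2pi_0 [simp]: "e2pi 0 = 1"
  by (simp add: e2pi_def)

lemma e2pi_of_int [simp]: "e2pi (of_int n) = 1"
  by (simp add: e2pi_def)

lemma norm_e2pi [simp]: "norm (e2pi t) = 1"
  by (simp add: e2pi_def)

lemma cnj_e2pi: "cnj (e2pi t) = e2pi (- t)"
  by (simp add: e2pi_def cis_cnj)

lemma e2pi_power: "e2pi t ^ n = e2pi (real n * t)"
  by (simp add: e2pi_def Complex.DeMoivre algebra_simps)

lemma e2pi_eq_1_iff: "e2pi t = 1 \<longleftrightarrow> t \<in> \<int>"
proof
  assume "e2pi t = 1"
  then have "cos (2 * pi * t) = 1"
    by (simp add: e2pi_def complex_eq_iff)
  then obtain n :: int where "2 * pi * t = of_int n * 2 * pi"
    using cos_one_2pi_int by blast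
  then have "t = of_int n"
    by simp
  then show "t \<in> \<int>"
    by simp
qed (auto elim!: Ints_cases)

lemma e2pi_add_int: "n \<in> \<int> \<Longrightarrow> e2pi (t + n) = e2pi t"
  using e2pi_eq_1_iff by (simp add: e2pi_add)

lemma sum_e2pi_full_period:
  fixes m :: nat and d :: int
  assumes "m > 0"
  shows "(\<Sum>j<m. e2pi (real j * (of_int d / real m))) = (if int m dvd d then of_nat m else 0)"
proof (cases "int m dvd d")
  case True
  then obtain c where "d = int m * c" ..
  then have "of_int d / real m = of_int c"
    using assms by simp
  then have "e2pi (real j * (of_int d / real m)) = 1" for j
    using e2pi_of_int[of "int j * c"] by simp
  with True show ?thesis by simp
next
  case False
  define z where "z = e2pi (of_int d / real m)"
  have "z \<noteq> 1"
  proof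
    assume "z = 1"
    then obtain c :: int where "of_int d / real m = of_int c"
      unfolding z_def e2pi_eq_1_iff by (auto elim: Ints_cases)
    then have "real_of_int d = of_int (int m * c)"
      using assms by (simp add: field_simps)
    then have "d = int m * c"
      using of_int_eq_iff by blast
    with False show False by simp
  qed
  moreover have "z ^ m = 1"
    using assms by (simp add: z_def e2pi_power)
  ultimately have "(\<Sum>j<m. z ^ j) = 0"
    by (simp add: geometric_sum)
  then show ?thesis
    using False by (simp add: z_def e2pi_power)
qed

lemma norm_sum_square_e2pi:
  fixes c :: "int \<Rightarrow> complex"
  assumes "finite B"
  shows "of_real ((norm (\<Sum>y\<in>B. c y * e2pi (of_int y * t)))\<^sup>2)
       = (\<Sum>y\<in>B. \<Sum>z\<in>B. c y * cnj (c z) * e2pi (of_int (y - z) * t))"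
proof -
  let ?S = "\<Sum>y\<in>B. c y * e2pi (of_int y * t)"
  have "of_real ((norm ?S)\<^sup>2)
     = ?S * cnj ?S"
    by (rule complex_norm_square)
  also have "\<dots> = (\<Sum>y\<in>B. \<Sum>z\<in>B. c y * e2pi (of_int y * t) * cnj (c z * e2pi (of_int z * t)))"
    by (simp only: cnj_sum sum_product)
  also have "\<dots> = (\<Sum>y\<in>B. \<Sum>z\<in>B. c y * cnj (c z) * e2pi (of_int (y - z) * t))"
  proof (intro sum.cong refl)
    fix y z
    have "e2pi (of_int (y - z) * t) = e2pi (of_int y * t) * e2pi (- (of_int z * t))"
      by (simp add: e2pi_add [symmetric] algebra_simps)
    then show "c y * e2pi (of_int y * t) * cnj (c z * e2pi (of_int z * t))
             = c y * cnj (c z) * e2pi (of_int (y - z) * t)"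
      by (simp add: cnj_e2pi)
  qed
  finally show ?thesis .
qed

text \<open>\<open>B\<close> need not lie in one period. For a modulus longer than \<open>B\<close>
  this becomes Parseval's identity; for a short modulus it counts pairs of \<open>B\<close> in the
  same residue class, which is how conditional densities are linked to energies.\<close>

lemma sum_norm_square_e2pi:
  fixes c :: "int \<Rightarrow> complex" and m :: nat
  assumes "finite B" "m > 0"
  shows "of_real (\<Sum>j<m. (norm (\<Sum>y\<in>B. c y * e2pi (of_int y * (real j / real m))))\<^sup>2)
       = of_nat m * (\<Sum>y\<in>B. \<Sum>z\<in>B. if int m dvd y - z then c y * cnj (c z) else 0)"
proof -
  let ?e = "\<lambda>y z j. e2pi (of_int (y - z) * (real j / real m))"
  have "of_real (\<Sum>j<m. (norm (\<Sum>y\<in>B. c y * e2pi (of_int y * (real j / real m))))\<^sup>2)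
      = (\<Sum>j<m. \<Sum>y\<in>B. \<Sum>z\<in>B. c y * cnj (c z) * ?e y z j)"
    by (simp only: of_real_sum norm_sum_square_e2pi[OF assms(1)])
  also have "\<dots> = (\<Sum>y\<in>B. \<Sum>j<m. \<Sum>z\<in>B. c y * cnj (c z) * ?e y z j)"
    by (rule sum.swap)
  also have "\<dots> = (\<Sum>y\<in>B. \<Sum>z\<in>B. \<Sum>j<m. c y * cnj (c z) * ?e y z j)"
    by (intro sum.cong refl sum.swap)
  also have "\<dots> = (\<Sum>y\<in>B. \<Sum>z\<in>B. c y * cnj (c z) * (\<Sum>j<m. e2pi (real j * (of_int (y - z) / real m))))"
    by (simp add: sum_distrib_left mult_ac)
  also have "\<dots> = (\<Sum>y\<in>B. \<Sum>z\<in>B. c y * cnj (c z) * (if int m dvd y - z then of_nat m else 0))"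
    by (simp only: sum_e2pi_full_period[OF assms(2)])
  also have "\<dots> = (\<Sum>y\<in>B. \<Sum>z\<in>B. of_nat m * (if int m dvd y - z then c y * cnj (c z) else 0))"
    by (intro sum.cong refl) simp
  finally show ?thesis
    by (simp add: sum_distrib_left)
qed

lemma parseval_e2pi:
  fixes c :: "int \<Rightarrow> complex" and m :: nat
  assumes "m > 0" "B \<subseteq> {1..int m}"
  shows "(\<Sum>j<m. (norm (\<Sum>y\<in>B. c y * e2pi (of_int y * (real j / real m))))\<^sup>2)
       = real m * (\<Sum>y\<in>B. (norm (c y))\<^sup>2)"
proof -
  have fin: "finite B"
    using assms(2) finite_subset by blast
  have eq: "int m dvd y - z \<longleftrightarrow> z = y" if "y \<in> B" "z \<in> B" for y z
  proof
    assume "int m dvd y - z"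
    moreover have "y \<in> {1..int m}" "z \<in> {1..int m}"
      using that assms(2) by blast+
    then have "\<bar>y - z\<bar> < int m"
      by auto
    ultimately show "z = y"
      using dvd_imp_le_int[of "y - z" "int m"] by force
  qed simp
  have "complex_of_real (\<Sum>j<m. (norm (\<Sum>y\<in>B. c y * e2pi (of_int y * (real j / real m))))\<^sup>2)
     = of_nat m * (\<Sum>y\<in>B. \<Sum>z\<in>B. if int m dvd y - z then c y * cnj (c z) else 0)"
    by (rule sum_norm_square_e2pi[OF fin assms(1)])
  also have "(\<Sum>y\<in>B. \<Sum>z\<in>B. if int m dvd y - z then c y * cnj (c z) else 0)
     = (\<Sum>y\<in>B. \<Sum>z\<in>B. if z = y then c y * cnj (c z) else 0)"
    using eq by (intro sum.cong refl) auto
  also have "\<dots> = (\<Sum>y\<in>B. of_real ((norm (c y))\<^sup>2))"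
    using fin by (simp add: sum.delta complex_norm_square del: of_real_power)
  finally have "complex_of_real (\<Sum>j<m. (norm (\<Sum>y\<in>B. c y * e2pi (of_int y * (real j / real m))))\<^sup>2)
     = complex_of_real (real m * (\<Sum>y\<in>B. (norm (c y))\<^sup>2))"
    by simp
  then show ?thesis
    by (simp only: of_real_eq_iff)
qed

section \<open>Distance to the nearest integer and geometric sums\<close>

definition dist_int :: "real \<Rightarrow> real" where
  "dist_int t = \<bar>t - of_int (round t)\<bar>"

lemma dist_int_nonneg [simp]: "dist_int t \<ge> 0"
  by (simp add: dist_int_def)

lemma dist_int_le: "dist_int t \<le> \<bar>t - of_int n\<bar>"
  by (simp add: dist_int_def round_diff_minimal)

lemma dist_int_le_add: "dist_int s \<le> dist_int t + \<bar>s - t\<bar>"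
  using dist_int_le[of s "round t"] unfolding dist_int_def by linarith

lemma dist_int_add_of_int [simp]: "dist_int (t + of_int n) = dist_int t"
proof -
  have "dist_int (t + of_int n) \<le> dist_int t"
    using dist_int_le[of "t + of_int n" "round t + n"] by (simp add: dist_int_def)
  moreover have "dist_int t \<le> dist_int (t + of_int n)"
    using dist_int_le[of t "round (t + of_int n) - n"] by (simp add: dist_int_def algebra_simps)
  ultimately show ?thesis by simp
qed

lemma sin_pi_ge:
  assumes "0 \<le> t" "t \<le> 1 / 2"
  shows "sin (pi * t) \<ge> t"
proof -
  define x where "x = pi * t"
  have x: "0 \<le> x" "x \<le> 2"
    using assms pi_less_4 mult_mono[of pi 4 t "1/2"] by (auto simp: x_def)
  have "\<bar>sin x - (\<Sum>m<3. sin_coeff m * x ^ m)\<bar> \<le> inverse (fact 3) * \<bar>x\<bar> ^ 3"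
    by (rule Maclaurin_sin_bound)
  then have "\<bar>sin x - x\<bar> \<le> x ^ 3 / 6"
    using x by (simp add: sin_coeff_def numeral_3_eq_3 fact_numeral)
  moreover have "x ^ 3 \<le> 4 * x"
    using x mult_mono[of x 2 x 2] mult_right_mono[of "x*x" 4 x] by (simp add: power3_eq_cube)
  ultimately have "sin x \<ge> x / 3" by linarith
  moreover have "x \<ge> 3 * t"
    using assms pi_gt3 mult_right_mono[of 3 pi t] by (simp add: x_def)
  ultimately show ?thesis
    unfolding x_def by linarith
qed

lemma norm_e2pi_minus_1: "norm (e2pi t - 1) = 2 * \<bar>sin (pi * t)\<bar>"
  using dist_exp_i_1[of "2 * pi * t"] by (simp add: e2pi_def cis_conv_exp)

lemma norm_e2pi_minus_1_ge: "norm (e2pi t - 1) \<ge> 2 * dist_int t"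
proof -
  define s where "s = t - of_int (round t)"
  have s: "\<bar>s\<bar> \<le> 1/2"
    unfolding s_def using of_int_round_abs_le[of t] by (simp add: abs_minus_commute)
  have "e2pi t = e2pi s"
    using e2pi_add_int[of "- of_int (round t)" t] by (simp add: s_def)
  moreover have "\<bar>sin (pi * s)\<bar> = \<bar>sin (pi * \<bar>s\<bar>)\<bar>"
    by (simp add: abs_if)
  moreover have "sin (pi * \<bar>s\<bar>) \<ge> \<bar>s\<bar>"
    using s by (intro sin_pi_ge) auto
  ultimately show ?thesis
    unfolding dist_int_def s_def[symmetric] by (simp add: norm_e2pi_minus_1)
qed

lemma norm_e2pi_minus_1_le: "norm (e2pi t - 1) \<le> 2 * pi * \<bar>t\<bar>"
  using abs_sin_x_le_abs_x[of "pi * t"] by (simp add: norm_e2pi_minus_1 abs_mult)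

text \<open>The case distinction avoids the junk value \<open>1 / 0 = 0\<close> of \<open>min K (1 / dist_int t)\<close> at integers.\<close>

definition kernel_bound :: "real \<Rightarrow> real \<Rightarrow> real" where
  "kernel_bound K t = (if K * dist_int t \<le> 1 then K else 1 / dist_int t)"

lemma kernel_bound_nonneg: "K \<ge> 0 \<Longrightarrow> kernel_bound K t \<ge> 0"
  by (simp add: kernel_bound_def)

lemma kernel_bound_le: "K \<ge> 0 \<Longrightarrow> kernel_bound K t \<le> K"
  by (auto simp: kernel_bound_def field_simps)
     (smt (verit) dist_int_nonneg divide_le_eq mult.commute)

lemma kernel_bound_le_divide:
  assumes "0 < d" "d \<le> dist_int t"
  shows "kernel_bound K t \<le> 1 / d"
proof (cases "K * dist_int t \<le> 1")
  case True
  then have "K \<le> 1 / dist_int t"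
    using assms by (simp add: field_simps)
  also have "\<dots> \<le> 1 / d"
    using assms by (simp add: field_simps)
  finally show ?thesis
    using True by (simp add: kernel_bound_def)
next
  case False
  then show ?thesis
    using assms by (simp add: kernel_bound_def field_simps)
qed

lemma norm_geometric_e2pi_le:
  assumes "real n \<le> K"
  shows "norm (\<Sum>m<n. e2pi (real m * t)) \<le> kernel_bound K t"
proof (cases "K * dist_int t \<le> 1")
  case True
  have "norm (\<Sum>m<n. e2pi (real m * t)) \<le> (\<Sum>m<n. norm (e2pi (real m * t)))"
    by (rule norm_sum)
  then show ?thesis
    using True assms by (simp add: kernel_bound_def)
next
  case False
  then have pos: "dist_int t > 0"
    using dist_int_nonneg[of t] by (cases "dist_int t = 0") (auto simp: less_le)
  define z where "z = e2pi t"
  have ge: "norm (z - 1) \<ge> 2 * dist_int t"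
    unfolding z_def by (rule norm_e2pi_minus_1_ge)
  then have "z \<noteq> 1"
    using pos by auto
  have "norm (\<Sum>m<n. e2pi (real m * t)) = norm (\<Sum>m<n. z ^ m)"
    by (simp add: z_def e2pi_power)
  also have "\<dots> = norm (z ^ n - 1) / norm (z - 1)"
    using \<open>z \<noteq> 1\<close> by (simp add: geometric_sum norm_divide)
  also have "\<dots> \<le> 2 / norm (z - 1)"
    using norm_triangle_ineq4[of "z ^ n" 1] by (intro divide_right_mono) (simp_all add: z_def norm_power)
  also have "\<dots> \<le> 2 / (2 * dist_int t)"
    using ge pos by (intro divide_left_mono mult_pos_pos) auto
  also have "\<dots> = kernel_bound K t"
    using False by (simp add: kernel_bound_def)
  finally show ?thesis .
qed

section \<open>Weyl's inequality for squares\<close>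

lemma harm_le_ln: "n > 0 \<Longrightarrow> harm n \<le> 1 + ln (real n)"
proof (induction n rule: nat_induct_non_zero)
  case 1
  then show ?case by (simp add: harm_expand)
next
  case (Suc n)
  have "harm (Suc n) - ln (Suc n) \<le> harm (Suc (n - 1)) - ln (Suc (n - 1))"
    using decseq_harm_diff_ln[THEN decseqD, of "n - 1" n] by simp
  with Suc show ?case by simp
qed

text \<open>The point lies in the cell between \<open>t / q\<close> and \<open>(t + 1) / q\<close>:
  there are \<open>t\<close> full cells between it and 0, and \<open>q - 1 - t\<close> between it
  and 1.\<close>

lemma dist_int_ge_fraction:
  assumes "t < q" "0 \<le> \<rho>" "\<rho> \<le> 1 / real q"
  shows "dist_int (real t / real q + \<rho>) \<ge> real (min t (q - 1 - t)) / real q"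
proof -
  have q: "real q > 0" using assms by simp
  define y where "y = real t / real q + \<rho>"
  define n where "n = round y"
  have y: "real t / real q \<le> y" "y \<le> (real t + 1) / real q"
    using assms by (auto simp: y_def add_divide_distrib)
  show ?thesis
  proof (cases "n \<le> 0")
    case True
    then have "real_of_int n \<le> 0" by simp
    moreover have "real (min t (q - 1 - t)) / real q \<le> real t / real q"
      by (intro divide_right_mono) auto
    ultimately have "real (min t (q - 1 - t)) / real q \<le> y - of_int n"
      using y by linarith
    then show ?thesis unfolding dist_int_def n_def y_def by linarith
  next
    case False
    then have "1 \<le> real_of_int n" by simp
    moreover have "real (min t (q - 1 - t)) \<le> real q - 1 - real t"
      using assms(1) by (auto simp: min_def of_nat_diff)
    then have "real (min t (q - 1 - t)) / real q \<le> (real q - 1 - real t) / real q"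
      by (rule divide_right_mono) simp
    moreover have "(real q - 1 - real t) / real q = 1 - (real t + 1) / real q"
      using q by (simp add: field_simps)
    ultimately have "real (min t (q - 1 - t)) / real q \<le> of_int n - y"
      using y by linarith
    then show ?thesis unfolding dist_int_def n_def y_def by linarith
  qed
qed

lemma sum_shifted_reciprocals:
  assumes "q > 0" "K \<ge> 0"
  shows "(\<Sum>t<q. if t \<le> 1 then K else real q / real (t - 1)) \<le> 2 * K + real q * (1 + ln (real q))"
proof -
  have "(\<Sum>t<q. if t \<le> 1 then K else real q / real (t - 1))
      \<le> (\<Sum>t\<in>{0,1} \<union> {2..q}. if t \<le> 1 then K else real q / real (t - 1))"
    using assms by (intro sum_mono2) (auto simp: le_Suc_eq numeral_2_eq_2)
  also have "\<dots> = 2 * K + (\<Sum>t\<in>{2..q}. if t \<le> 1 then K else real q / real (t - 1))"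
    by (subst sum.union_disjoint) auto
  also have "(\<Sum>t\<in>{2..q}. if t \<le> 1 then K else real q / real (t - 1)) = (\<Sum>t\<in>{2..q}. real q / real (t - 1))"
    by (intro sum.cong) auto
  also have "\<dots> = (\<Sum>t\<in>{1..q - 1}. real q / real t)"
    by (rule sum.reindex_bij_witness[of _ "\<lambda>t. t + 1" "\<lambda>t. t - 1"]) auto
  also have "\<dots> \<le> (\<Sum>t\<in>{1..q}. real q / real t)"
    by (intro sum_mono2) auto
  also have "\<dots> = real q * harm q"
    by (simp add: harm_def sum_distrib_left divide_inverse)
  also have "\<dots> \<le> real q * (1 + ln (real q))"
    using harm_le_ln[OF assms(1)] by (intro mult_left_mono) auto
  finally show ?thesis by simp
qed

text \<open>Since \<open>a\<close> is coprime to \<open>q\<close>, the points with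
  \<open>a / q\<close> in place of \<theta> occupy each cell of length \<open>1 / q\<close> exactly
  once, and the replacement moves a point by at most one cell. Two cells at each end are then too
  close to an integer for a reciprocal bound; they account for \<open>4 * K\<close>.\<close>

lemma sum_kernel_bound_block:
  fixes a :: int and q :: nat
  assumes "q > 0" "coprime a (int q)" "\<bar>\<theta> - of_int a / real q\<bar> \<le> 1 / (real q)\<^sup>2" "K \<ge> 0"
  shows "(\<Sum>r<q. kernel_bound K (\<gamma> + real r * \<theta>)) \<le> 4 * K + 2 * real q * (1 + ln (real q))"
proof -
  let ?x = "\<lambda>r. \<gamma> + real r * \<theta>"
  have q: "real q > 0" using assms by simp
  define u where "u = \<lfloor>real q * \<gamma>\<rfloor>"
  define \<rho> where "\<rho> = \<gamma> - of_int u / real q"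
  have \<rho>: "0 \<le> \<rho>" "\<rho> \<le> 1 / real q"
  proof -
    have "of_int u \<le> real q * \<gamma>" "real q * \<gamma> \<le> of_int u + 1"
      unfolding u_def by linarith+
    moreover have "\<rho> * real q = real q * \<gamma> - of_int u"
      using q by (simp add: \<rho>_def left_diff_distrib)
    ultimately have "0 \<le> \<rho> * real q" "\<rho> * real q \<le> 1"
      by linarith+
    then show "0 \<le> \<rho>" "\<rho> \<le> 1 / real q"
      using q by (simp_all add: zero_le_mult_iff pos_le_divide_eq)
  qed
  define T where "T r = nat ((u + int r * a) mod int q)" for r
  define \<phi> where "\<phi> t = (if t \<le> 1 then K else real q / real (t - 1))" for t :: nat
  have \<phi>_nonneg: "\<phi> t \<ge> 0" for t
    using assms(4) by (simp add: \<phi>_def)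
  have T_less: "T r < q" for r
    using assms(1) by (simp add: T_def nat_less_iff)
  have T_eq: "int (T r) = (u + int r * a) mod int q" for r
    using assms(1) by (simp add: T_def)
  have inj: "inj_on T {..<q}"
  proof (rule inj_onI)
    fix r s assume rs: "r \<in> {..<q}" "s \<in> {..<q}" "T r = T s"
    then have "(u + int r * a) mod int q = (u + int s * a) mod int q"
      by (metis T_eq)
    then have "int q dvd (u + int r * a) - (u + int s * a)"
      by (rule mod_eq_dvd_iff[THEN iffD1])
    then have "int q dvd a * (int r - int s)"
      by (simp add: algebra_simps)
    then have "int q dvd int r - int s"
      using assms(2) by (simp add: coprime_dvd_mult_right_iff coprime_commute)
    moreover have "\<bar>int r - int s\<bar> < int q"
      using rs by auto
    ultimately show "r = s"
      using dvd_imp_le_int[of "int r - int s" "int q"] by force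
  qed
  then have img: "T ` {..<q} = {..<q}"
    using T_less by (intro endo_inj_surj) auto
  have bound: "kernel_bound K (?x r) \<le> \<phi> (min (T r) (q - 1 - T r))" if r: "r < q" for r
  proof -
    define s where "s = min (T r) (q - 1 - T r)"
    define c where "c = (u + int r * a) div int q"
    have uc: "u + int r * a = c * int q + int (T r)"
      unfolding c_def T_eq by simp
    have eq: "\<gamma> + real r * (of_int a / real q) = (real (T r) / real q + \<rho>) + of_int c"
    proof -
      have "real_of_int (u + int r * a) = of_int c * real q + real (T r)"
        unfolding uc by simp
      then show ?thesis
        using q by (simp add: \<rho>_def field_simps)
    qed
    have "real s / real q \<le> dist_int (real (T r) / real q + \<rho>)"
      unfolding s_def by (rule dist_int_ge_fraction[OF T_less \<rho>])
    also have "\<dots> = dist_int (\<gamma> + real r * (of_int a / real q))"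
      unfolding eq by simp
    also have "\<dots> \<le> dist_int (?x r) + \<bar>\<gamma> + real r * (of_int a / real q) - (?x r)\<bar>"
      by (rule dist_int_le_add)
    also have "\<bar>\<gamma> + real r * (of_int a / real q) - (?x r)\<bar> = real r * \<bar>\<theta> - of_int a / real q\<bar>"
    proof -
      have "\<gamma> + real r * (of_int a / real q) - (?x r) = real r * (of_int a / real q - \<theta>)"
        by (simp add: algebra_simps)
      then show ?thesis
        by (simp add: abs_mult abs_minus_commute)
    qed
    also have "\<dots> \<le> real q * (1 / (real q)\<^sup>2)"
      using r assms(3) by (intro mult_mono) auto
    also have "\<dots> = 1 / real q"
      using q by (simp add: power2_eq_square)
    finally have ge: "dist_int (?x r) \<ge> (real s - 1) / real q"
      by (simp add: diff_divide_distrib)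
    show ?thesis
    proof (cases "s \<le> 1")
      case True
      then show ?thesis
        using kernel_bound_le[OF assms(4)] by (simp add: \<phi>_def s_def)
    next
      case False
      then have "kernel_bound K (?x r) \<le> 1 / ((real s - 1) / real q)"
        using ge q by (intro kernel_bound_le_divide) auto
      also have "\<dots> = \<phi> s"
        using False by (simp add: \<phi>_def of_nat_diff)
      finally show ?thesis unfolding s_def .
    qed
  qed
  have "(\<Sum>r<q. kernel_bound K (?x r)) \<le> (\<Sum>r<q. \<phi> (min (T r) (q - 1 - T r)))"
    using bound by (intro sum_mono) auto
  also have "\<dots> = (\<Sum>t\<in>T ` {..<q}. \<phi> (min t (q - 1 - t)))"
    using inj by (simp add: sum.reindex)
  also have "\<dots> = (\<Sum>t<q. \<phi> (min t (q - 1 - t)))"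
    unfolding img ..
  also have "\<dots> \<le> (\<Sum>t<q. \<phi> t + \<phi> (q - 1 - t))"
    using \<phi>_nonneg by (intro sum_mono) (auto simp: min_def)
  also have "\<dots> = (\<Sum>t<q. \<phi> t) + (\<Sum>t<q. \<phi> (q - 1 - t))"
    by (rule sum.distrib)
  also have "(\<Sum>t<q. \<phi> (q - 1 - t)) = (\<Sum>t<q. \<phi> t)"
    using sum.nat_diff_reindex[of \<phi> q] by simp
  also have "(\<Sum>t<q. \<phi> t) + (\<Sum>t<q. \<phi> t) \<le> 2 * (2 * K + real q * (1 + ln (real q)))"
    using sum_shifted_reciprocals[OF assms(1,4)] unfolding \<phi>_def by simp
  finally show ?thesis by simp
qed

lemma sum_kernel_bound:
  fixes a :: int and q H :: nat
  assumes "q > 0" "coprime a (int q)" "\<bar>\<theta> - of_int a / real q\<bar> \<le> 1 / (real q)\<^sup>2" "K \<ge> 0"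
  shows "(\<Sum>h=1..H. kernel_bound K (real h * \<theta>))
     \<le> (real H / real q + 1) * (4 * K + 2 * real q * (1 + ln (real q)))"
proof -
  let ?k = "\<lambda>h. kernel_bound K (real (h + 1) * \<theta>)"
  define nb where "nb = H div q + 1"
  define C where "C = 4 * K + 2 * real q * (1 + ln (real q))"
  have C: "C \<ge> 0"
    using assms by (auto simp: C_def)
  have "(\<Sum>h=1..H. kernel_bound K (real h * \<theta>)) = (\<Sum>h<H. ?k h)"
    by (rule sum.reindex_bij_witness[of _ "\<lambda>h. h + 1" "\<lambda>h. h - 1"]) auto
  also have "\<dots> \<le> (\<Sum>h<nb * q. ?k h)"
  proof -
    have "H < nb * q"
      using dividend_less_div_times[OF assms(1), of H] by (simp add: nb_def)
    then show ?thesis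
      using assms(4) by (intro sum_mono2) (auto intro: kernel_bound_nonneg)
  qed
  also have "\<dots> = (\<Sum>i<nb. \<Sum>h\<in>{i * q..<i * q + q}. ?k h)"
    by (simp add: sum.nat_group)
  also have "\<dots> = (\<Sum>i<nb. \<Sum>r<q. kernel_bound K (real (i * q + 1) * \<theta> + real r * \<theta>))"
  proof (rule sum.cong[OF refl])
    fix i
    show "(\<Sum>h\<in>{i * q..<i * q + q}. ?k h)
       = (\<Sum>r<q. kernel_bound K (real (i * q + 1) * \<theta> + real r * \<theta>))"
      by (rule sum.reindex_bij_witness[of _ "\<lambda>r. i * q + r" "\<lambda>h. h - i * q"]) (auto simp: algebra_simps)
  qed
  also have "\<dots> \<le> (\<Sum>i<nb. C)"
    unfolding C_def by (intro sum_mono sum_kernel_bound_block[OF assms])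
  also have "\<dots> = real nb * C"
    by simp
  also have "\<dots> \<le> (real H / real q + 1) * C"
    using C of_nat_div_le_of_nat[of H q] by (intro mult_right_mono) (auto simp: nb_def)
  finally show ?thesis unfolding C_def .
qed

definition weyl_sum :: "nat \<Rightarrow> real \<Rightarrow> complex" where
  "weyl_sum M \<theta> = (\<Sum>n=1..M. e2pi ((real n)\<^sup>2 * \<theta>))"

lemma norm_weyl_sum_square_expand:
  "(norm (weyl_sum M \<theta>))\<^sup>2 = real M + 2 * Re (\<Sum>n=1..M. \<Sum>m\<in>{1..<n}. e2pi (((real n)\<^sup>2 - (real m)\<^sup>2) * \<theta>))"
proof (induction M)
  case 0
  then show ?case by (simp add: weyl_sum_def)
next
  case (Suc M)
  define w where "w = e2pi ((real (Suc M))\<^sup>2 * \<theta>)"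
  have "weyl_sum (Suc M) \<theta> = weyl_sum M \<theta> + w"
    by (simp add: weyl_sum_def w_def)
  moreover have "(norm (z + w))\<^sup>2 = (norm z)\<^sup>2 + 1 + 2 * Re (w * cnj z)" for z
  proof -
    have "(norm w)\<^sup>2 = 1" by (simp add: w_def)
    then show ?thesis
      unfolding cmod_power2 by (simp add: power2_eq_square algebra_simps)
  qed
  moreover have "w * cnj (weyl_sum M \<theta>) = (\<Sum>m\<in>{1..<Suc M}. e2pi (((real (Suc M))\<^sup>2 - (real m)\<^sup>2) * \<theta>))"
  proof -
    have "w * cnj (e2pi ((real m)\<^sup>2 * \<theta>)) = e2pi (((real (Suc M))\<^sup>2 - (real m)\<^sup>2) * \<theta>)" for m
      unfolding w_def cnj_e2pi by (simp add: e2pi_add[symmetric] algebra_simps)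
    then show ?thesis
      by (simp add: weyl_sum_def cnj_sum sum_distrib_left atLeastLessThanSuc_atLeastAtMost)
  qed
  moreover have "2 * Re (\<Sum>n=1..Suc M. \<Sum>m\<in>{1..<n}. e2pi (((real n)\<^sup>2 - (real m)\<^sup>2) * \<theta>))
     = 2 * Re (\<Sum>n=1..M. \<Sum>m\<in>{1..<n}. e2pi (((real n)\<^sup>2 - (real m)\<^sup>2) * \<theta>))
     + 2 * Re (\<Sum>m\<in>{1..<Suc M}. e2pi (((real (Suc M))\<^sup>2 - (real m)\<^sup>2) * \<theta>))"
    by (simp del: sum.op_ivl_Suc)
  ultimately show ?case
    using Suc.IH by (simp only: of_nat_Suc)
qed

lemma sum_pairs_by_difference:
  fixes f :: "nat \<Rightarrow> nat \<Rightarrow> 'a :: comm_monoid_add"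
  shows "(\<Sum>n=1..M. \<Sum>m\<in>{1..<n}. f n m) = (\<Sum>h=1..M. \<Sum>m<M - h. f (m + 1 + h) (m + 1))"
proof -
  have "(\<Sum>n=1..M. \<Sum>m\<in>{1..<n}. f n m) = (\<Sum>(n,m)\<in>(SIGMA n:{1..M}. {1..<n}). f n m)"
    by (simp add: sum.Sigma)
  also have "\<dots> = (\<Sum>(h,m)\<in>(SIGMA h:{1..M}. {..<M - h}). f (m + 1 + h) (m + 1))"
    by (rule sum.reindex_bij_witness[of _ "\<lambda>(h,m). (m + 1 + h, m + 1)" "\<lambda>(n,m). (n - m, m - 1)"]) auto
  also have "\<dots> = (\<Sum>h=1..M. \<Sum>m<M - h. f (m + 1 + h) (m + 1))"
    by (simp add: sum.Sigma)
  finally show ?thesis .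
qed

text \<open>Weyl differencing: for \<open>n = m + h\<close> the phase n^2 - m^2 is linear in
  \<open>m\<close>, so the inner sum is geometric with frequency \<open>2 * h * \<theta>\<close>.
  The even multiples of \<theta> are completed to all multiples up to \<open>2 * M\<close>, to which
  the block estimate applies.\<close>

lemma norm_weyl_sum_square_le_kernel:
  "(norm (weyl_sum M \<theta>))\<^sup>2 \<le> real M + 2 * (\<Sum>h=1..2*M. kernel_bound (real M) (real h * \<theta>))"
proof -
  let ?t = "\<lambda>h. real (2 * h) * \<theta>"
  let ?d = "\<lambda>n m. e2pi (((real n)\<^sup>2 - (real m)\<^sup>2) * \<theta>)"
  let ?e = "\<lambda>h m. e2pi (((real (m + 1 + h))\<^sup>2 - (real (m + 1))\<^sup>2) * \<theta>)"
  have "(norm (weyl_sum M \<theta>))\<^sup>2 = real M + 2 * Re (\<Sum>n=1..M. \<Sum>m\<in>{1..<n}. ?d n m)"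
    by (rule norm_weyl_sum_square_expand)
  also have "\<dots> \<le> real M + 2 * norm (\<Sum>n=1..M. \<Sum>m\<in>{1..<n}. ?d n m)"
    by (intro add_left_mono mult_left_mono complex_Re_le_cmod) auto
  also have "(\<Sum>n=1..M. \<Sum>m\<in>{1..<n}. ?d n m)
     = (\<Sum>h=1..M. \<Sum>m<M - h. ?e h m)"
    by (rule sum_pairs_by_difference)
  also have "norm \<dots> \<le> (\<Sum>h=1..M. norm (\<Sum>m<M - h. ?e h m))"
    by (rule norm_sum)
  also have "\<dots> \<le> (\<Sum>h=1..M. kernel_bound (real M) (?t h))"
  proof (intro sum_mono)
    fix h assume h: "h \<in> {1..M}"
    have "(\<Sum>m<M - h. ?e h m)
       = (\<Sum>m<M - h. e2pi ((2 * real h + (real h)\<^sup>2) * \<theta>) * e2pi (real m * (?t h)))"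
      by (intro sum.cong refl) (simp add: e2pi_add[symmetric] power2_eq_square algebra_simps)
    also have "norm \<dots> = norm (\<Sum>m<M - h. e2pi (real m * (?t h)))"
      by (simp add: sum_distrib_left[symmetric] norm_mult)
    also have "\<dots> \<le> kernel_bound (real M) (?t h)"
      by (rule norm_geometric_e2pi_le) simp
    finally show "norm (\<Sum>m<M - h. ?e h m)
        \<le> kernel_bound (real M) (?t h)" .
  qed
  also have "\<dots> = (\<Sum>h\<in>(\<lambda>h. 2 * h) ` {1..M}. kernel_bound (real M) (real h * \<theta>))"
    by (simp add: sum.reindex inj_on_def)
  also have "\<dots> \<le> (\<Sum>h=1..2*M. kernel_bound (real M) (real h * \<theta>))"
    by (intro sum_mono2) (auto intro: kernel_bound_nonneg)
  finally show ?thesis by simp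
qed

lemma weyl_inequality:
  fixes a :: int and q M :: nat
  assumes "q > 0" "coprime a (int q)" "\<bar>\<theta> - of_int a / real q\<bar> \<le> 1 / (real q)\<^sup>2"
  shows "(norm (weyl_sum M \<theta>))\<^sup>2
     \<le> 16 * (real M)\<^sup>2 / real q + (17 * real M + 4 * real q) * (1 + ln (real q))"
proof -
  define l where "l = 1 + ln (real q)"
  have l: "l \<ge> 1" using assms by (simp add: l_def)
  have "(norm (weyl_sum M \<theta>))\<^sup>2 \<le> real M + 2 * ((real (2 * M) / real q + 1) * (4 * real M + 2 * real q * l))"
    using norm_weyl_sum_square_le_kernel[of M \<theta>] sum_kernel_bound[OF assms, of "real M" "2 * M"]
    unfolding l_def by simp
  also have "\<dots> = 16 * (real M)\<^sup>2 / real q + 9 * real M + 8 * real M * l + 4 * real q * l"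
    using assms(1) by (simp add: field_simps power2_eq_square)
  also have "\<dots> \<le> 16 * (real M)\<^sup>2 / real q + (17 * real M + 4 * real q) * l"
    using mult_left_mono[OF l, of "9 * real M"] by (simp add: algebra_simps)
  finally show ?thesis unfolding l_def .
qed

section \<open>The circle method\<close>

definition exp_sum :: "int set \<Rightarrow> real \<Rightarrow> complex" where
  "exp_sum B \<theta> = (\<Sum>y\<in>B. e2pi (of_int y * \<theta>))"

definition mean_kernel :: "nat \<Rightarrow> real \<Rightarrow> complex" where
  "mean_kernel N t = (\<Sum>s<N. e2pi (real s * t)) / of_nat N"

abbreviation sq_diff_free :: "int set \<Rightarrow> bool" where
  "sq_diff_free A \<equiv> \<not> (\<exists>a1\<in>A. \<exists>a2\<in>A. \<exists>n::int. n > 0 \<and> a1 - a2 = n ^ 2)"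

definition window :: "nat \<Rightarrow> int \<Rightarrow> int set" where
  "window N x = {x - int N<..x}"

lemma finite_window [simp]: "finite (window N x)"
  by (simp add: window_def)

abbreviation local_energy :: "nat \<Rightarrow> int set \<Rightarrow> real \<Rightarrow> real" where
  "local_energy N B \<theta> \<equiv> (norm (exp_sum B \<theta> / of_nat N))\<^sup>2"

text \<open>The phases turn by at most \<open>2 * pi * N / D \<le> 8 / 32\<close>, so the kernel is
  within 1/4 of 1.\<close>

lemma norm_mean_kernel_ge:
  assumes "N > 0" "\<bar>t - of_int n\<bar> \<le> 1 / real D" "32 * N \<le> D"
  shows "(norm (mean_kernel N t))\<^sup>2 \<ge> 1 / 2"
proof -
  define u where "u = t - of_int n"
  have "e2pi (real s * t) = e2pi (real s * u)" for s
    using e2pi_add_int[of "of_int (- (int s * n))" "real s * t"] by (simp add: u_def algebra_simps)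
  then have "mean_kernel N t - 1 = (\<Sum>s<N. e2pi (real s * u) - 1) / of_nat N"
    using assms(1) by (simp add: mean_kernel_def sum_subtractf diff_divide_distrib)
  then have "norm (mean_kernel N t - 1) = norm (\<Sum>s<N. e2pi (real s * u) - 1) / real N"
    by (simp add: norm_divide)
  also have "\<dots> \<le> (\<Sum>s<N. norm (e2pi (real s * u) - 1)) / real N"
    by (intro divide_right_mono norm_sum) simp
  also have "\<dots> \<le> (\<Sum>s<N. 1 / 4) / real N"
  proof (intro divide_right_mono sum_mono)
    fix s assume s: "s \<in> {..<N}"
    have D: "real D > 0" using assms by linarith
    have "norm (e2pi (real s * u) - 1) \<le> 2 * pi * \<bar>real s * u\<bar>"
      by (rule norm_e2pi_minus_1_le)
    also have "\<dots> \<le> 2 * 4 * (real N * (1 / real D))"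
      unfolding abs_mult using s assms(2) pi_less_4
      by (intro mult_mono mult_nonneg_nonneg) (auto simp: u_def)
    also have "\<dots> \<le> 1 / 4"
      using assms(3) D by (simp add: field_simps)
    finally show "norm (e2pi (real s * u) - 1) \<le> 1 / 4" .
  qed simp
  also have "\<dots> = 1 / 4"
    using assms(1) by simp
  finally have "norm (mean_kernel N t - 1) \<le> 1 / 4" .
  then have "norm (mean_kernel N t) \<ge> 3 / 4"
    using norm_triangle_ineq2[of 1 "1 - mean_kernel N t"] by (simp add: norm_minus_commute)
  then have "(norm (mean_kernel N t))\<^sup>2 \<ge> (3 / 4)\<^sup>2"
    by (intro power_mono) auto
  then show ?thesis by (simp add: power2_eq_square)
qed

text \<open>Multiplying the transform of \<open>A\<close> by the kernel centred at \<theta> is a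
  convolution: it gives the transform of the window sums of \<open>A\<close> twisted by \<theta>.
  Only windows with right end between 1 and \<open>X + N - 1\<close> meet \<open>A\<close>, so the
  condition on \<open>R\<close> keeps them all in one period and nothing wraps around.\<close>

lemma parseval_window:
  assumes A: "A \<subseteq> {1..int X}" and "N > 0" "R > 0" "X + N \<le> R + 1"
  shows "(\<Sum>j<R. (norm (exp_sum A (real j / real R)))\<^sup>2 * (norm (mean_kernel N (real j / real R - \<theta>)))\<^sup>2)
       = real R * (\<Sum>x\<in>{1..int R}. local_energy N (A \<inter> window N x) \<theta>)"
proof -
  let ?E = "\<Sum>x\<in>{1..int R}. local_energy N (A \<inter> window N x) \<theta>"
  have fin: "finite A" using A finite_subset by blast
  define c where "c x = (\<Sum>y\<in>A \<inter> window N x. e2pi (of_int y * \<theta>)) * e2pi (- of_int x * \<theta>) / of_nat N" for x :: int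
  have "exp_sum A t * mean_kernel N (t - \<theta>) = (\<Sum>x\<in>{1..int R}. c x * e2pi (of_int x * t))" for t
  proof -
    have "exp_sum A t * mean_kernel N (t - \<theta>)
        = (\<Sum>y\<in>A. \<Sum>s<N. e2pi (of_int y * t) * e2pi (real s * (t - \<theta>)) / of_nat N)"
      by (simp add: exp_sum_def mean_kernel_def sum_product sum_divide_distrib)
    also have "\<dots> = (\<Sum>(y,s)\<in>A \<times> {..<N}. e2pi (of_int y * t) * e2pi (real s * (t - \<theta>)) / of_nat N)"
      by (rule sum.cartesian_product)
    also have "\<dots> = (\<Sum>(x,y)\<in>(SIGMA x:{1..int R}. A \<inter> window N x).
        e2pi (of_int y * \<theta>) * e2pi (- of_int x * \<theta>) * e2pi (of_int x * t) / of_nat N)"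
    proof (rule sum.reindex_bij_witness[of _ "\<lambda>(x,y). (y, nat (x - y))" "\<lambda>(y,s). (y + int s, y)"])
      fix p assume p: "p \<in> A \<times> {..<N}"
      then obtain y s where ys: "p = (y,s)" "y \<in> A" "s < N" by auto
      with A have "1 \<le> y" "y \<le> int X" by auto
      with ys assms show "(case p of (y,s) \<Rightarrow> (y + int s, y)) \<in> (SIGMA x:{1..int R}. A \<inter> window N x)"
        by (auto simp: window_def)
      show "(case (case p of (y,s) \<Rightarrow> (y + int s, y)) of (x,y) \<Rightarrow>
          e2pi (of_int y * \<theta>) * e2pi (- of_int x * \<theta>) * e2pi (of_int x * t) / of_nat N)
        = (case p of (y,s) \<Rightarrow> e2pi (of_int y * t) * e2pi (real s * (t - \<theta>)) / of_nat N)"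
        unfolding ys by (simp add: e2pi_add[symmetric] algebra_simps)
    qed (auto simp: window_def)
    also have "\<dots> = (\<Sum>x\<in>{1..int R}. \<Sum>y\<in>A \<inter> window N x.
        e2pi (of_int y * \<theta>) * e2pi (- of_int x * \<theta>) * e2pi (of_int x * t) / of_nat N)"
      using fin by (simp add: sum.Sigma)
    also have "\<dots> = (\<Sum>x\<in>{1..int R}. c x * e2pi (of_int x * t))"
      by (simp add: c_def sum_distrib_right sum_divide_distrib)
    finally show ?thesis .
  qed
  then have "(\<Sum>j<R. (norm (exp_sum A (real j / real R)))\<^sup>2 * (norm (mean_kernel N (real j / real R - \<theta>)))\<^sup>2)
     = (\<Sum>j<R. (norm (\<Sum>x\<in>{1..int R}. c x * e2pi (of_int x * (real j / real R))))\<^sup>2)"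
    by (simp only: norm_mult[symmetric] power_mult_distrib[symmetric])
  also have "\<dots> = real R * (\<Sum>x\<in>{1..int R}. (norm (c x))\<^sup>2)"
    by (rule parseval_e2pi) (use assms in auto)
  also have "\<dots> = real R * ?E"
    by (simp add: c_def exp_sum_def norm_mult norm_divide)
  finally show ?thesis .
qed

text \<open>Orthogonality modulo \<open>R\<close> counts the solutions of \<open>z - y = n^2\<close>
  as a congruence. The period \<open>X + M^2\<close> exceeds every absolute value of
  \<open>y - z + n^2\<close>, so a congruence would be an equation.\<close>

lemma sum_exp_sum_weyl_eq_0:
  assumes A: "A \<subseteq> {1..int X}" and "M > 0" "X > 0"
    and no_sq: "sq_diff_free A"
  defines "R \<equiv> X + M\<^sup>2"
  shows "(\<Sum>j<R. of_real ((norm (exp_sum A (real j / real R)))\<^sup>2) * weyl_sum M (real j / real R)) = 0"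
proof -
  let ?S = "\<lambda>j. weyl_sum M (real j / real R)"
  let ?e = "\<lambda>j y z n. e2pi (real j * (of_int (y - z + (int n)\<^sup>2) / real R))"
  have fin: "finite A" using A finite_subset by blast
  have R: "R > 0" using assms by (simp add: R_def)
  have sq: "of_real ((norm (exp_sum A t))\<^sup>2) = (\<Sum>y\<in>A. \<Sum>z\<in>A. e2pi (of_int (y - z) * t))" for t
    using norm_sum_square_e2pi[OF fin, of "\<lambda>_. 1" t] by (simp add: exp_sum_def del: of_real_power)
  have "(\<Sum>j<R. of_real ((norm (exp_sum A (real j / real R)))\<^sup>2) * ?S j)
     = (\<Sum>j<R. (\<Sum>y\<in>A. \<Sum>z\<in>A. e2pi (of_int (y - z) * (real j / real R))) * ?S j)"
    by (simp only: sq)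
  also have "\<dots> = (\<Sum>j<R. \<Sum>y\<in>A. \<Sum>z\<in>A. \<Sum>n=1..M. ?e j y z n)"
    unfolding sum_distrib_right unfolding weyl_sum_def sum_distrib_left
    by (intro sum.cong refl) (simp add: e2pi_add[symmetric] add_divide_distrib diff_divide_distrib algebra_simps)
  also have "\<dots> = (\<Sum>y\<in>A. \<Sum>j<R. \<Sum>z\<in>A. \<Sum>n=1..M. ?e j y z n)"
    by (rule sum.swap)
  also have "\<dots> = (\<Sum>y\<in>A. \<Sum>z\<in>A. \<Sum>j<R. \<Sum>n=1..M. ?e j y z n)"
    by (rule sum.cong[OF refl], rule sum.swap)
  also have "\<dots> = (\<Sum>y\<in>A. \<Sum>z\<in>A. \<Sum>n=1..M. \<Sum>j<R. ?e j y z n)"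
    by (rule sum.cong[OF refl], rule sum.cong[OF refl], rule sum.swap)
  also have "\<dots> = (\<Sum>y\<in>A. \<Sum>z\<in>A. \<Sum>n=1..M. 0)"
  proof (rule sum.cong[OF refl], rule sum.cong[OF refl], rule sum.cong[OF refl])
    fix y z n assume yz: "y \<in> A" "z \<in> A" and n: "n \<in> {1..M}"
    have "\<not> int R dvd y - z + (int n)\<^sup>2"
    proof
      assume dvd: "int R dvd y - z + (int n)\<^sup>2"
      have "y \<in> {1..int X}" "z \<in> {1..int X}" using A yz by blast+
      then have "1 \<le> y" "y \<le> int X" "1 \<le> z" "z \<le> int X" by auto
      moreover have "0 < (int n)\<^sup>2" "(int n)\<^sup>2 \<le> (int M)\<^sup>2"
        using n by (auto intro: power_mono)
      ultimately have "\<bar>y - z + (int n)\<^sup>2\<bar> < int R"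
        unfolding R_def of_nat_add of_nat_power by linarith
      then have "y - z + (int n)\<^sup>2 = 0"
        using dvd dvd_imp_le_int[of "y - z + (int n)\<^sup>2" "int R"] by force
      then have "z - y = (int n)\<^sup>2" by simp
      moreover have "int n > 0" using n by auto
      ultimately show False
        using no_sq yz by blast
    qed
    then show "(\<Sum>j<R. ?e j y z n) = 0"
      unfolding sum_e2pi_full_period[OF R] by simp
  qed
  finally show ?thesis by simp
qed

text \<open>The frequency 0 carries the expected number of square differences; as there are none,
  the other frequencies must cancel it.\<close>

lemma card_square_le_sum_weyl:
  assumes A: "A \<subseteq> {1..int X}" and "M > 0" "X > 0"
    and no_sq: "sq_diff_free A"
  defines "R \<equiv> X + M\<^sup>2"
  shows "real M * (real (card A))\<^sup>2
     \<le> (\<Sum>j\<in>{1..<R}. (norm (exp_sum A (real j / real R)))\<^sup>2 * norm (weyl_sum M (real j / real R)))"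
proof -
  define F where "F j = of_real ((norm (exp_sum A (real j / real R)))\<^sup>2) * weyl_sum M (real j / real R)" for j
  have "R > 0" using assms by simp
  then have "{..<R} = insert 0 {1..<R}" by auto
  then have "(\<Sum>j<R. F j) = F 0 + (\<Sum>j\<in>{1..<R}. F j)" by simp
  then have "F 0 = - (\<Sum>j\<in>{1..<R}. F j)"
    using sum_exp_sum_weyl_eq_0[OF assms(1-4)] unfolding F_def R_def
    by (simp add: add_eq_0_iff)
  then have "norm (F 0) \<le> (\<Sum>j\<in>{1..<R}. norm (F j))"
    using norm_sum[of F "{1..<R}"] by simp
  moreover have "norm (F 0) = real M * (real (card A))\<^sup>2"
    by (simp add: F_def exp_sum_def weyl_sum_def norm_mult norm_power)
  moreover have "norm (F j) = (norm (exp_sum A (real j / real R)))\<^sup>2 * norm (weyl_sum M (real j / real R))" for j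
    by (simp add: F_def norm_mult norm_power)
  ultimately show ?thesis by simp
qed

text \<open>Dirichlet's theorem supplies a denominator up to \<open>D\<close>. Beyond
  \<open>Q\<close> Weyl's bound is at most \<open>24 * M^2 / Q\<close>, which the constant
  \<open>1536 = 24 * 64\<close> turns into the square of \<open>\<alpha> * M / 8\<close>. Up to
  \<open>Q\<close> the same two terms are at most \<open>24 * M^2 / q\<close>, and 24 is rounded up
  to the square of 6.\<close>

lemma weyl_dichotomy:
  fixes \<alpha> \<theta> :: real and M Q D X :: nat
  assumes "0 < \<alpha>" "D > 0" "M > 0" "D \<le> X" "1536 \<le> real Q * \<alpha>\<^sup>2"
    and D: "real D * (1 + ln (real X)) * real Q \<le> (real M)\<^sup>2"
    and M: "17 * (1 + ln (real X)) * real Q \<le> 4 * real M"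
  shows "norm (weyl_sum M \<theta>) \<le> \<alpha> * real M / 8 \<or>
    (\<exists>q\<in>{1..Q}. \<exists>a<q. \<exists>n::int. coprime a q \<and> \<bar>\<theta> - real a / real q - of_int n\<bar> \<le> 1 / real D
        \<and> norm (weyl_sum M \<theta>) \<le> 6 * real M / sqrt (real q))"
proof -
  let ?S = "norm (weyl_sum M \<theta>)"
  obtain h k where hk: "coprime h k" "0 < k" "k \<le> int D" "\<bar>of_int k * \<theta> - of_int h\<bar> < 1 / real D"
    using Dirichlet_approx_coprime[OF assms(2)] by blast
  define q where "q = nat k"
  have k: "k = int q" "q > 0" "q \<le> D" using hk by (auto simp: q_def)
  have rq: "real q \<ge> 1" "real q \<le> real D" using k by auto
  have D0: "real D > 0" using assms by simp
  have dist: "\<bar>\<theta> - of_int h / real q\<bar> \<le> 1 / (real q * real D)"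
  proof -
    have "\<bar>\<theta> - of_int h / real q\<bar> = \<bar>real q * \<theta> - of_int h\<bar> / real q"
      using rq by (simp add: field_simps abs_if)
    also have "\<dots> \<le> (1 / real D) / real q"
      using hk(4) k(1) by (intro divide_right_mono) auto
    finally show ?thesis by (simp add: mult.commute)
  qed
  also have "1 / (real q * real D) \<le> 1 / (real q)\<^sup>2"
    unfolding power2_eq_square using rq D0 by (intro divide_left_mono mult_left_mono) auto
  finally have "(?S)\<^sup>2
     \<le> 16 * (real M)\<^sup>2 / real q + (17 * real M + 4 * real q) * (1 + ln (real q))"
    using hk(1) k by (intro weyl_inequality[where a = h]) auto
  also have "(17 * real M + 4 * real q) * (1 + ln (real q)) \<le> (17 * real M + 4 * real D) * (1 + ln (real X))"
    using rq assms(4) by (intro mult_mono add_mono) auto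
  also have "\<dots> \<le> 8 * (real M)\<^sup>2 / real Q"
  proof -
    have Q: "real Q > 0" using assms(1,5) by (cases "Q = 0") auto
    have "(17 * real M + 4 * real D) * (1 + ln (real X)) * real Q
       = real M * (17 * (1 + ln (real X)) * real Q) + 4 * (real D * (1 + ln (real X)) * real Q)"
      by (simp add: algebra_simps)
    also have "\<dots> \<le> real M * (4 * real M) + 4 * (real M)\<^sup>2"
      using M D by (intro add_mono mult_left_mono) auto
    also have "\<dots> = 8 * (real M)\<^sup>2" by (simp add: power2_eq_square)
    finally show ?thesis using Q by (simp add: field_simps)
  qed
  finally have S: "(?S)\<^sup>2 \<le> 16 * (real M)\<^sup>2 / real q + 8 * (real M)\<^sup>2 / real Q"
    by simp
  have Q: "real Q > 0" using assms(1,5) by (cases "Q = 0") auto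
  show ?thesis
  proof (cases "q \<le> Q")
    case False
    then have "16 * (real M)\<^sup>2 / real q \<le> 16 * (real M)\<^sup>2 / real Q"
      using Q by (intro divide_left_mono) auto
    with S have "(?S)\<^sup>2 \<le> 24 * (real M)\<^sup>2 / real Q"
      by simp
    also have "24 * (real M)\<^sup>2 / real Q \<le> (\<alpha> * real M / 8)\<^sup>2"
    proof -
      have "1536 * (real M)\<^sup>2 \<le> (real Q * \<alpha>\<^sup>2) * (real M)\<^sup>2"
        using assms(5) by (intro mult_right_mono) auto
      then show ?thesis
        using Q by (simp add: field_simps power2_eq_square)
    qed
    finally have "?S \<le> \<alpha> * real M / 8"
      by (rule power2_le_imp_le) (use assms in auto)
    then show ?thesis ..
  next
    case True
    then have "8 * (real M)\<^sup>2 / real Q \<le> 8 * (real M)\<^sup>2 / real q"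
      using rq by (intro divide_left_mono) auto
    with S have "(?S)\<^sup>2 \<le> 24 * (real M)\<^sup>2 / real q"
      by simp
    also have "\<dots> \<le> (6 * real M / sqrt (real q))\<^sup>2"
      using rq by (simp add: power_divide power_mult_distrib divide_right_mono)
    finally have S6: "?S \<le> 6 * real M / sqrt (real q)"
      by (rule power2_le_imp_le) simp
    define a where "a = nat (h mod int q)"
    have a: "a < q" "int a = h mod int q"
      using k by (auto simp: a_def nat_less_iff)
    have "coprime (int a) (int q)"
      unfolding a using hk(1) k by simp
    then have cop: "coprime a q" by simp
    have "h = int a + (h div int q) * int q"
      unfolding a by simp
    then have "of_int h = real a + of_int (h div int q) * real q"
      by (metis of_int_add of_int_mult of_int_of_nat_eq)
    then have "of_int h / real q = real a / real q + of_int (h div int q)"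
      using rq by (simp add: add_divide_distrib)
    moreover have "1 / (real q * real D) \<le> 1 / real D"
      using rq D0 by (intro divide_left_mono) auto
    ultimately have "\<bar>\<theta> - real a / real q - of_int (h div int q)\<bar> \<le> 1 / real D"
      using dist by (simp add: algebra_simps)
    then show ?thesis
      using a cop S6 True k by (intro disjI2 bexI[of _ q] exI[of _ a] exI[of _ "h div int q"] conjI) auto
  qed
qed

text \<open>The frequency \<open>0\<close> is represented by the pair \<open>(1, 0)\<close>.\<close>

definition frac_pairs :: "nat \<Rightarrow> (nat \<times> nat) set" where
  "frac_pairs Q = (SIGMA q:{1..Q}. {a. a < q \<and> coprime a q})"

lemma finite_frac_pairs [simp]: "finite (frac_pairs Q)"
  by (simp add: frac_pairs_def)

abbreviation weighted_energy :: "nat \<Rightarrow> nat \<Rightarrow> int set \<Rightarrow> real" where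
  "weighted_energy Q N B \<equiv> (\<Sum>(q,a)\<in>frac_pairs Q. local_energy N B (real a / real q) / sqrt (real q))"

text \<open>Origin of 17/16: Weyl's constant 6 and the lower bound 1/2 for the squared kernel give a
  factor 12. Frequencies far from small denominators absorb a quarter of the main term; the
  remaining three quarters, divided by 12, leave 1/16. The summand 1 is the energy of the frequency
  0 itself.\<close>

lemma circle_method:
  fixes X M Q D N :: nat
  assumes A: "A \<subseteq> {1..int X}"
    and no_sq: "sq_diff_free A"
    and pos: "M > 0" "N > 0" "A \<noteq> {}"
    and M2: "M\<^sup>2 \<le> X"
    and Q: "1536 * (real X)\<^sup>2 \<le> real Q * (real (card A))\<^sup>2"
    and D: "real D * (1 + ln (real X)) * real Q \<le> (real M)\<^sup>2"
    and M: "17 * (1 + ln (real X)) * real Q \<le> 4 * real M"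
    and N: "32 * N \<le> D"
  shows "17 / 16 * (real (card A))\<^sup>2 \<le> real (X + M\<^sup>2) * (\<Sum>x\<in>{1..int (X + M\<^sup>2)}. weighted_energy Q N (A \<inter> window N x))"
proof -
  let ?A = "\<lambda>x. A \<inter> window N x"
  let ?a = "(real (card A))\<^sup>2"
  define R where "R = X + M\<^sup>2"
  have fin: "finite A" using A finite_subset by blast
  have cA: "card A > 0" using fin pos by (simp add: card_gt_0_iff)
  have X: "X > 0"
    using pos M2 by (metis gr0I le_zero_eq power_eq_0_iff zero_less_iff_neq_zero)
  have R: "R > 0" using X by (simp add: R_def)
  have Q0: "real Q \<ge> 1"
    using Q X by (cases "Q = 0") auto
  have lX: "ln (real X) \<ge> 0" using X by simp
  have DM: "real D \<le> (real M)\<^sup>2"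
  proof -
    have "real D * 1 * 1 \<le> real D * (1 + ln (real X)) * real Q"
      using lX Q0 by (intro mult_mono) auto
    then show ?thesis using D by linarith
  qed
  then have "real D \<le> real (M\<^sup>2)" by (simp only: of_nat_power)
  then have DM': "D \<le> M\<^sup>2" by linarith
  define \<alpha> where "\<alpha> = real (card A) / real X"
  have \<alpha>: "\<alpha> > 0" using cA X by (simp add: \<alpha>_def)
  have Q\<alpha>: "1536 \<le> real Q * \<alpha>\<^sup>2"
    using Q X by (simp add: \<alpha>_def power_divide field_simps)
  define f where "f j = (norm (exp_sum A (real j / real R)))\<^sup>2" for j
  define K where "K j = (\<lambda>(q,a). (norm (mean_kernel N (real j / real R - real a / real q)))\<^sup>2)" for j :: nat
  define w where "w qa = 1 / sqrt (real (fst qa))" for qa :: "nat \<times> nat"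
  define E where "E = (\<lambda>(q::nat,a::nat). real R * (\<Sum>x\<in>{1..int R}. local_energy N (?A x) (real a / real q)))"
  let ?T = "\<Sum>qa\<in>frac_pairs Q. w qa * E qa"
  let ?V = "\<lambda>j. \<Sum>qa\<in>frac_pairs Q. w qa * K j qa"
  let ?S = "\<lambda>j. weyl_sum M (real j / real R)"
  let ?U = "\<Sum>qa\<in>frac_pairs Q. w qa * (\<Sum>j\<in>{1..<R}. f j * K j qa)"

  have f_nonneg: "f j \<ge> 0" for j by (simp add: f_def)
  have K_nonneg: "K j qa \<ge> 0" for j qa by (simp add: K_def split: prod.split)
  have w_nonneg: "w qa \<ge> 0" for qa by (simp add: w_def)
  have weyl: "norm (?S j)
     \<le> \<alpha> * real M / 8 + 12 * real M * ?V j" for j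
  proof -
    have sum_nonneg: "?V j \<ge> 0"
      by (intro sum_nonneg mult_nonneg_nonneg w_nonneg K_nonneg)
    consider "norm (?S j) \<le> \<alpha> * real M / 8"
      | q a n where "q \<in> {1..Q}" "a < q" "coprime a q" "\<bar>real j / real R - real a / real q - of_int n\<bar> \<le> 1 / real D"
          "norm (?S j) \<le> 6 * real M / sqrt (real q)"
      using weyl_dichotomy[OF \<alpha> _ pos(1) _ Q\<alpha> D M, of "real j / real R"] N pos DM' M2 by auto
    then show ?thesis
    proof cases
      case 1
      then show ?thesis using sum_nonneg by (simp add: add_increasing2)
    next
      case 2
      have "1 / 2 \<le> K j (q,a)"
        using norm_mean_kernel_ge[OF pos(2) 2(4) N] by (simp add: K_def)
      have "6 * real M / sqrt (real q) = 12 * real M * (w (q,a) * (1 / 2))"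
        by (simp add: w_def)
      also have "\<dots> \<le> 12 * real M * (w (q,a) * K j (q,a))"
        using \<open>1 / 2 \<le> K j (q,a)\<close> w_nonneg by (intro mult_left_mono) auto
      also have "\<dots> \<le> 12 * real M * ?V j"
      proof (intro mult_left_mono)
        show "w (q,a) * K j (q,a) \<le> ?V j"
          using 2 by (intro member_le_sum mult_nonneg_nonneg w_nonneg K_nonneg) (auto simp: frac_pairs_def)
      qed simp
      finally show ?thesis using 2(5) \<alpha> by (simp add: add_increasing)
    qed
  qed
  have E_eq: "(\<Sum>j<R. f j * K j qa) = E qa" for qa
  proof -
    obtain q a where qa: "qa = (q,a)" by (cases qa)
    have "X + N \<le> R + 1" using N DM' by (simp add: R_def)
    then show ?thesis
      unfolding f_def K_def E_def qa using parseval_window[OF A pos(2) R] by simp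
  qed
  have split0: "(\<Sum>j<R. g j) = g 0 + (\<Sum>j\<in>{1..<R}. g j)" for g :: "nat \<Rightarrow> real"
  proof -
    have "{..<R} = insert 0 {1..<R}" using R by auto
    then show ?thesis by simp
  qed
  have f0: "f 0 = ?a" by (simp add: f_def exp_sum_def)
  have total: "(\<Sum>j\<in>{1..<R}. f j) \<le> real R * real (card A)"
  proof -
    have "int X \<le> int R" by (simp add: R_def)
    then have AR: "A \<subseteq> {1..int R}" using A by fastforce
    have "(\<Sum>j<R. f j) = real R * real (card A)"
      using parseval_e2pi[OF R AR, of "\<lambda>_. 1"] by (simp add: f_def exp_sum_def)
    then show ?thesis using split0[of f] f_nonneg[of 0] by simp
  qed
  \<comment> \<open>\<open>E\<close> includes the term \<open>j = 0\<close>, which cannot help to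
    cancel the main term. Removing its contribution at the fraction 0 is what pushes the total above
    the trivial value \<open>?a\<close>.\<close>
  have part: "?U
     \<le> ?T - ?a"
  proof -
    have mem: "(1,0) \<in> frac_pairs Q" using Q0 by (auto simp: frac_pairs_def)
    have one: "f 0 * K 0 (1,0) = ?a"
      using pos by (simp add: f0 K_def mean_kernel_def)
    have "?a = w (1,0) * (f 0 * K 0 (1,0))"
      unfolding one by (simp add: w_def)
    also have "\<dots> \<le> (\<Sum>qa\<in>frac_pairs Q. w qa * (f 0 * K 0 qa))"
      using mem by (intro member_le_sum mult_nonneg_nonneg w_nonneg K_nonneg f_nonneg) auto
    finally show ?thesis
      by (simp add: E_eq[symmetric] split0 distrib_left sum.distrib)
  qed
  have "real M * ?a \<le> (\<Sum>j\<in>{1..<R}. f j * norm (?S j))"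
    using card_square_le_sum_weyl[OF A pos(1) X no_sq] by (simp add: f_def R_def)
  also have "\<dots> \<le> (\<Sum>j\<in>{1..<R}. f j * (\<alpha> * real M / 8 + 12 * real M * ?V j))"
    using weyl by (intro sum_mono mult_left_mono f_nonneg)
  also have "\<dots> = \<alpha> * real M / 8 * (\<Sum>j\<in>{1..<R}. f j)
     + 12 * real M * (\<Sum>j\<in>{1..<R}. \<Sum>qa\<in>frac_pairs Q. w qa * (f j * K j qa))"
    by (simp add: distrib_left sum.distrib sum_distrib_left sum_distrib_right mult_ac)
  also have "(\<Sum>j\<in>{1..<R}. \<Sum>qa\<in>frac_pairs Q. w qa * (f j * K j qa))
     = ?U"
    by (subst sum.swap) (simp add: sum_distrib_left)
  also have "\<alpha> * real M / 8 * (\<Sum>j\<in>{1..<R}. f j) \<le> \<alpha> * real M / 8 * (2 * real X * real (card A))"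
  proof (intro mult_left_mono order.trans[OF total])
    have "R \<le> 2 * X" using M2 by (simp add: R_def)
    then have "real R \<le> 2 * real X" by linarith
    then show "real R * real (card A) \<le> 2 * real X * real (card A)"
      by (intro mult_right_mono) auto
  qed (use \<alpha> in simp)
  also have "\<alpha> * real M / 8 * (2 * real X * real (card A)) = real M * ?a / 4"
    using X by (simp add: \<alpha>_def power2_eq_square)
  finally have "real M * ?a \<le> real M * ?a / 4
     + 12 * real M * ?U"
    by simp
  also have "\<dots> \<le> real M * ?a / 4
     + 12 * real M * (?T - ?a)"
    using part by (intro add_left_mono mult_left_mono) auto
  also have "\<dots> = real M * (?a / 4
     + 12 * (?T - ?a))"
    by (simp add: algebra_simps)
  finally have "?a \<le> ?a / 4
     + 12 * (?T - ?a)"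
    using pos(1) by simp
  then have "17 / 16 * ?a \<le> ?T"
    by simp
  also have "\<dots> = real R * (\<Sum>qa\<in>frac_pairs Q. \<Sum>x\<in>{1..int R}.
     local_energy N (?A x) (real (snd qa) / real (fst qa)) / sqrt (real (fst qa)))"
    by (simp add: E_def w_def sum_distrib_left case_prod_unfold mult_ac)
  also have "(\<Sum>qa\<in>frac_pairs Q. \<Sum>x\<in>{1..int R}.
     local_energy N (?A x) (real (snd qa) / real (fst qa)) / sqrt (real (fst qa)))
     = (\<Sum>x\<in>{1..int R}. \<Sum>qa\<in>frac_pairs Q.
     local_energy N (?A x) (real (snd qa) / real (fst qa)) / sqrt (real (fst qa)))"
    by (rule sum.swap)
  finally show ?thesis
    by (simp add: R_def case_prod_unfold)
qed

section \<open>Moments of random conditional expectations\<close>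

lemma prod_if_mem:
  assumes "finite P" "S \<subseteq> P"
  shows "(\<Prod>p\<in>P. if p \<in> S then f p else g p) = (\<Prod>p\<in>S. f p) * (\<Prod>p\<in>P - S. g p)"
  using assms by (subst prod.If_cases) (auto simp: Int_absorb1 Diff_eq intro!: arg_cong2[where f = "(*)"] prod.cong)

text \<open>The law of the random subset of \<open>P\<close> that contains each \<open>p\<close>
  independently with probability \<open>w p\<close>.\<close>

definition incl_weight :: "'p set \<Rightarrow> ('p \<Rightarrow> real) \<Rightarrow> 'p set \<Rightarrow> real" where
  "incl_weight P w S = (\<Prod>p\<in>P. if p \<in> S then w p else 1 - w p)"

lemma incl_weight_nonneg:
  "(\<And>p. p \<in> P \<Longrightarrow> 0 \<le> w p \<and> w p \<le> 1) \<Longrightarrow> incl_weight P w S \<ge> 0"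
  unfolding incl_weight_def by (intro prod_nonneg) auto

lemma sum_incl_weight_superset:
  assumes "finite P" "T \<subseteq> P"
  shows "(\<Sum>S\<in>{S \<in> Pow P. T \<subseteq> S}. incl_weight P w S) = (\<Prod>p\<in>T. w p)"
proof -
  let ?r = "\<lambda>S. \<Prod>p\<in>P - S. if p \<in> T then 0 else 1 - w p"
  have "(\<Prod>p\<in>T. w p) = (\<Prod>p\<in>P. w p + (if p \<in> T then 0 else 1 - w p))"
    using assms prod.mono_neutral_right[of P T "\<lambda>p. w p + (if p \<in> T then 0 else 1 - w p)"] by simp
  also have "\<dots> = (\<Sum>S\<in>Pow P. (\<Prod>p\<in>S. w p) * ?r S)"
    by (rule prod_add[OF assms(1)])
  also have "\<dots> = (\<Sum>S\<in>Pow P. if T \<subseteq> S then incl_weight P w S else 0)"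
  proof (rule sum.cong[OF refl])
    fix S assume S: "S \<in> Pow P"
    show "(\<Prod>p\<in>S. w p) * ?r S = (if T \<subseteq> S then incl_weight P w S else 0)"
    proof (cases "T \<subseteq> S")
      case True
      then have "?r S = (\<Prod>p\<in>P - S. 1 - w p)"
        by (intro prod.cong) auto
      then show ?thesis
        using True S assms by (simp add: incl_weight_def prod_if_mem)
    next
      case False
      then obtain p where "p \<in> T" "p \<notin> S" by blast
      then have "?r S = 0"
        using assms by (intro prod_zero) auto
      then show ?thesis using False by simp
    qed
  qed
  also have "\<dots> = (\<Sum>S\<in>{S \<in> Pow P. T \<subseteq> S}. incl_weight P w S)"
    by (rule sum.inter_filter[symmetric]) (use assms(1) in simp)
  finally show ?thesis ..
qed

definition occ :: "nat \<Rightarrow> (nat \<Rightarrow> 'p set) \<Rightarrow> 'p \<Rightarrow> nat set" where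
  "occ k \<sigma> p = {i \<in> {..<k}. p \<in> \<sigma> i}"

text \<open>Transposition of the incidence matrix: a \<open>k\<close>-tuple of subsets of
  \<open>P\<close> is the same as a set of positions for every \<open>p\<close>, and these sets are
  independent for different \<open>p\<close>.\<close>

lemma sum_tuples_incl_weight:
  fixes c :: "nat \<Rightarrow> real"
  assumes "finite P"
  shows "(\<Sum>\<sigma>\<in>{..<k} \<rightarrow>\<^sub>E Pow P. (\<Prod>i<k. incl_weight P w (\<sigma> i)) * (\<Prod>p\<in>P. c (card (occ k \<sigma> p))))
       = (\<Prod>p\<in>P. \<Sum>B\<in>Pow {..<k}. (\<Prod>i<k. if i \<in> B then w p else 1 - w p) * c (card B))"
proof -
  let ?q = "\<lambda>b p. \<Prod>i<k. if i \<in> b p then w p else 1 - w p"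
  let ?s = "\<lambda>b. \<lambda>i\<in>{..<k}. {p \<in> P. i \<in> b p}"
  have "(\<Prod>p\<in>P. \<Sum>B\<in>Pow {..<k}. (\<Prod>i<k. if i \<in> B then w p else 1 - w p) * c (card B))
      = (\<Sum>b\<in>P \<rightarrow>\<^sub>E Pow {..<k}. \<Prod>p\<in>P. ?q b p * c (card (b p)))"
    by (rule prod_sum_PiE) (use assms in auto)
  also have "\<dots> = (\<Sum>\<sigma>\<in>{..<k} \<rightarrow>\<^sub>E Pow P. \<Prod>p\<in>P. (\<Prod>i<k. if p \<in> \<sigma> i then w p else 1 - w p) * c (card (occ k \<sigma> p)))"
  proof (rule sum.reindex_bij_witness[of _ "\<lambda>\<sigma>. \<lambda>p\<in>P. occ k \<sigma> p" "\<lambda>b. \<lambda>i\<in>{..<k}. {p \<in> P. i \<in> b p}"])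
    fix b assume b: "b \<in> P \<rightarrow>\<^sub>E Pow {..<k}"
    show "(\<lambda>p\<in>P. occ k (?s b) p) = b"
    proof
      fix p show "(\<lambda>p\<in>P. occ k (?s b) p) p = b p"
        using b by (cases "p \<in> P") (auto simp: occ_def PiE_def extensional_def Pi_def)
    qed
    show "(\<Prod>p\<in>P. (\<Prod>i<k. if p \<in> (?s b) i then w p else 1 - w p)
            * c (card (occ k (?s b) p)))
        = (\<Prod>p\<in>P. ?q b p * c (card (b p)))"
    proof (rule prod.cong[OF refl])
      fix p assume p: "p \<in> P"
      have "occ k (?s b) p = b p"
        using b p by (auto simp: occ_def PiE_def Pi_def)
      moreover have "(\<Prod>i<k. if p \<in> (?s b) i then w p else 1 - w p)
          = ?q b p"
        using p by (intro prod.cong) auto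
      ultimately show "(\<Prod>i<k. if p \<in> (?s b) i then w p else 1 - w p)
            * c (card (occ k (?s b) p))
          = ?q b p * c (card (b p))"
        by simp
    qed
  next
    fix \<sigma> assume \<sigma>: "\<sigma> \<in> {..<k} \<rightarrow>\<^sub>E Pow P"
    show "(\<lambda>i\<in>{..<k}. {p \<in> P. i \<in> (\<lambda>p\<in>P. occ k \<sigma> p) p}) = \<sigma>"
    proof
      fix i show "(\<lambda>i\<in>{..<k}. {p \<in> P. i \<in> (\<lambda>p\<in>P. occ k \<sigma> p) p}) i = \<sigma> i"
        using \<sigma> by (cases "i < k") (auto simp: occ_def PiE_def extensional_def Pi_def)
    qed
  qed (auto simp: occ_def)
  also have "\<dots> = (\<Sum>\<sigma>\<in>{..<k} \<rightarrow>\<^sub>E Pow P. (\<Prod>i<k. incl_weight P w (\<sigma> i)) * (\<Prod>p\<in>P. c (card (occ k \<sigma> p))))"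
    by (intro sum.cong refl) (simp add: prod.distrib incl_weight_def prod.swap[of _ P])
  finally show ?thesis ..
qed

text \<open>The probabilities sum to 1. The extra weight of sets with at least two elements is at
  most \<open>exp y - 1 - y\<close> for \<open>y = 6 * k * w\<close>, so no term linear in
  \<open>w\<close> survives; for \<open>w = 1 / sqrt p\<close> this leaves a multiple of 1 /
  p.\<close>

lemma sum_subsets_heavy_le:
  fixes w :: real
  assumes "0 \<le> w" "w \<le> 1" "6 * real k * w \<le> 1"
  shows "(\<Sum>B\<in>Pow {..<k}. (\<Prod>i<k. if i \<in> B then w else 1 - w) * (if card B \<ge> 2 then 6 ^ card B else 1))
     \<le> 1 + (6 * real k * w)\<^sup>2"
proof -
  define y where "y = 6 * real k * w"
  define v where "v B = (\<Prod>i<k. if i \<in> B then w else 1 - w)" for B :: "nat set"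
  have v_eq: "v B = w ^ card B * (1 - w) ^ card ({..<k} - B)" if "B \<in> Pow {..<k}" for B
    using that unfolding v_def by (subst prod_if_mem) auto
  have v_nonneg: "v B \<ge> 0" for B
    unfolding v_def using assms by (intro prod_nonneg) auto
  have v_le: "v B \<le> w ^ card B" if "B \<in> Pow {..<k}" for B
    unfolding v_eq[OF that] using assms by (intro mult_left_le power_le_one) auto
  have "(\<Sum>B\<in>Pow {..<k}. v B) = (\<Prod>i<k. w + (1 - w))"
    by (subst prod_add) (auto intro!: sum.cong simp: v_eq)
  then have v_sum: "(\<Sum>B\<in>Pow {..<k}. v B) = 1" by simp
  define H where "H = {B \<in> Pow {..<k}. card B \<ge> 2}"
  define L where "L = insert {} ((\<lambda>i. {i}) ` {..<k})"
  have Pow_eq: "Pow {..<k} = H \<union> L"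
  proof (intro equalityI subsetI)
    fix B assume B: "B \<in> Pow {..<k}"
    then have "finite B" using finite_subset by blast
    then consider "card B \<ge> 2" | "B = {}" | i where "B = {i}"
      by (metis One_nat_def card_0_eq card_1_singletonE less_2_cases linorder_not_less)
    then show "B \<in> H \<union> L"
      by cases (use B in \<open>auto simp: H_def L_def\<close>)
  qed (auto simp: H_def L_def)
  have disj: "H \<inter> L = {}" by (auto simp: H_def L_def)
  have fin: "finite H" "finite L" by (auto simp: H_def L_def)
  have "(\<Sum>B\<in>Pow {..<k}. (6 * w) ^ card B) = (\<Prod>i<k. 6 * w + 1)"
    by (subst prod_add) auto
  also have "\<dots> = (1 + 6 * w) ^ k" by (simp add: add.commute)
  also have "\<dots> \<le> exp (6 * w) ^ k"
    using assms by (intro power_mono exp_ge_add_one_self) auto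
  also have "\<dots> = exp y"
    by (simp add: y_def exp_of_nat_mult[symmetric] mult_ac)
  also have "\<dots> \<le> 1 + y + y\<^sup>2"
    by (rule exp_bound) (use assms in \<open>auto simp: y_def\<close>)
  finally have all: "(\<Sum>B\<in>Pow {..<k}. (6 * w) ^ card B) \<le> 1 + y + y\<^sup>2" .
  have "(\<Sum>B\<in>L. (6 * w) ^ card B) = 1 + y"
    unfolding L_def by (subst sum.insert) (auto simp: sum.reindex inj_on_def y_def)
  then have heavy: "(\<Sum>B\<in>H. (6 * w) ^ card B) \<le> y\<^sup>2"
    using all unfolding Pow_eq sum.union_disjoint[OF fin disj] by simp
  have "(\<Sum>B\<in>Pow {..<k}. v B * (if card B \<ge> 2 then 6 ^ card B else 1))
      \<le> (\<Sum>B\<in>Pow {..<k}. v B + (if card B \<ge> 2 then (6 * w) ^ card B else 0))"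
  proof (rule sum_mono)
    fix B assume B: "B \<in> Pow {..<k}"
    have "v B * 6 ^ card B \<le> (6 * w) ^ card B"
      using mult_right_mono[OF v_le[OF B], of "6 ^ card B"] by (simp add: power_mult_distrib mult.commute)
    then show "v B * (if card B \<ge> 2 then 6 ^ card B else 1) \<le> v B + (if card B \<ge> 2 then (6 * w) ^ card B else 0)"
      using v_nonneg[of B] by (cases "card B \<ge> 2") (simp_all only: if_P if_not_P not_False_eq_True simp_thms)
  qed
  also have "\<dots> = 1 + (\<Sum>B\<in>H. (6 * w) ^ card B)"
    unfolding sum.distrib v_sum H_def by (subst sum.inter_filter) simp_all
  also have "\<dots> \<le> 1 + y\<^sup>2" using heavy by simp
  finally show ?thesis unfolding v_def y_def .
qed

definition avg :: "'x set \<Rightarrow> ('x \<Rightarrow> real) \<Rightarrow> real" where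
  "avg \<Omega> h = (\<Sum>z\<in>\<Omega>. h z) / real (card \<Omega>)"

lemma avg_cong: "(\<And>z. z \<in> \<Omega> \<Longrightarrow> g z = h z) \<Longrightarrow> avg \<Omega> g = avg \<Omega> h"
  by (simp add: avg_def)

lemma avg_sum: "avg \<Omega> (\<lambda>z. \<Sum>i\<in>I. h i z) = (\<Sum>i\<in>I. avg \<Omega> (h i))"
  unfolding avg_def sum_divide_distrib by (rule sum.swap)

lemma avg_cmult: "avg \<Omega> (\<lambda>z. c * h z) = c * avg \<Omega> h"
  by (simp add: avg_def sum_distrib_left)

lemma avg_le:
  assumes "finite \<Omega>" "\<Omega> \<noteq> {}" "\<And>z. z \<in> \<Omega> \<Longrightarrow> h z \<le> c"
  shows "avg \<Omega> h \<le> c"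
proof -
  have "card \<Omega> > 0" using assms by (simp add: card_gt_0_iff)
  moreover have "(\<Sum>z\<in>\<Omega>. h z) \<le> real (card \<Omega>) * c"
    using assms(3) by (rule sum_bounded_above)
  ultimately show ?thesis by (simp add: avg_def field_simps)
qed

text \<open>
  \<open>F S\<close> plays the role of the conditional expectation of one fixed function given the coordinates
  in \<open>S\<close>, where \<open>T p\<close> moves only the coordinate \<open>p\<close>.
\<close>

locale coordinate_martingale =
  fixes \<Omega> :: "'x set" and P :: "'p set" and T :: "'p \<Rightarrow> 'x \<Rightarrow> 'x" and F :: "'p set \<Rightarrow> 'x \<Rightarrow> real"
  assumes fin_\<Omega>: "finite \<Omega>" and nonempty: "\<Omega> \<noteq> {}" and fin_P: "finite P"
    and invariant: "S \<subseteq> P \<Longrightarrow> p \<in> P - S \<Longrightarrow> F S (T p z) = F S z"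
    and average: "S \<subseteq> P \<Longrightarrow> p \<in> S \<Longrightarrow> (\<And>z. h (T p z) = h z) \<Longrightarrow>
       avg \<Omega> (\<lambda>z. F S z * h z) = avg \<Omega> (\<lambda>z. F (S - {p}) z * h z)"
begin

text \<open>
  A coordinate occurring in at most one factor can be averaged out of the whole product, so only
  the coordinates shared by two factors matter.
\<close>

lemma avg_prod_remove:
  assumes \<sigma>: "\<And>i. i < k \<Longrightarrow> \<sigma> i \<subseteq> P" and "finite R" "R \<subseteq> P" "\<And>p. p \<in> R \<Longrightarrow> card (occ k \<sigma> p) \<le> 1"
  shows "avg \<Omega> (\<lambda>z. \<Prod>i<k. F (\<sigma> i) z) = avg \<Omega> (\<lambda>z. \<Prod>i<k. F (\<sigma> i - R) z)"
  using assms(2-4)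
proof (induction R rule: finite_induct)
  case empty
  then show ?case by simp
next
  case (insert p R)
  let ?S = "\<lambda>i. \<sigma> i - insert p R"
  have fin_occ: "finite (occ k \<sigma> p)" by (simp add: occ_def)
  have IH: "avg \<Omega> (\<lambda>z. \<Prod>i<k. F (\<sigma> i) z) = avg \<Omega> (\<lambda>z. \<Prod>i<k. F (\<sigma> i - R) z)"
    using insert by auto
  show ?case
  proof (cases "occ k \<sigma> p = {}")
    case True
    then have "\<sigma> i - R = \<sigma> i - insert p R" if "i < k" for i
      using that by (auto simp: occ_def)
    then have "(\<Prod>i<k. F (\<sigma> i - R) z) = (\<Prod>i<k. F (?S i) z)" for z
      by (intro prod.cong) auto
    with IH show ?thesis by simp
  next
    case False
    then have "card (occ k \<sigma> p) = 1"
      using insert.prems(2)[of p] fin_occ by (metis card_0_eq insertI1 le_antisym less_one linorder_not_less)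
    then obtain j where j: "occ k \<sigma> p = {j}" using card_1_singletonE by blast
    then have jk: "j < k" "p \<in> \<sigma> j" by (auto simp: occ_def)
    have other: "p \<notin> \<sigma> i" if "i < k" "i \<noteq> j" for i
      using j that by (auto simp: occ_def)
    define h where "h z = (\<Prod>i\<in>{..<k} - {j}. F (\<sigma> i - R) z)" for z
    have h_inv: "h (T p z) = h z" for z
      unfolding h_def using insert.prems(1) \<sigma> other by (intro prod.cong refl invariant) auto
    have split: "(\<Prod>i<k. G i) = G j * (\<Prod>i\<in>{..<k} - {j}. G i)" for G :: "nat \<Rightarrow> real"
      using jk by (intro prod.remove) auto
    have "avg \<Omega> (\<lambda>z. \<Prod>i<k. F (\<sigma> i - R) z) = avg \<Omega> (\<lambda>z. F (\<sigma> j - R) z * h z)"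
      by (intro avg_cong) (subst split, simp add: h_def)
    also have "\<dots> = avg \<Omega> (\<lambda>z. F (\<sigma> j - R - {p}) z * h z)"
      by (intro average h_inv) (use jk \<sigma> insert.hyps in auto)
    also have "\<dots> = avg \<Omega> (\<lambda>z. \<Prod>i<k. F (?S i) z)"
    proof (intro avg_cong)
      fix z
      have "h z = (\<Prod>i\<in>{..<k} - {j}. F (?S i) z)"
        unfolding h_def
      proof (rule prod.cong[OF refl])
        fix i assume "i \<in> {..<k} - {j}"
        then have "\<sigma> i - R = \<sigma> i - insert p R" using other by auto
        then show "F (\<sigma> i - R) z = F (?S i) z" by simp
      qed
      moreover have "\<sigma> j - R - {p} = \<sigma> j - insert p R" by auto
      ultimately show "F (\<sigma> j - R - {p}) z * h z = (\<Prod>i<k. F (?S i) z)"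
        by (subst split) simp
    qed
    finally show ?thesis using IH by simp
  qed
qed

definition heavy :: "nat \<Rightarrow> (nat \<Rightarrow> 'p set) \<Rightarrow> 'p set" where
  "heavy k \<sigma> = {p \<in> P. card (occ k \<sigma> p) \<ge> 2}"

lemma avg_prod_heavy:
  assumes "\<And>i. i < k \<Longrightarrow> \<sigma> i \<subseteq> P"
  shows "avg \<Omega> (\<lambda>z. \<Prod>i<k. F (\<sigma> i) z) = avg \<Omega> (\<lambda>z. \<Prod>i<k. F (\<sigma> i \<inter> heavy k \<sigma>) z)"
proof -
  have "avg \<Omega> (\<lambda>z. \<Prod>i<k. F (\<sigma> i) z) = avg \<Omega> (\<lambda>z. \<Prod>i<k. F (\<sigma> i - (P - heavy k \<sigma>)) z)"
    by (rule avg_prod_remove) (use assms fin_P in \<open>auto simp: heavy_def\<close>)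
  moreover have "\<sigma> i - (P - heavy k \<sigma>) = \<sigma> i \<inter> heavy k \<sigma>" if "i < k" for i
    using assms[OF that] by auto
  ultimately show ?thesis by simp
qed

text \<open>After removal of the light coordinates, at most \<open>D\<close> heavy ones mean that
  every factor lies between 0 and \<beta>. With more than \<open>D\<close> of them the factors obey
  only the \<open>3 ^ card\<close> bound, but each heavy coordinate occurs \<open>n \<ge> 2\<close>
  times and its weight \<open>6 ^ n = 3 ^ n * 2 ^ n\<close> pays both for that bound and for a spare
  factor 2. Together the spare factors exceed \<open>2 ^ D\<close>.\<close>

lemma avg_prod_le:
  assumes \<sigma>: "\<And>i. i < k \<Longrightarrow> \<sigma> i \<subseteq> P" and "\<beta> \<ge> 0"
    and small: "\<And>S z. S \<subseteq> P \<Longrightarrow> card S \<le> D \<Longrightarrow> 0 \<le> F S z \<and> F S z \<le> \<beta>"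
    and large: "\<And>S z. S \<subseteq> P \<Longrightarrow> \<bar>F S z\<bar> \<le> 3 ^ card S * \<beta>"
  shows "avg \<Omega> (\<lambda>z. \<Prod>i<k. F (\<sigma> i) z)
     \<le> \<beta> ^ k * (1 + (\<Prod>p\<in>P. if card (occ k \<sigma> p) \<ge> 2 then 6 ^ card (occ k \<sigma> p) else 1) / 2 ^ D)"
proof -
  let ?n = "\<lambda>p. card (occ k \<sigma> p)"
  define U where "U = heavy k \<sigma>"
  let ?V = "\<lambda>i. \<sigma> i \<inter> U"
  have U: "U \<subseteq> P" "finite U" using fin_P by (auto simp: U_def heavy_def)
  define W :: real where "W = (\<Prod>p\<in>P. if ?n p \<ge> 2 then 6 ^ ?n p else 1)"
  have W: "W = (\<Prod>p\<in>U. 6 ^ ?n p)"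
    unfolding W_def U_def heavy_def using fin_P by (simp add: prod.inter_filter)
  have W0: "W \<ge> 0" unfolding W by (intro prod_nonneg) auto
  have bound: "(\<Prod>i<k. F (?V i) z) \<le> \<beta> ^ k * (1 + W / 2 ^ D)" for z
  proof (cases "card U \<le> D")
    case True
    have "(\<Prod>i<k. F (?V i) z) \<le> (\<Prod>i<k. \<beta>)"
    proof (intro prod_mono)
      fix i assume "i \<in> {..<k}"
      have "card (?V i) \<le> D"
        using card_mono[OF U(2), of "\<sigma> i \<inter> U"] True by auto
      moreover have "\<sigma> i \<inter> U \<subseteq> P" using U by auto
      ultimately show "0 \<le> F (?V i) z \<and> F (?V i) z \<le> \<beta>" by (rule small[rotated])
    qed
    also have "\<dots> \<le> \<beta> ^ k * (1 + W / 2 ^ D)"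
      using assms(2) W0 by (simp add: mult_le_cancel_left1)
    finally show ?thesis .
  next
    case False
    have "(\<Prod>i<k. F (?V i) z) \<le> \<bar>\<Prod>i<k. F (?V i) z\<bar>" by simp
    also have "\<dots> = (\<Prod>i<k. \<bar>F (?V i) z\<bar>)" by (rule abs_prod)
    also have "\<dots> \<le> (\<Prod>i<k. 3 ^ card (?V i) * \<beta>)"
      using U by (intro prod_mono) (auto intro: large)
    also have "\<dots> = 3 ^ (\<Sum>i<k. card (?V i)) * \<beta> ^ k"
      by (simp add: prod.distrib power_sum)
    also have "(\<Sum>i<k. card (?V i)) = (\<Sum>p\<in>U. ?n p)"
    proof -
      have "(\<Sum>i<k. card (?V i)) = (\<Sum>i<k. \<Sum>p\<in>U. if p \<in> \<sigma> i then 1 else 0)"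
        using U by (intro sum.cong refl) (simp add: sum.If_cases Int_commute)
      also have "\<dots> = (\<Sum>p\<in>U. \<Sum>i<k. if p \<in> \<sigma> i then 1 else 0)"
        by (rule sum.swap)
      also have "\<dots> = (\<Sum>p\<in>U. ?n p)"
        by (intro sum.cong refl) (simp add: sum.If_cases occ_def Int_def)
      finally show ?thesis .
    qed
    also have "(3::real) ^ (\<Sum>p\<in>U. ?n p) * 2 ^ D \<le> W"
    proof -
      have "(2::real) ^ D \<le> 2 ^ card U" using False by (intro power_increasing) auto
      also have "\<dots> = (\<Prod>p\<in>U. 2)" by simp
      also have "\<dots> \<le> (\<Prod>p\<in>U. 2 ^ ?n p)"
      proof (intro prod_mono conjI)
        fix p assume "p \<in> U"
        then have "(2::real) ^ 1 \<le> 2 ^ ?n p"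
          by (intro power_increasing) (auto simp: U_def heavy_def)
        then show "(2::real) \<le> 2 ^ ?n p" by simp
      qed simp
      finally have "(3::real) ^ (\<Sum>p\<in>U. ?n p) * 2 ^ D
          \<le> (\<Prod>p\<in>U. 3 ^ ?n p) * (\<Prod>p\<in>U. 2 ^ ?n p)"
        unfolding power_sum by (intro mult_left_mono prod_nonneg) auto
      also have "\<dots> = W" unfolding W prod.distrib[symmetric] power_mult_distrib[symmetric] by simp
      finally show ?thesis .
    qed
    then have "(3::real) ^ (\<Sum>p\<in>U. ?n p) * \<beta> ^ k \<le> (W / 2 ^ D) * \<beta> ^ k"
      using assms(2) by (intro mult_right_mono) (auto simp: field_simps)
    also have "\<dots> \<le> \<beta> ^ k * (1 + W / 2 ^ D)"
      using assms(2) by (simp add: algebra_simps)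
    finally show ?thesis .
  qed
  have "avg \<Omega> (\<lambda>z. \<Prod>i<k. F (\<sigma> i) z) = avg \<Omega> (\<lambda>z. \<Prod>i<k. F (?V i) z)"
    unfolding U_def by (rule avg_prod_heavy[OF \<sigma>])
  also have "\<dots> \<le> \<beta> ^ k * (1 + W / 2 ^ D)"
    by (intro avg_le fin_\<Omega> nonempty bound)
  finally show ?thesis unfolding W_def .
qed

text \<open>The power expands into \<open>k\<close> independent random sets. The expected weight of
  the heavy coordinates is at most \<open>2 ^ D\<close> by independence, so the tuples with too many
  of them cost no more than a second \<open>\<beta> ^ k\<close>.\<close>

theorem moment_bound:
  assumes w: "\<And>p. p \<in> P \<Longrightarrow> 0 \<le> w p \<and> w p \<le> 1 \<and> 6 * real k * w p \<le> 1"
    and prod_w: "(\<Prod>p\<in>P. 1 + (6 * real k * w p)\<^sup>2) \<le> 2 ^ D" and "\<beta> \<ge> 0"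
    and small: "\<And>S z. S \<subseteq> P \<Longrightarrow> card S \<le> D \<Longrightarrow> 0 \<le> F S z \<and> F S z \<le> \<beta>"
    and large: "\<And>S z. S \<subseteq> P \<Longrightarrow> \<bar>F S z\<bar> \<le> 3 ^ card S * \<beta>"
  shows "avg \<Omega> (\<lambda>z. (\<Sum>S\<in>Pow P. incl_weight P w S * F S z) ^ k) \<le> 2 * \<beta> ^ k"
proof -
  let ?g = "\<lambda>z. \<Sum>S\<in>Pow P. incl_weight P w S * F S z"
  let ?q = "\<lambda>p B. \<Prod>i<k. if i \<in> B then w p else 1 - w p"
  define c :: "nat \<Rightarrow> real" where "c n = (if n \<ge> 2 then 6 ^ n else 1)" for n
  let ?c = "\<lambda>\<sigma>. \<Prod>p\<in>P. c (card (occ k \<sigma> p))"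
  define \<nu> where "\<nu> \<sigma> = (\<Prod>i<k. incl_weight P w (\<sigma> i))" for \<sigma>
  let ?\<Sigma> = "{..<k} \<rightarrow>\<^sub>E Pow P"
  let ?E = "\<Sum>\<sigma>\<in>?\<Sigma>. \<nu> \<sigma> * ?c \<sigma>"
  have \<nu>_nonneg: "\<nu> \<sigma> \<ge> 0" for \<sigma>
    unfolding \<nu>_def using w by (intro prod_nonneg) (auto intro!: incl_weight_nonneg)
  have "?E
     = (\<Prod>p\<in>P. \<Sum>B\<in>Pow {..<k}. ?q p B * c (card B))"
    unfolding \<nu>_def by (rule sum_tuples_incl_weight[OF fin_P])
  also have "\<dots> \<le> 2 ^ D"
  proof (rule order.trans[OF prod_mono prod_w])
    fix p assume "p \<in> P"
    then show "0 \<le> (\<Sum>B\<in>Pow {..<k}. ?q p B * c (card B))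
      \<and> (\<Sum>B\<in>Pow {..<k}. ?q p B * c (card B)) \<le> 1 + (6 * real k * w p)\<^sup>2"
      using w sum_subsets_heavy_le[of "w p" k] unfolding c_def
      by (auto intro!: sum_nonneg mult_nonneg_nonneg prod_nonneg)
  qed
  finally have heavy_le: "?E \<le> 2 ^ D" .
  have "?g z ^ k = (\<Sum>\<sigma>\<in>?\<Sigma>. \<nu> \<sigma> * (\<Prod>i<k. F (\<sigma> i) z))" for z
  proof -
    have "?g z ^ k = (\<Prod>i<k. \<Sum>S\<in>Pow P. incl_weight P w S * F S z)"
      by simp
    also have "\<dots> = (\<Sum>\<sigma>\<in>?\<Sigma>. \<Prod>i<k. incl_weight P w (\<sigma> i) * F (\<sigma> i) z)"
      by (rule prod_sum_PiE) (use fin_P in auto)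
    finally show ?thesis by (simp add: prod.distrib \<nu>_def)
  qed
  then have "avg \<Omega> (\<lambda>z. ?g z ^ k)
     = (\<Sum>\<sigma>\<in>?\<Sigma>. \<nu> \<sigma> * avg \<Omega> (\<lambda>z. \<Prod>i<k. F (\<sigma> i) z))"
    by (simp add: avg_sum avg_cmult)
  also have "\<dots> \<le> (\<Sum>\<sigma>\<in>?\<Sigma>. \<nu> \<sigma> * (\<beta> ^ k * (1 + ?c \<sigma> / 2 ^ D)))"
    unfolding c_def
    by (intro sum_mono mult_left_mono \<nu>_nonneg avg_prod_le small large) (use \<open>\<beta> \<ge> 0\<close> in \<open>auto simp: PiE_def Pi_def\<close>)
  also have "\<dots> = \<beta> ^ k * ((\<Sum>\<sigma>\<in>?\<Sigma>. \<nu> \<sigma> * (\<Prod>p\<in>P. 1)) + ?E / 2 ^ D)"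
    by (simp add: sum_distrib_left sum_divide_distrib sum.distrib[symmetric] algebra_simps)
  also have "(\<Sum>\<sigma>\<in>?\<Sigma>. \<nu> \<sigma> * (\<Prod>p\<in>P. 1)) = 1"
  proof -
    have "(\<Sum>B\<in>Pow {..<k}. ?q p B) = 1" for p
    proof -
      have "(\<Sum>B\<in>Pow {..<k}. ?q p B) = (\<Prod>i<k. w p + (1 - w p))"
        by (subst prod_add) (auto intro!: sum.cong simp: prod_if_mem)
      then show ?thesis by simp
    qed
    then show ?thesis
      unfolding \<nu>_def using sum_tuples_incl_weight[OF fin_P, where c = "\<lambda>_. 1"] by simp
  qed
  also have "\<beta> ^ k * (1 + ?E / 2 ^ D) \<le> \<beta> ^ k * (1 + 1)"
    using heavy_le \<open>\<beta> \<ge> 0\<close> by (intro mult_left_mono add_left_mono) simp_all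
  finally show ?thesis by simp
qed

end

section \<open>Subset inversion and periodic functions\<close>

lemma sum_alternating_Pow:
  assumes "finite A"
  shows "(\<Sum>W\<in>Pow A. (-1::real) ^ card W) = (if A = {} then 1 else 0)"
  using prod_add[OF assms, of "\<lambda>_. -1" "\<lambda>_. 1::real"] assms by (auto simp: power_0_left)

lemma sum_alternating_interval:
  assumes "finite T" "S \<subseteq> T"
  shows "(\<Sum>V\<in>{V \<in> Pow T. S \<subseteq> V}. (-1::real) ^ card (V - S)) = (if S = T then 1 else 0)"
proof -
  have "(\<Sum>V\<in>{V \<in> Pow T. S \<subseteq> V}. (-1::real) ^ card (V - S)) = (\<Sum>W\<in>Pow (T - S). (-1) ^ card W)"
    by (rule sum.reindex_bij_witness[of _ "\<lambda>W. W \<union> S" "\<lambda>V. V - S"]) (use assms(2) in auto)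
  also have "\<dots> = (if S = T then 1 else 0)"
    using assms sum_alternating_Pow[of "T - S"] by auto
  finally show ?thesis .
qed

lemma sum_alternating_interval':
  assumes "finite T" "S \<subseteq> T"
  shows "(\<Sum>V\<in>{V \<in> Pow T. S \<subseteq> V}. (-1::real) ^ card (T - V)) = (if S = T then 1 else 0)"
proof -
  have "(\<Sum>V\<in>{V \<in> Pow T. S \<subseteq> V}. (-1::real) ^ card (T - V)) = (\<Sum>W\<in>Pow (T - S). (-1) ^ card W)"
    by (rule sum.reindex_bij_witness[of _ "\<lambda>W. T - W" "\<lambda>V. T - V"])
       (use assms(2) in \<open>auto simp: double_diff\<close>)
  also have "\<dots> = (if S = T then 1 else 0)"
    using assms sum_alternating_Pow[of "T - S"] by auto
  finally show ?thesis .
qed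

definition mobius_diff :: "('p set \<Rightarrow> real) \<Rightarrow> 'p set \<Rightarrow> real" where
  "mobius_diff f T = (\<Sum>V\<in>Pow T. (-1) ^ card (T - V) * f V)"

lemma sum_mobius_diff:
  assumes "finite S"
  shows "(\<Sum>T\<in>Pow S. mobius_diff f T) = f S"
proof -
  have "(\<Sum>T\<in>Pow S. mobius_diff f T) = (\<Sum>T\<in>Pow S. \<Sum>V\<in>{V \<in> Pow S. V \<subseteq> T}. (-1) ^ card (T - V) * f V)"
    unfolding mobius_diff_def by (intro sum.cong) auto
  also have "\<dots> = (\<Sum>V\<in>Pow S. \<Sum>T\<in>{T \<in> Pow S. V \<subseteq> T}. (-1) ^ card (T - V) * f V)"
    using assms by (intro sum.swap_restrict) auto
  also have "\<dots> = (\<Sum>V\<in>Pow S. (if V = S then 1 else 0) * f V)"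
    unfolding sum_distrib_right[symmetric]
    by (intro sum.cong refl) (subst sum_alternating_interval, use assms in auto)
  also have "\<dots> = f S"
    using assms by (simp add: if_distrib[of "\<lambda>x. x * _"] sum.delta' cong: if_cong)
  finally show ?thesis .
qed

lemma mobius_diff_sum:
  assumes "finite T"
  shows "mobius_diff (\<lambda>V. \<Sum>S\<in>Pow V. c S) T = c T"
proof -
  have "mobius_diff (\<lambda>V. \<Sum>S\<in>Pow V. c S) T = (\<Sum>V\<in>Pow T. \<Sum>S\<in>{S \<in> Pow T. S \<subseteq> V}. (-1) ^ card (T - V) * c S)"
    unfolding mobius_diff_def sum_distrib_left by (intro sum.cong) auto
  also have "\<dots> = (\<Sum>S\<in>Pow T. \<Sum>V\<in>{V \<in> Pow T. S \<subseteq> V}. (-1) ^ card (T - V) * c S)"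
    using assms by (intro sum.swap_restrict) auto
  also have "\<dots> = (\<Sum>S\<in>Pow T. (if S = T then 1 else 0) * c S)"
    unfolding sum_distrib_right[symmetric]
    by (intro sum.cong refl) (subst sum_alternating_interval', use assms in auto)
  also have "\<dots> = c T"
    using assms by (simp add: if_distrib[of "\<lambda>x. x * _"] sum.delta' cong: if_cong)
  finally show ?thesis .
qed

lemma mobius_diff_eq_0:
  assumes "finite T" "p \<in> T" "\<And>V. V \<subseteq> T \<Longrightarrow> p \<in> V \<Longrightarrow> f V = f (V - {p})"
  shows "mobius_diff f T = 0"
proof -
  have "Pow T = Pow (T - {p}) \<union> insert p ` Pow (T - {p})"
    using assms(2) Pow_insert[of p "T - {p}"] by (simp add: insert_absorb)
  then have "mobius_diff f T = (\<Sum>V\<in>Pow (T - {p}). (-1) ^ card (T - V) * f V)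
      + (\<Sum>V\<in>insert p ` Pow (T - {p}). (-1) ^ card (T - V) * f V)"
    unfolding mobius_diff_def using assms(1) by (simp only:) (subst sum.union_disjoint, auto)
  also have "(\<Sum>V\<in>insert p ` Pow (T - {p}). (-1) ^ card (T - V) * f V)
      = (\<Sum>V\<in>Pow (T - {p}). (-1) ^ card (T - insert p V) * f (insert p V))"
    by (subst sum.reindex) (auto intro!: inj_onI)
  also have "\<dots> = (\<Sum>V\<in>Pow (T - {p}). - ((-1) ^ card (T - V) * f V))"
  proof (rule sum.cong[OF refl])
    fix V assume V: "V \<in> Pow (T - {p})"
    have "T - V = insert p (T - insert p V)" using V assms(2) by auto
    then have "card (T - V) = Suc (card (T - insert p V))"
      using assms(1) by (metis Diff_iff card_insert_disjoint finite_Diff insertI1)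
    moreover have "f (insert p V) = f V"
    proof -
      have "insert p V - {p} = V" using V by auto
      then show ?thesis using assms(3)[of "insert p V"] V assms(2) by auto
    qed
    ultimately show "(-1) ^ card (T - insert p V) * f (insert p V) = - ((-1) ^ card (T - V) * f V)"
      by simp
  qed
  finally show ?thesis by (simp add: sum_negf)
qed

lemma abs_mobius_diff_le:
  assumes "finite T" "\<And>V. V \<subseteq> T \<Longrightarrow> \<bar>f V\<bar> \<le> \<beta>"
  shows "\<bar>mobius_diff f T\<bar> \<le> 2 ^ card T * \<beta>"
proof -
  have "\<bar>mobius_diff f T\<bar> \<le> (\<Sum>V\<in>Pow T. \<bar>(-1) ^ card (T - V) * f V\<bar>)"
    unfolding mobius_diff_def by (rule sum_abs)
  also have "\<dots> \<le> (\<Sum>V\<in>Pow T. \<beta>)"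
    using assms(2) by (intro sum_mono) (auto simp: abs_mult power_abs)
  finally show ?thesis using assms(1) by (simp add: card_Pow)
qed

lemma sum_Pow_power_card:
  assumes "finite S"
  shows "(\<Sum>T\<in>Pow S. (x::real) ^ card T) = (x + 1) ^ card S"
  using prod_add[OF assms, of "\<lambda>_. x" "\<lambda>_. 1"] by simp

abbreviation small_subsets :: "nat \<Rightarrow> 'a set \<Rightarrow> 'a set set" where
  "small_subsets D P \<equiv> {T \<in> Pow P. card T \<le> D}"

lemma card_bounded_subsets_le:
  assumes "finite P"
  shows "card (small_subsets D P) \<le> (card P + 1) ^ D"
proof (induction D)
  case 0
  have "{T \<in> Pow P. card T \<le> 0} = {{}}"
    using assms finite_subset by fastforce
  then show ?case by simp
next
  case (Suc D)
  let ?S = "small_subsets D P"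
  have "small_subsets (Suc D) P \<subseteq> (\<lambda>(T, x). case x of None \<Rightarrow> T | Some p \<Rightarrow> insert p T) ` (?S \<times> insert None (Some ` P))"
  proof
    fix T assume T: "T \<in> small_subsets (Suc D) P"
    show "T \<in> (\<lambda>(T, x). case x of None \<Rightarrow> T | Some p \<Rightarrow> insert p T) ` (?S \<times> insert None (Some ` P))"
    proof (cases "T = {}")
      case True
      then show ?thesis by (intro image_eqI[of _ _ "({}, None)"]) auto
    next
      case False
      then obtain p where p: "p \<in> T" by blast
      have "finite T" using T assms finite_subset by blast
      then have "card (T - {p}) \<le> D" using T p by (simp add: le_diff_conv)
      then show ?thesis
        using T p by (intro image_eqI[of _ _ "(T - {p}, Some p)"]) auto
    qed
  qed
  then have "card (small_subsets (Suc D) P) \<le> card (?S \<times> insert None (Some ` P))"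
    using assms by (intro surj_card_le) auto
  also have "\<dots> = card ?S * (card P + 1)"
    using assms by (subst card_cartesian_product) (simp add: card_image)
  also have "\<dots> \<le> (card P + 1) ^ D * (card P + 1)"
    using Suc.IH by (rule mult_right_mono) simp
  finally show ?case by (simp add: mult.commute)
qed

section \<open>Periodic functions: windows against full periods\<close>

lemma periodic_mult:
  fixes h :: "int \<Rightarrow> 'a"
  assumes "\<And>z. h (z + c) = h z"
  shows "h (z + int n * c) = h z"
proof (induction n)
  case (Suc n)
  have "h (z + int (Suc n) * c) = h ((z + int n * c) + c)" by (simp add: algebra_simps)
  then show ?case using Suc assms by simp
qed simp

lemma sum_periodic_shift:
  fixes h :: "int \<Rightarrow> real"
  assumes "\<And>z. h (z + int m) = h z"
  shows "(\<Sum>z\<in>{a..<a + int m}. h z) = (\<Sum>z\<in>{0..<int m}. h z)"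
proof -
  have step: "(\<Sum>z\<in>{b + 1..<b + 1 + int m}. h z) = (\<Sum>z\<in>{b..<b + int m}. h z)" for b
  proof (cases "m = 0")
    case False
    then have "{b..<b + int m} = insert b {b + 1..<b + int m}"
      "{b + 1..<b + 1 + int m} = insert (b + int m) {b + 1..<b + int m}" by auto
    then show ?thesis using assms by simp
  qed simp
  show ?thesis
  proof (induction a rule: int_induct[where k = 0])
    case base
    then show ?case by simp
  next
    case (step1 i)
    then show ?case using step[of i] by simp
  next
    case (step2 i)
    then show ?case using step[of "i - 1"] by simp
  qed
qed

lemma avg_periodic_shift:
  fixes h :: "int \<Rightarrow> real"
  assumes "\<And>z. h (z + int m) = h z"
  shows "avg {0..<int m} (\<lambda>z. h (z + c)) = avg {0..<int m} h"
proof -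
  have "(\<Sum>z\<in>{0..<int m}. h (z + c)) = (\<Sum>z\<in>{c..<c + int m}. h z)"
    by (rule sum.reindex_bij_witness[of _ "\<lambda>z. z - c" "\<lambda>z. z + c"]) auto
  then show ?thesis using sum_periodic_shift[of h m, OF assms] by (simp add: avg_def)
qed

lemma sum_periodic_blocks:
  fixes h :: "int \<Rightarrow> real"
  assumes "\<And>z. h (z + int m) = h z"
  shows "(\<Sum>z\<in>{a..<a + int (n * m)}. h z) = real n * (\<Sum>z\<in>{0..<int m}. h z)"
proof (induction n)
  case (Suc n)
  have "{a..<a + int (Suc n * m)} = {a..<a + int (n * m)} \<union> {a + int (n * m)..<a + int (n * m) + int m}"
    using ivl_disj_un_two(3)[of a "a + int (n * m)" "a + int (n * m) + int m"] by (simp add: algebra_simps)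
  then have "(\<Sum>z\<in>{a..<a + int (Suc n * m)}. h z) = (\<Sum>z\<in>{a..<a + int (n * m)}. h z)
      + (\<Sum>z\<in>{a + int (n * m)..<a + int (n * m) + int m}. h z)"
    by (simp only:) (rule sum.union_disjoint, auto)
  then show ?case
    using Suc sum_periodic_shift[of h m "a + int (n * m)", OF assms] by (simp add: algebra_simps)
qed simp

lemma avg_periodic_multiple:
  fixes h :: "int \<Rightarrow> real"
  assumes "\<And>z. h (z + int m) = h z" "n > 0" "m > 0"
  shows "avg {0..<int (n * m)} h = avg {0..<int m} h"
  using sum_periodic_blocks[of h m 0 n, OF assms(1)] assms(2,3) by (simp add: avg_def)

text \<open>One period is lost in the incomplete last block and one in replacing the number of
  complete blocks by \<open>N / m\<close>. The average may be taken over any multiple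
  \<open>M\<close> of the period, so that summands with different periods can later be averaged over
  a common one.\<close>

lemma sum_periodic_le_avg:
  fixes h :: "int \<Rightarrow> real"
  assumes per: "\<And>z. h (z + int m) = h z" and "m > 0" and H: "\<And>z. \<bar>h z\<bar> \<le> H"
    and "m dvd M" "M > 0"
  shows "(\<Sum>z\<in>{a..<a + int N}. h z) \<le> real N * avg {0..<int M} h + 2 * real m * H"
proof -
  define S where "S = (\<Sum>z\<in>{0..<int m}. h z)"
  define n r where "n = N div m" and "r = N mod m"
  let ?I = "{a + int (n * m)..<a + int (n * m) + int r}"
  have N: "N = n * m + r" "r < m" using assms(2) by (auto simp: n_def r_def)
  have H0: "H \<ge> 0" using H[of 0] by linarith
  obtain d where d: "M = d * m" using assms(4) by (metis dvd_def mult.commute)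
  then have "d > 0" using assms(5) by (cases d) auto
  then have avg: "avg {0..<int M} h = S / real m"
    unfolding d using avg_periodic_multiple[of h m d, OF per] assms(2) by (simp add: avg_def S_def)
  have S: "\<bar>S\<bar> \<le> real m * H"
    unfolding S_def using sum_norm_bound[of "{0..<int m}" h H] H by (simp add: sum_abs[THEN order.trans])
  have "{a..<a + int N} = {a..<a + int (n * m)} \<union> ?I"
    using ivl_disj_un_two(3)[of a "a + int (n * m)" "a + int (n * m) + int r"] N(1) by (simp add: algebra_simps)
  then have "(\<Sum>z\<in>{a..<a + int N}. h z) = (\<Sum>z\<in>{a..<a + int (n * m)}. h z)
      + (\<Sum>z\<in>?I. h z)"
    by (simp only:) (rule sum.union_disjoint, auto)
  also have "(\<Sum>z\<in>{a..<a + int (n * m)}. h z) = real n * S"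
    unfolding S_def by (rule sum_periodic_blocks[of h m, OF per])
  also have "(\<Sum>z\<in>?I. h z) \<le> real r * H"
    using sum_bounded_above[of "?I" h H] H by (simp add: abs_le_iff)
  also have "real r * H \<le> real m * H"
    using N H0 by (intro mult_right_mono) auto
  also have "real n * S \<le> real N * (S / real m) + real m * H"
  proof -
    define v where "v = S / real m"
    have "real N * v = real n * S + real r * v"
      using N assms(2) by (simp add: v_def field_simps)
    moreover have "\<bar>real r * v\<bar> \<le> real m * H"
    proof -
      have "\<bar>real r * v\<bar> = (real r / real m) * \<bar>S\<bar>"
        by (simp add: v_def abs_mult)
      also have "\<dots> \<le> 1 * (real m * H)"
        using N S assms(2) by (intro mult_mono) auto
      finally show ?thesis by simp
    qed
    ultimately show ?thesis unfolding v_def[symmetric] by linarith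
  qed
  finally show ?thesis unfolding avg by (simp add: algebra_simps)
qed

text \<open>Jensen's inequality. The exponent is even because the functions to which it is applied
  may be negative after truncation.\<close>

lemma power_sum_le_card:
  fixes g :: "'a \<Rightarrow> real"
  assumes "finite B" "even k" "k > 0"
  shows "(\<Sum>y\<in>B. g y) ^ k \<le> real (card B) ^ (k - 1) * (\<Sum>y\<in>B. g y ^ k)"
proof (cases "B = {}")
  case True
  then show ?thesis using assms by (simp add: power_0_left)
next
  case False
  define n where "n = real (card B)"
  have n: "n > 0" using False assms by (simp add: n_def card_gt_0_iff)
  have "(\<Sum>y\<in>B. (1 / n) *\<^sub>R g y) ^ k \<le> (\<Sum>y\<in>B. (1 / n) * g y ^ k)"
    by (rule convex_on_sum[OF assms(1) False, of UNIV "\<lambda>x. x ^ k"])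
       (use assms n convex_power_even[of k] in \<open>auto simp: n_def\<close>)
  then have "((\<Sum>y\<in>B. g y) / n) ^ k \<le> (\<Sum>y\<in>B. g y ^ k) / n"
    by (simp add: sum_divide_distrib)
  then have "(\<Sum>y\<in>B. g y) ^ k \<le> n ^ k * ((\<Sum>y\<in>B. g y ^ k) / n)"
    using n by (simp add: power_divide pos_divide_le_eq mult.commute)
  also have "\<dots> = n ^ (k - 1) * (\<Sum>y\<in>B. g y ^ k)"
    using n assms(3) by (simp add: power_eq_if)
  finally show ?thesis unfolding n_def .
qed

section \<open>Conditional densities of a set of integers\<close>

locale modulus_system =
  fixes P :: "'p set" and m :: "'p \<Rightarrow> nat" and m0 :: nat and B :: "int set" and N :: nat
  assumes fin_P: "finite P" and m0_pos: "m0 > 0" and m_pos: "p \<in> P \<Longrightarrow> m p > 0"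
    and coprime_m: "p \<in> P \<Longrightarrow> q \<in> P \<Longrightarrow> p \<noteq> q \<Longrightarrow> coprime (m p) (m q)"
    and coprime_m0: "p \<in> P \<Longrightarrow> coprime (m p) m0"
    and fin_B: "finite B" and N_pos: "N > 0"
begin

definition modl :: "'p set \<Rightarrow> nat" where
  "modl T = m0 * (\<Prod>p\<in>T. m p)"

lemma finite_sub: "T \<subseteq> P \<Longrightarrow> finite T"
  using fin_P finite_subset by blast

lemma modl_pos: "T \<subseteq> P \<Longrightarrow> modl T > 0"
  unfolding modl_def using m0_pos m_pos by (auto intro!: prod_pos)

lemma modl_remove: "T \<subseteq> P \<Longrightarrow> p \<in> T \<Longrightarrow> modl T = modl (T - {p}) * m p"
  using prod.remove[OF finite_sub, of T p m] by (simp add: modl_def mult_ac)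

lemma modl_dvd: "S \<subseteq> T \<Longrightarrow> T \<subseteq> P \<Longrightarrow> modl S dvd modl T"
  unfolding modl_def by (intro mult_dvd_mono dvd_refl prod_dvd_prod_subset finite_sub)

lemma coprime_m_modl:
  assumes "T \<subseteq> P" "p \<in> P" "p \<notin> T"
  shows "coprime (m p) (modl T)"
proof -
  have "coprime (m p) (\<Prod>q\<in>T. m q)"
    using assms by (intro prod_coprime_right coprime_m) auto
  then show ?thesis
    unfolding modl_def using coprime_m0[OF assms(2)] by simp
qed

text \<open>The factor \<open>modl T\<close> makes the mean over residue classes equal to
  \<open>card B / N\<close> for every \<open>T\<close>, so that the functions for different
  \<open>T\<close> are conditional expectations of one function.\<close>

definition dens :: "'p set \<Rightarrow> int \<Rightarrow> real" where
  "dens T z = real (modl T) / real N * real (card {y \<in> B. int (modl T) dvd y - z})"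

lemma dens_shift:
  assumes "modl T dvd c"
  shows "dens T (z + int c) = dens T z"
proof -
  have "int (modl T) dvd int c" using assms by simp
  from dvd_add_left_iff[OF this]
  have "int (modl T) dvd (y - (z + int c)) + int c \<longleftrightarrow> int (modl T) dvd y - (z + int c)" for y .
  then have "int (modl T) dvd y - (z + int c) \<longleftrightarrow> int (modl T) dvd y - z" for y
    by (simp add: algebra_simps)
  then show ?thesis by (simp add: dens_def)
qed

text \<open>By the Chinese remainder theorem a shift by \<open>step p\<close> changes the residue
  modulo \<open>m p\<close> and leaves those modulo \<open>m0\<close> and the other moduli
  fixed.\<close>

abbreviation step :: "'p \<Rightarrow> nat" where
  "step p \<equiv> modl (P - {p})"

abbreviation period :: nat where
  "period \<equiv> modl P"

abbreviation mean :: "(int \<Rightarrow> real) \<Rightarrow> real" where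
  "mean \<equiv> avg {0..<int period}"

text \<open>As \<open>step p\<close> is a multiple of \<open>modl (T - {p})\<close> and coprime to
  \<open>m p\<close>, the \<open>m p\<close> translates of \<open>z\<close> meet each class modulo
  \<open>modl T\<close> inside the class of \<open>z\<close> modulo \<open>modl (T - {p})\<close>
  exactly once.\<close>

lemma sum_dens_step:
  assumes T: "T \<subseteq> P" "p \<in> T"
  shows "(\<Sum>j<m p. dens T (z + int j * int (step p))) = real (m p) * dens (T - {p}) z"
proof -
  let ?m = "int (modl (T - {p}))"
  let ?z = "\<lambda>j. z + int j * int (step p)"
  have p: "p \<in> P" using T by auto
  have mp: "m p > 0" using m_pos[OF p] .
  have eqT: "modl T = modl (T - {p}) * m p" by (rule modl_remove[OF T])
  have cop: "coprime (modl (T - {p})) (m p)"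
    using coprime_m_modl[of "T - {p}" p] T by (auto simp: coprime_commute)
  have cop_u: "coprime (m p) (step p)"
    using p by (intro coprime_m_modl) auto
  have dvd_u: "?m dvd int (step p)"
    using T modl_dvd[of "T - {p}" "P - {p}"] by auto
  have count: "(\<Sum>j<m p. if int (modl T) dvd y - (?z j) then 1 else 0)
     = (if ?m dvd y - z then 1 else (0::real))" for y
  proof (cases "?m dvd y - z")
    case False
    have "\<not> int (modl T) dvd y - (?z j)" for j
    proof
      assume "int (modl T) dvd y - (?z j)"
      moreover have "?m dvd int (modl T)" by (simp add: eqT)
      ultimately have "?m dvd y - (?z j)"
        using dvd_trans by blast
      moreover have "?m dvd int j * int (step p)" by (rule dvd_mult[OF dvd_u])
      ultimately have "?m dvd (y - (?z j)) + int j * int (step p)"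
        by (rule dvd_add)
      with False show False by simp
    qed
    with False show ?thesis by simp
  next
    case True
    have iff: "int (modl T) dvd y - (?z j) \<longleftrightarrow> int (m p) dvd y - (?z j)" for j
    proof
      assume "int (m p) dvd y - (?z j)"
      moreover have "?m dvd (y - z) - int j * int (step p)"
        by (rule dvd_diff[OF True dvd_mult[OF dvd_u]])
      moreover have "coprime (?m) (int (m p))" using cop by simp
      ultimately show "int (modl T) dvd y - (?z j)"
        unfolding eqT of_nat_mult by (intro divides_mult) (auto simp: algebra_simps)
    qed (auto simp: eqT dvd_mult_right)
    have copz: "coprime (int (step p)) (int (m p))" using cop_u by (simp add: coprime_commute)
    have "\<exists>!j. j < m p \<and> int (m p) dvd y - (?z j)"
    proof -
      obtain s t where st: "s * int (step p) + t * int (m p) = 1"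
        using bezout_int[of "int (step p)" "int (m p)"] copz by auto
      define x where "x = s * (y - z)"
      have x: "int (step p) * x - (y - z) = - (t * (y - z)) * int (m p)"
      proof -
        have "(s * int (step p) + t * int (m p)) * (y - z) = y - z"
          unfolding st by simp
        then show ?thesis by (simp add: x_def algebra_simps)
      qed
      define j where "j = nat (x mod int (m p))"
      have j: "j < m p" "int j = x mod int (m p)" using mp by (auto simp: j_def nat_less_iff)
      have "int (m p) dvd x - int j" unfolding j(2) by simp
      then have "int (m p) dvd int (step p) * (x - int j) - (int (step p) * x - (y - z))"
        unfolding x by (rule dvd_diff[OF dvd_mult dvd_triv_right])
      then have ex: "int (m p) dvd y - (?z j)"
        by (simp add: algebra_simps)
      show ?thesis
      proof (intro ex1I[of _ j] conjI j ex)
        fix i assume i: "i < m p \<and> int (m p) dvd y - (?z i)"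
        have "int (m p) dvd (y - (?z i)) - (y - (?z j))"
          by (rule dvd_diff[OF conjunct2[OF i] ex])
        then have "int (m p) dvd int (step p) * (int j - int i)"
          by (simp add: algebra_simps)
        then have "int (m p) dvd int j - int i"
          using copz by (simp add: coprime_dvd_mult_right_iff coprime_commute)
        moreover have "\<bar>int j - int i\<bar> < int (m p)" using i j by auto
        ultimately show "i = j" using dvd_imp_le_int[of "int j - int i" "int (m p)"] by force
      qed
    qed
    then obtain j where j: "j < m p" "\<And>i. i < m p \<Longrightarrow> int (m p) dvd y - (?z i) \<longleftrightarrow> i = j"
      by blast
    have "(\<Sum>i<m p. if int (modl T) dvd y - (?z i) then 1 else (0::real))
        = (\<Sum>i<m p. if i = j then 1 else 0)"
      using j by (intro sum.cong refl) (simp add: iff)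
    then show ?thesis using True j by simp
  qed
  have card_eq: "real (card {y \<in> B. Q y}) = (\<Sum>y\<in>B. if Q y then 1 else 0)" for Q :: "int \<Rightarrow> bool"
    using fin_B by (simp add: sum.If_cases Int_def)
  have "(\<Sum>j<m p. dens T (?z j))
     = real (modl T) / real N * (\<Sum>j<m p. \<Sum>y\<in>B. if int (modl T) dvd y - (?z j) then 1 else 0)"
    by (simp only: dens_def card_eq sum_distrib_left)
  also have "(\<Sum>j<m p. \<Sum>y\<in>B. if int (modl T) dvd y - (?z j) then 1 else (0::real))
     = (\<Sum>y\<in>B. \<Sum>j<m p. if int (modl T) dvd y - (?z j) then 1 else 0)"
    by (rule sum.swap)
  also have "\<dots> = real (card {y \<in> B. ?m dvd y - z})"
    unfolding count card_eq ..
  finally show ?thesis by (simp add: dens_def eqT)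
qed

lemma avg_dens_remove:
  assumes T: "T \<subseteq> P" "p \<in> T" and h: "\<And>z. h (z + int (step p)) = h z"
  shows "mean (\<lambda>z. dens T z * h z) = mean (\<lambda>z. dens (T - {p}) z * h z)"
proof -
  let ?z = "\<lambda>z j. z + int j * int (step p)"
  have p: "p \<in> P" using T by auto
  have mp: "m p > 0" using m_pos[OF p] .
  have hj: "h (?z z j) = h z" for z j
    by (rule periodic_mult) (rule h)
  have per: "int period = int (m p) * int (step p)"
    using modl_remove[of P p] p by simp
  have "h (z + int period) = h z" for z unfolding per by (rule hj)
  then have phi: "dens T (z + int period) * h (z + int period) = dens T z * h z" for z
    using T by (simp add: dens_shift modl_dvd)
  have "real (m p) * mean (\<lambda>z. dens T z * h z)
     = (\<Sum>j<m p. mean (\<lambda>z. dens T (?z z j) * h (?z z j)))"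
    using avg_periodic_shift[of "\<lambda>z. dens T z * h z" period, OF phi] by simp
  also have "\<dots> = (\<Sum>j<m p. mean (\<lambda>z. dens T (?z z j) * h z))"
    unfolding hj ..
  also have "\<dots> = mean (\<lambda>z. \<Sum>j<m p. dens T (?z z j) * h z)"
    by (rule avg_sum[symmetric])
  also have "\<dots> = mean (\<lambda>z. real (m p) * (dens (T - {p}) z * h z))"
    unfolding sum_distrib_right[symmetric] sum_dens_step[OF T] by (simp add: mult.assoc)
  also have "\<dots> = real (m p) * mean (\<lambda>z. dens (T - {p}) z * h z)"
    by (rule avg_cmult)
  finally show ?thesis using mp by simp
qed

definition dens_diff :: "'p set \<Rightarrow> int \<Rightarrow> real" where
  "dens_diff T z = mobius_diff (\<lambda>V. dens V z) T"

lemma dens_diff_shift: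
  assumes "T \<subseteq> P" "modl T dvd c"
  shows "dens_diff T (z + int c) = dens_diff T z"
  unfolding dens_diff_def mobius_diff_def
proof (rule sum.cong[OF refl])
  fix V assume "V \<in> Pow T"
  then have "modl V dvd c"
    using dvd_trans[OF modl_dvd assms(2)] assms(1) by blast
  then show "(-1) ^ card (T - V) * dens V (z + int c) = (-1) ^ card (T - V) * dens V z"
    by (simp add: dens_shift)
qed

lemma avg_dens_diff_eq_0:
  assumes T: "T \<subseteq> P" "p \<in> T" and h: "\<And>z. h (z + int (step p)) = h z"
  shows "mean (\<lambda>z. dens_diff T z * h z) = 0"
proof -
  have "mean (\<lambda>z. dens_diff T z * h z)
      = mobius_diff (\<lambda>V. mean (\<lambda>z. dens V z * h z)) T"
    unfolding dens_diff_def mobius_diff_def sum_distrib_right mult.assoc avg_sum avg_cmult ..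
  also have "\<dots> = 0"
    using T h by (intro mobius_diff_eq_0[of T p] finite_sub avg_dens_remove) auto
  finally show ?thesis .
qed

definition trunc :: "nat \<Rightarrow> 'p set \<Rightarrow> int \<Rightarrow> real" where
  "trunc D S z = (\<Sum>T\<in>small_subsets D S. dens_diff T z)"

lemma trunc_eq_dens:
  assumes "S \<subseteq> P" "card S \<le> D"
  shows "trunc D S z = dens S z"
proof -
  have fin: "finite S" using assms finite_sub by blast
  then have "small_subsets D S = Pow S"
    using assms(2) by (auto intro: order.trans[OF card_mono])
  then show ?thesis
    unfolding trunc_def dens_diff_def by (simp add: sum_mobius_diff[OF fin])
qed

text \<open>Truncation in degree is compatible with averaging out a coordinate because every single
  difference \<open>dens_diff T\<close> with \<open>p \<in> T\<close> averages to 0 against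
  functions that do not depend on \<open>p\<close>.\<close>

lemma martingale: "coordinate_martingale {0..<int period} P (\<lambda>p z. z + int (step p)) (trunc D)"
proof
  show "{0..<int period} \<noteq> {}" using modl_pos[of P] by simp
  show "trunc D S (z + int (step p)) = trunc D S z" if "S \<subseteq> P" "p \<in> P - S" for S p z
    unfolding trunc_def using that by (intro sum.cong refl dens_diff_shift modl_dvd) auto
  show "mean (\<lambda>z. trunc D S z * h z) = mean (\<lambda>z. trunc D (S - {p}) z * h z)"
    if S: "S \<subseteq> P" "p \<in> S" and h: "\<And>z. h (z + int (step p)) = h z" for S p h
  proof -
    have fin: "finite S" using S finite_sub by blast
    have "mean (\<lambda>z. trunc D S z * h z)
       = (\<Sum>T\<in>small_subsets D S. mean (\<lambda>z. dens_diff T z * h z))"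
      unfolding trunc_def sum_distrib_right by (rule avg_sum)
    also have "\<dots> = (\<Sum>T\<in>small_subsets D (S - {p}). mean (\<lambda>z. dens_diff T z * h z))"
    proof (rule sum.mono_neutral_right)
      show "\<forall>T\<in>small_subsets D S - small_subsets D (S - {p}).
          mean (\<lambda>z. dens_diff T z * h z) = 0"
        using S h by (intro ballI avg_dens_diff_eq_0[of _ p]) auto
    qed (use fin in auto)
    also have "\<dots> = mean (\<lambda>z. trunc D (S - {p}) z * h z)"
      unfolding trunc_def sum_distrib_right by (rule avg_sum[symmetric])
    finally show ?thesis .
  qed
qed (use fin_P in simp_all)

lemma abs_dens_diff_le:
  assumes "\<And>T z. T \<subseteq> P \<Longrightarrow> card T \<le> D \<Longrightarrow> dens T z \<le> \<beta>" "T \<subseteq> P" "card T \<le> D"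
  shows "\<bar>dens_diff T z\<bar> \<le> 2 ^ card T * \<beta>"
  unfolding dens_diff_def
proof (rule abs_mobius_diff_le)
  show fin: "finite T" using assms finite_sub by blast
  fix V assume V: "V \<subseteq> T"
  then have "card V \<le> D" using card_mono[OF fin V] assms(3) by simp
  moreover have "V \<subseteq> P" using V assms(2) by auto
  ultimately have "dens V z \<le> \<beta>" using assms(1) by blast
  then show "\<bar>dens V z\<bar> \<le> \<beta>" by (simp add: dens_def)
qed

text \<open>Each difference is bounded by \<open>2 ^ card T * \<beta>\<close>, and summing
  \<open>2 ^ card T\<close> over all subsets of \<open>S\<close> gives
  \<open>(2 + 1) ^ card S\<close>: the origin of the base 3 in the moment bound.\<close>

lemma abs_trunc_le:
  assumes b: "\<And>T z. T \<subseteq> P \<Longrightarrow> card T \<le> D \<Longrightarrow> dens T z \<le> \<beta>" and "S \<subseteq> P" "\<beta> \<ge> 0"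
  shows "\<bar>trunc D S z\<bar> \<le> 3 ^ card S * \<beta>"
proof -
  have fin: "finite S" using assms finite_sub by blast
  have "\<bar>trunc D S z\<bar> \<le> (\<Sum>T\<in>small_subsets D S. \<bar>dens_diff T z\<bar>)"
    unfolding trunc_def by (rule sum_abs)
  also have "\<dots> \<le> (\<Sum>T\<in>small_subsets D S. 2 ^ card T * \<beta>)"
    using assms(2) by (intro sum_mono abs_dens_diff_le[OF b]) auto
  also have "\<dots> \<le> (\<Sum>T\<in>Pow S. 2 ^ card T * \<beta>)"
    using fin assms(3) by (intro sum_mono2) auto
  also have "\<dots> = 3 ^ card S * \<beta>"
    unfolding sum_distrib_right[symmetric] using sum_Pow_power_card[OF fin, of 2] by simp
  finally show ?thesis .
qed

text \<open>
  Truncation to \<open>card T \<le> D\<close> keeps all moduli far below \<open>N\<close>; without it \<open>noise\<close> would be the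
  expectation of \<open>dens S\<close> for a random \<open>S\<close> containing each \<open>p\<close> independently with probability \<open>w p\<close>.
\<close>

definition noise :: "('p \<Rightarrow> real) \<Rightarrow> nat \<Rightarrow> int \<Rightarrow> real" where
  "noise w D z = (\<Sum>T\<in>small_subsets D P. (\<Prod>p\<in>T. w p) * dens_diff T z)"

text \<open>The difference of index \<open>T\<close> occurs in \<open>trunc D S\<close> exactly when
  \<open>T \<subseteq> S\<close>, an event whose probability is the product of \<open>w\<close> over
  \<open>T\<close>.\<close>

lemma noise_eq_mixture: "noise w D z = (\<Sum>S\<in>Pow P. incl_weight P w S * trunc D S z)"
proof -
  have "(\<Sum>S\<in>Pow P. incl_weight P w S * trunc D S z)
     = (\<Sum>S\<in>Pow P. \<Sum>T\<in>{T \<in> small_subsets D P. T \<subseteq> S}. incl_weight P w S * dens_diff T z)"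
    unfolding trunc_def sum_distrib_left by (intro sum.cong) auto
  also have "\<dots> = (\<Sum>T\<in>small_subsets D P. \<Sum>S\<in>{S \<in> Pow P. T \<subseteq> S}. incl_weight P w S * dens_diff T z)"
    using fin_P by (intro sum.swap_restrict) auto
  also have "\<dots> = noise w D z"
    unfolding noise_def sum_distrib_right[symmetric]
  proof (rule sum.cong[OF refl])
    fix T assume "T \<in> small_subsets D P"
    then have "T \<subseteq> P" by simp
    then show "(\<Sum>S\<in>{S \<in> Pow P. T \<subseteq> S}. incl_weight P w S) * dens_diff T z = (\<Prod>p\<in>T. w p) * dens_diff T z"
      by (simp only: sum_incl_weight_superset[OF fin_P])
  qed
  finally show ?thesis ..
qed

lemma avg_noise_power_le:
  assumes b: "\<And>T z. T \<subseteq> P \<Longrightarrow> card T \<le> D \<Longrightarrow> dens T z \<le> \<beta>" and "\<beta> \<ge> 0"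
    and w: "\<And>p. p \<in> P \<Longrightarrow> 0 \<le> w p \<and> w p \<le> 1 \<and> 6 * real k * w p \<le> 1"
    and prod_w: "(\<Prod>p\<in>P. 1 + (6 * real k * w p)\<^sup>2) \<le> 2 ^ D"
  shows "mean (\<lambda>z. noise w D z ^ k) \<le> 2 * \<beta> ^ k"
proof -
  interpret coordinate_martingale "{0..<int period}" P "\<lambda>p z. z + int (step p)" "trunc D"
    by (rule martingale)
  show ?thesis
    unfolding noise_eq_mixture
  proof (rule moment_bound[OF w prod_w \<open>\<beta> \<ge> 0\<close>])
    show "0 \<le> trunc D S z \<and> trunc D S z \<le> \<beta>" if "S \<subseteq> P" "card S \<le> D" for S z
      using b that by (simp add: trunc_eq_dens) (simp add: dens_def)
    show "\<bar>trunc D S z\<bar> \<le> 3 ^ card S * \<beta>" if "S \<subseteq> P" for S z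
      by (rule abs_trunc_le[OF b that \<open>\<beta> \<ge> 0\<close>])
  qed
qed

lemma modl_Union_le:
  assumes "\<And>p. p \<in> P \<Longrightarrow> m p \<le> Q" "Q > 0" "\<And>i. i < k \<Longrightarrow> \<tau> i \<subseteq> P \<and> card (\<tau> i) \<le> D"
  shows "modl (\<Union>i<k. \<tau> i) \<le> m0 * Q ^ (k * D)"
proof -
  let ?V = "\<Union>i<k. \<tau> i"
  have V: "?V \<subseteq> P" using assms(3) by blast
  have "card ?V \<le> (\<Sum>i<k. card (\<tau> i))" by (rule card_UN_le) simp
  also have "\<dots> \<le> (\<Sum>i<k. D)" using assms(3) by (intro sum_mono) auto
  finally have card: "card ?V \<le> k * D" by simp
  have "(\<Prod>p\<in>?V. m p) \<le> (\<Prod>p\<in>?V. Q)"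
    using V assms(1) by (intro prod_mono) auto
  also have "\<dots> \<le> Q ^ (k * D)"
    using card assms(2) by (simp add: power_increasing)
  finally show ?thesis by (simp add: modl_def)
qed

text \<open>The moment bound averages over the full period, which may be far longer than the window.
  After expansion of the power, each product involves at most \<open>k * D\<close> of the moduli and
  so has a short period; the size of \<open>N\<close> ensures that all boundary errors together add
  at most \<open>N * \<beta> ^ k\<close>, whence 3 in place of 2.\<close>

lemma sum_noise_power_le:
  assumes b: "\<And>T z. T \<subseteq> P \<Longrightarrow> card T \<le> D \<Longrightarrow> dens T z \<le> \<beta>" and "\<beta> \<ge> 0"
    and w: "\<And>p. p \<in> P \<Longrightarrow> 0 \<le> w p \<and> w p \<le> 1 \<and> 6 * real k * w p \<le> 1"
    and prod_w: "(\<Prod>p\<in>P. 1 + (6 * real k * w p)\<^sup>2) \<le> 2 ^ D"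
    and Q: "\<And>p. p \<in> P \<Longrightarrow> m p \<le> Q" "Q > 0"
    and N: "2 * m0 * (2 * (card P + 1) * Q) ^ (k * D) \<le> N"
  shows "(\<Sum>z\<in>{a..<a + int N}. noise w D z ^ k) \<le> 3 * real N * \<beta> ^ k"
proof -
  let ?\<T> = "small_subsets D P"
  let ?\<Sigma> = "{..<k} \<rightarrow>\<^sub>E ?\<T>"
  have fin: "finite ?\<T>" using fin_P by simp
  define c where "c \<tau> = (\<Prod>i<k. \<Prod>p\<in>\<tau> i. w p)" for \<tau> :: "nat \<Rightarrow> 'p set"
  define h where "h \<tau> z = (\<Prod>i<k. dens_diff (\<tau> i) z)" for \<tau> :: "nat \<Rightarrow> 'p set" and z
  let ?h = "\<lambda>\<tau>. \<Sum>z\<in>{a..<a + int N}. h \<tau> z"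
  have expand: "noise w D z ^ k = (\<Sum>\<tau>\<in>?\<Sigma>. c \<tau> * h \<tau> z)" for z
  proof -
    have "noise w D z ^ k = (\<Prod>i<k. \<Sum>T\<in>?\<T>. (\<Prod>p\<in>T. w p) * dens_diff T z)"
      by (simp add: noise_def)
    also have "\<dots> = (\<Sum>\<tau>\<in>?\<Sigma>. \<Prod>i<k. (\<Prod>p\<in>\<tau> i. w p) * dens_diff (\<tau> i) z)"
      by (rule prod_sum_PiE) (use fin in auto)
    finally show ?thesis by (simp add: prod.distrib c_def h_def)
  qed
  have c01: "0 \<le> c \<tau> \<and> c \<tau> \<le> 1" if "\<tau> \<in> ?\<Sigma>" for \<tau>
  proof -
    have *: "0 \<le> (\<Prod>p\<in>\<tau> i. w p) \<and> (\<Prod>p\<in>\<tau> i. w p) \<le> 1" if "i < k" for i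
      using \<open>\<tau> \<in> ?\<Sigma>\<close> that w by (intro conjI prod_nonneg prod_le_1) (auto simp: PiE_def Pi_def)
    have "0 \<le> c \<tau>" unfolding c_def by (rule prod_nonneg) (use * in auto)
    moreover have "c \<tau> \<le> 1" unfolding c_def by (rule prod_le_1) (use * in auto)
    ultimately show ?thesis ..
  qed
  define E where "E = 2 * real (m0 * Q ^ (k * D)) * ((2 ^ D * \<beta>) ^ k)"
  have E0: "E \<ge> 0" using \<open>\<beta> \<ge> 0\<close> by (simp add: E_def)
  have single: "?h \<tau> \<le> real N * mean (h \<tau>) + E" if "\<tau> \<in> ?\<Sigma>" for \<tau>
  proof -
    have \<tau>: "\<tau> i \<subseteq> P \<and> card (\<tau> i) \<le> D" if "i < k" for i
      using \<open>\<tau> \<in> ?\<Sigma>\<close> that by (auto simp: PiE_def Pi_def)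
    let ?V = "\<Union>i<k. \<tau> i"
    have V: "?V \<subseteq> P" using \<tau> by blast
    have "?h \<tau> \<le> real N * mean (h \<tau>) + 2 * real (modl ?V) * ((2 ^ D * \<beta>) ^ k)"
    proof (rule sum_periodic_le_avg)
      show "h \<tau> (z + int (modl ?V)) = h \<tau> z" for z
        unfolding h_def using \<tau> V by (intro prod.cong refl dens_diff_shift modl_dvd) auto
      show "\<bar>h \<tau> z\<bar> \<le> (2 ^ D * \<beta>) ^ k" for z
      proof -
        have "\<bar>h \<tau> z\<bar> = (\<Prod>i<k. \<bar>dens_diff (\<tau> i) z\<bar>)" unfolding h_def by (rule abs_prod)
        also have "\<dots> \<le> (\<Prod>i<k. 2 ^ D * \<beta>)"
        proof (intro prod_mono conjI)
          fix i assume i: "i \<in> {..<k}"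
          have "\<bar>dens_diff (\<tau> i) z\<bar> \<le> 2 ^ card (\<tau> i) * \<beta>"
            by (rule abs_dens_diff_le[OF b]) (use \<tau> i in auto)
          also have "\<dots> \<le> 2 ^ D * \<beta>"
            using \<tau> i \<open>\<beta> \<ge> 0\<close> by (intro mult_right_mono power_increasing) auto
          finally show "\<bar>dens_diff (\<tau> i) z\<bar> \<le> 2 ^ D * \<beta>" .
        qed simp
        finally show ?thesis by simp
      qed
    qed (use V modl_pos modl_dvd in auto)
    also have "2 * real (modl ?V) * ((2 ^ D * \<beta>) ^ k) \<le> E"
      unfolding E_def using modl_Union_le[OF Q \<tau>] \<open>\<beta> \<ge> 0\<close>
      by (intro mult_right_mono mult_left_mono of_nat_mono) auto
    finally show ?thesis by simp
  qed
  have "(\<Sum>z\<in>{a..<a + int N}. noise w D z ^ k) = (\<Sum>\<tau>\<in>?\<Sigma>. c \<tau> * ?h \<tau>)"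
    unfolding expand sum_distrib_left by (rule sum.swap)
  also have "\<dots> \<le> (\<Sum>\<tau>\<in>?\<Sigma>. real N * (c \<tau> * mean (h \<tau>)) + E)"
  proof (rule sum_mono)
    fix \<tau> assume \<tau>: "\<tau> \<in> ?\<Sigma>"
    have "c \<tau> * ?h \<tau> \<le> c \<tau> * (real N * mean (h \<tau>) + E)"
      using single[OF \<tau>] c01[OF \<tau>] by (intro mult_left_mono) auto
    also have "\<dots> = real N * (c \<tau> * mean (h \<tau>)) + c \<tau> * E"
      by (simp add: algebra_simps)
    also have "c \<tau> * E \<le> 1 * E"
      using c01[OF \<tau>] E0 by (intro mult_right_mono) auto
    finally show "c \<tau> * ?h \<tau> \<le> real N * (c \<tau> * mean (h \<tau>)) + E"
      by simp
  qed
  also have "\<dots> = real N * mean (\<lambda>z. noise w D z ^ k) + real (card ?\<Sigma>) * E"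
    unfolding expand by (simp add: avg_sum avg_cmult sum.distrib sum_distrib_left)
  also have "\<dots> \<le> real N * (2 * \<beta> ^ k) + real N * \<beta> ^ k"
  proof (intro add_mono mult_left_mono avg_noise_power_le[OF b])
    have "card ?\<Sigma> = card ?\<T> ^ k" by (simp add: card_PiE)
    also have "\<dots> \<le> ((card P + 1) ^ D) ^ k"
      using card_bounded_subsets_le[OF fin_P] by (intro power_mono) auto
    finally have "card ?\<Sigma> * (2 * (m0 * Q ^ (k * D)) * (2 ^ D) ^ k)
        \<le> ((card P + 1) ^ D) ^ k * (2 * (m0 * Q ^ (k * D)) * (2 ^ D) ^ k)"
      by (rule mult_right_mono) simp
    also have "\<dots> = 2 * m0 * (2 * (card P + 1) * Q) ^ (k * D)"
    proof -
      have "(2 * (card P + 1) * Q) ^ (k * D) = 2 ^ (k * D) * (card P + 1) ^ (k * D) * Q ^ (k * D)"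
        by (simp only: power_mult_distrib)
      moreover have "((card P + 1) ^ D) ^ k = (card P + 1) ^ (k * D)" "((2::nat) ^ D) ^ k = 2 ^ (k * D)"
        by (simp_all only: power_mult[symmetric] mult.commute[of D k])
      ultimately show ?thesis by simp
    qed
    also note N
    finally have "real (card ?\<Sigma> * (2 * (m0 * Q ^ (k * D)) * (2 ^ D) ^ k)) * \<beta> ^ k \<le> real N * \<beta> ^ k"
      using \<open>\<beta> \<ge> 0\<close> by (intro mult_right_mono of_nat_mono) auto
    then show "real (card ?\<Sigma>) * E \<le> real N * \<beta> ^ k"
      by (simp add: E_def power_mult_distrib mult_ac)
  qed (use assms in auto)
  finally show ?thesis by simp
qed

text \<open>Jensen's inequality on \<open>B\<close>, after which the even powers may be summed over
  the whole window. The outcome exceeds \<open>\<beta>^2\<close> by the k-th root of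
  \<open>3 / \<beta>\<close>, which \<epsilon> absorbs.\<close>

lemma mean_noise_le:
  assumes b: "\<And>T z. T \<subseteq> P \<Longrightarrow> card T \<le> D \<Longrightarrow> dens T z \<le> \<beta>" and "\<beta> > 0"
    and w: "\<And>p. p \<in> P \<Longrightarrow> 0 \<le> w p \<and> w p \<le> 1 \<and> 6 * real k * w p \<le> 1"
    and prod_w: "(\<Prod>p\<in>P. 1 + (6 * real k * w p)\<^sup>2) \<le> 2 ^ D"
    and Q: "\<And>p. p \<in> P \<Longrightarrow> m p \<le> Q" "Q > 0"
    and N: "2 * m0 * (2 * (card P + 1) * Q) ^ (k * D) \<le> N"
    and k: "even k" "k > 0" and B: "B \<subseteq> {a..<a + int N}" "real (card B) \<le> \<beta> * real N"
    and \<epsilon>: "\<epsilon> \<ge> 0" "3 / \<beta> \<le> (1 + \<epsilon>) ^ k"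
  shows "(\<Sum>y\<in>B. noise w D y) / real N \<le> (1 + \<epsilon>) * \<beta>\<^sup>2"
proof -
  define S where "S = (\<Sum>y\<in>B. noise w D y)"
  have N0: "real N > 0" using N_pos by simp
  have "S ^ k \<le> real (card B) ^ (k - 1) * (\<Sum>y\<in>B. noise w D y ^ k)"
    unfolding S_def by (rule power_sum_le_card[OF fin_B k])
  also have "\<dots> \<le> real (card B) ^ (k - 1) * (\<Sum>y\<in>{a..<a + int N}. noise w D y ^ k)"
    using B(1) k(1) by (intro mult_left_mono sum_mono2) (auto simp: zero_le_even_power)
  also have "\<dots> \<le> (\<beta> * real N) ^ (k - 1) * (3 * real N * \<beta> ^ k)"
    using B(2) sum_noise_power_le[OF b _ w prod_w Q N, of a] \<open>\<beta> > 0\<close> k(1)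
    by (intro mult_mono power_mono sum_nonneg) (auto simp: zero_le_even_power)
  also have "\<dots> = (3 / \<beta>) * (\<beta>\<^sup>2 * real N) ^ k"
  proof -
    have "(\<beta> * real N) ^ k = (\<beta> * real N) * (\<beta> * real N) ^ (k - 1)"
      using k(2) by (simp add: power_eq_if)
    then have "(3 / \<beta>) * (\<beta>\<^sup>2 * real N) ^ k = (3 / \<beta>) * (\<beta> ^ k * ((\<beta> * real N) * (\<beta> * real N) ^ (k - 1)))"
      by (simp add: power2_eq_square power_mult_distrib mult_ac)
    then show ?thesis using \<open>\<beta> > 0\<close> by (simp add: mult_ac)
  qed
  also have "\<dots> \<le> (1 + \<epsilon>) ^ k * (\<beta>\<^sup>2 * real N) ^ k"
    using \<epsilon> by (intro mult_right_mono) auto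
  also have "\<dots> = ((1 + \<epsilon>) * \<beta>\<^sup>2 * real N) ^ k"
    by (simp add: power_mult_distrib mult_ac)
  finally have "S ^ k \<le> ((1 + \<epsilon>) * \<beta>\<^sup>2 * real N) ^ k" .
  then have "\<bar>S\<bar> ^ k \<le> ((1 + \<epsilon>) * \<beta>\<^sup>2 * real N) ^ k"
    using k(1) by (simp add: power_even_abs)
  then have "\<bar>S\<bar> \<le> (1 + \<epsilon>) * \<beta>\<^sup>2 * real N"
    using k(2) \<epsilon>(1) by (subst (asm) power_mono_iff) auto
  then show ?thesis
    using N0 unfolding S_def[symmetric] by (simp add: pos_divide_le_eq)
qed

end

section \<open>The weighted energy of a set without density increment\<close>

lemma Ints_mult_coprime:
  fixes x :: real and a b :: nat
  assumes "x * real a \<in> \<int>" "x * real b \<in> \<int>" "coprime a b"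
  shows "x \<in> \<int>"
proof -
  obtain s t where st: "s * int a + t * int b = 1"
    using bezout_int[of "int a" "int b"] assms(3) by auto
  have "x = x * of_int (s * int a + t * int b)" unfolding st by simp
  also have "\<dots> = of_int s * (x * real a) + of_int t * (x * real b)"
    by (simp add: algebra_simps)
  also have "\<dots> \<in> \<int>" by (rule Ints_add[OF Ints_mult[OF Ints_of_int assms(1)] Ints_mult[OF Ints_of_int assms(2)]])
  finally show ?thesis .
qed

context modulus_system
begin

definition ratpts :: "'p set \<Rightarrow> real set" where
  "ratpts T = {\<theta>. 0 \<le> \<theta> \<and> \<theta> < 1 \<and> \<theta> * real (modl T) \<in> \<int>}"

lemma ratpts_eq_image:
  assumes "T \<subseteq> P"
  shows "ratpts T = (\<lambda>a. real a / real (modl T)) ` {..<modl T}"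
proof -
  have pos: "real (modl T) > 0" using modl_pos[OF assms] by simp
  have "\<theta> \<in> (\<lambda>a. real a / real (modl T)) ` {..<modl T}" if "\<theta> \<in> ratpts T" for \<theta>
  proof -
    have \<theta>: "0 \<le> \<theta>" "\<theta> < 1" and "\<theta> * real (modl T) \<in> \<int>"
      using that by (auto simp: ratpts_def)
    then obtain n where n: "\<theta> * real (modl T) = of_int n"
      by (auto elim: Ints_cases)
    have "0 \<le> \<theta> * real (modl T)" "\<theta> * real (modl T) < real (modl T)"
      using \<theta> pos by auto
    then have "0 \<le> n" "n < int (modl T)" unfolding n by simp_all
    moreover have "\<theta> = real (nat n) / real (modl T)"
      using n pos \<open>0 \<le> n\<close> by (simp add: field_simps)
    ultimately show ?thesis by (intro image_eqI[of _ _ "nat n"]) auto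
  qed
  then show ?thesis using pos by (auto simp: ratpts_def)
qed

lemma finite_ratpts: "T \<subseteq> P \<Longrightarrow> finite (ratpts T)"
  by (simp add: ratpts_eq_image)

lemma ratpts_mono:
  assumes "S \<subseteq> T" "T \<subseteq> P"
  shows "ratpts S \<subseteq> ratpts T"
proof -
  obtain d where "modl T = modl S * d" using modl_dvd[OF assms] by auto
  then have eq: "\<theta> * real (modl T) = (\<theta> * real (modl S)) * of_int (int d)" for \<theta> by simp
  have "\<theta> * real (modl T) \<in> \<int>" if "\<theta> * real (modl S) \<in> \<int>" for \<theta>
    unfolding eq by (rule Ints_mult[OF that Ints_of_int])
  then show ?thesis by (auto simp: ratpts_def)
qed

definition energy :: "real \<Rightarrow> real" where
  "energy \<theta> = local_energy N B \<theta>"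

lemma energy_nonneg [simp]: "energy \<theta> \<ge> 0"
  by (simp add: energy_def)

text \<open>Parseval's identity modulo \<open>modl T\<close>: both sides are the normalised number
  of pairs of elements of \<open>B\<close> congruent modulo \<open>modl T\<close>.\<close>

lemma mean_dens:
  assumes T: "T \<subseteq> P"
  shows "(\<Sum>y\<in>B. dens T y) / real N = (\<Sum>\<theta>\<in>ratpts T. energy \<theta>)"
proof -
  let ?n = "\<lambda>y. card {z \<in> B. int (modl T) dvd z - y}"
  have pos: "modl T > 0" by (rule modl_pos[OF T])
  have inj: "inj_on (\<lambda>a. real a / real (modl T)) {..<modl T}"
    using pos by (auto simp: inj_on_def)
  have "complex_of_real (\<Sum>j<modl T. (norm (\<Sum>y\<in>B. 1 * e2pi (of_int y * (real j / real (modl T)))))\<^sup>2)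
     = of_nat (modl T) * (\<Sum>y\<in>B. \<Sum>z\<in>B. if int (modl T) dvd y - z then 1 * cnj 1 else 0)"
    by (rule sum_norm_square_e2pi[OF fin_B pos])
  also have "\<dots> = complex_of_real (real (modl T) * (\<Sum>y\<in>B. real (?n y)))"
  proof -
    have "(\<Sum>z\<in>B. if int (modl T) dvd y - z then 1 * cnj 1 else (0::complex)) = of_nat (?n y)" for y
      using fin_B by (simp add: sum.If_cases Int_def dvd_diff_commute)
    then show ?thesis by simp
  qed
  finally have "(\<Sum>j<modl T. (norm (exp_sum B (real j / real (modl T))))\<^sup>2)
      = real (modl T) * (\<Sum>y\<in>B. real (?n y))"
    unfolding exp_sum_def mult_1 by (simp only: of_real_eq_iff)
  moreover have "(\<Sum>\<theta>\<in>ratpts T. energy \<theta>) = (\<Sum>j<modl T. (norm (exp_sum B (real j / real (modl T))))\<^sup>2) / (real N)\<^sup>2"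
    unfolding ratpts_eq_image[OF T] sum.reindex[OF inj]
    by (simp add: energy_def norm_divide power_divide sum_divide_distrib)
  moreover have "(\<Sum>y\<in>B. dens T y) / real N
      = real (modl T) * (\<Sum>y\<in>B. real (?n y)) / (real N)\<^sup>2"
    by (simp add: dens_def sum_distrib_left sum_divide_distrib power2_eq_square)
  ultimately show ?thesis by simp
qed

text \<open>For \<open>\<theta> \<in> ratpts P\<close>, \<open>supp \<theta>\<close> is the least \<open>T\<close> such that the denominator of \<open>\<theta>\<close> divides \<open>modl T\<close>.\<close>

definition supp :: "real \<Rightarrow> 'p set" where
  "supp \<theta> = {p \<in> P. \<theta> \<notin> ratpts (P - {p})}"

lemma supp_subset: "supp \<theta> \<subseteq> P"
  by (auto simp: supp_def)

text \<open>The greatest common divisor of \<open>modl T\<close> and \<open>modl (P - {p})\<close>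
  is \<open>modl (T - {p})\<close>, by coprimality of the coordinate moduli.\<close>

lemma ratpts_remove:
  assumes T: "T \<subseteq> P" "p \<in> T" and \<theta>: "\<theta> \<in> ratpts T" "\<theta> \<in> ratpts (P - {p})"
  shows "\<theta> \<in> ratpts (T - {p})"
proof -
  have p: "p \<in> P" using T by auto
  have "modl (T - {p}) dvd modl (P - {p})" using T by (intro modl_dvd) auto
  then obtain r where r: "modl (P - {p}) = modl (T - {p}) * r" by auto
  have "coprime (m p) (modl (P - {p}))" using p by (intro coprime_m_modl) auto
  then have "coprime (m p) r" unfolding r by simp
  moreover have "\<theta> * real (modl (T - {p})) * real (m p) \<in> \<int>"
    using \<theta>(1) modl_remove[OF T] by (simp add: ratpts_def mult.assoc)
  moreover have "\<theta> * real (modl (T - {p})) * real r \<in> \<int>"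
    using \<theta>(2) r by (simp add: ratpts_def mult.assoc)
  ultimately have "\<theta> * real (modl (T - {p})) \<in> \<int>"
    using Ints_mult_coprime by blast
  then show ?thesis using \<theta> by (simp add: ratpts_def)
qed

lemma ratpts_iff_supp:
  assumes "T \<subseteq> P"
  shows "\<theta> \<in> ratpts T \<longleftrightarrow> \<theta> \<in> ratpts P \<and> supp \<theta> \<subseteq> T"
proof
  assume \<theta>: "\<theta> \<in> ratpts T"
  have "p \<in> T" if "p \<in> supp \<theta>" for p
  proof (rule ccontr)
    assume "p \<notin> T"
    then have "ratpts T \<subseteq> ratpts (P - {p})" using assms by (intro ratpts_mono) auto
    with \<theta> that show False by (auto simp: supp_def)
  qed
  then show "\<theta> \<in> ratpts P \<and> supp \<theta> \<subseteq> T" using \<theta> ratpts_mono[OF assms] by auto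
next
  assume \<theta>: "\<theta> \<in> ratpts P \<and> supp \<theta> \<subseteq> T"
  have "\<theta> \<in> ratpts (P - R)" if "finite R" "R \<subseteq> P - T" for R
    using that
  proof (induction R rule: finite_induct)
    case (insert p R)
    have "\<theta> \<in> ratpts (P - R - {p})"
      by (rule ratpts_remove) (use insert \<theta> in \<open>auto simp: supp_def\<close>)
    moreover have "P - R - {p} = P - insert p R" by auto
    ultimately show ?case by simp
  qed (use \<theta> in simp)
  from this[of "P - T"] have "\<theta> \<in> ratpts (P - (P - T))" using fin_P by simp
  then show "\<theta> \<in> ratpts T" using assms by (simp add: double_diff)
qed

lemma mean_dens_diff:
  assumes T: "T \<subseteq> P"
  shows "(\<Sum>y\<in>B. dens_diff T y) / real N = (\<Sum>\<theta>\<in>{\<theta> \<in> ratpts P. supp \<theta> = T}. energy \<theta>)"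
proof -
  define c where "c S = (\<Sum>\<theta>\<in>{\<theta> \<in> ratpts P. supp \<theta> = S}. energy \<theta>)" for S
  have fin: "finite T" using T finite_sub by blast
  have "(\<Sum>y\<in>B. dens_diff T y) / real N = mobius_diff (\<lambda>V. (\<Sum>y\<in>B. dens V y) / real N) T"
    unfolding dens_diff_def mobius_diff_def
    by (subst sum.swap) (simp add: sum_divide_distrib sum_distrib_left)
  also have "\<dots> = mobius_diff (\<lambda>V. \<Sum>S\<in>Pow V. c S) T"
    unfolding mobius_diff_def
  proof (rule sum.cong[OF refl])
    fix V assume "V \<in> Pow T"
    then have V: "V \<subseteq> P" using T by auto
    have "(\<Sum>y\<in>B. dens V y) / real N = (\<Sum>\<theta>\<in>ratpts V. energy \<theta>)" by (rule mean_dens[OF V])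
    also have "ratpts V = (\<Union>S\<in>Pow V. {\<theta> \<in> ratpts P. supp \<theta> = S})"
      using ratpts_iff_supp[OF V] by auto
    also have "(\<Sum>\<theta>\<in>\<dots>. energy \<theta>) = (\<Sum>S\<in>Pow V. c S)"
      unfolding c_def using finite_sub[OF V] finite_ratpts[of P] by (intro sum.UNION_disjoint) auto
    finally show "(-1) ^ card (T - V) * ((\<Sum>y\<in>B. dens V y) / real N) = (-1) ^ card (T - V) * (\<Sum>S\<in>Pow V. c S)"
      by simp
  qed
  also have "\<dots> = c T" by (rule mobius_diff_sum[OF fin])
  finally show ?thesis unfolding c_def .
qed

text \<open>On the Fourier side the noise operator is diagonal, with multiplier the product of
  \<open>w\<close> over the support of the frequency. Its pairing with \<open>B\<close> is thus an
  energy with nonnegative weights, and terms may be added to reach it.\<close>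

lemma mean_noise_eq:
  "(\<Sum>y\<in>B. noise w D y) / real N
   = (\<Sum>\<theta>\<in>{\<theta> \<in> ratpts P. card (supp \<theta>) \<le> D}. (\<Prod>p\<in>supp \<theta>. w p) * energy \<theta>)"
proof -
  let ?R = "\<lambda>T. {\<theta> \<in> ratpts P. supp \<theta> = T}"
  let ?\<T> = "small_subsets D P"
  have "(\<Sum>y\<in>B. noise w D y) / real N = (\<Sum>T\<in>?\<T>. (\<Prod>p\<in>T. w p) * ((\<Sum>y\<in>B. dens_diff T y) / real N))"
    unfolding noise_def by (subst sum.swap) (simp add: sum_divide_distrib sum_distrib_left)
  also have "\<dots> = (\<Sum>T\<in>?\<T>. \<Sum>\<theta>\<in>?R T. (\<Prod>p\<in>supp \<theta>. w p) * energy \<theta>)"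
    by (intro sum.cong refl) (auto simp: mean_dens_diff sum_distrib_left intro!: sum.cong)
  also have "\<dots> = (\<Sum>\<theta>\<in>(\<Union>T\<in>?\<T>. ?R T). (\<Prod>p\<in>supp \<theta>. w p) * energy \<theta>)"
    using fin_P finite_ratpts[of P] by (intro sum.UNION_disjoint[symmetric]) auto
  also have "(\<Union>T\<in>?\<T>. ?R T) = {\<theta> \<in> ratpts P. card (supp \<theta>) \<le> D}"
    using supp_subset by auto
  finally show ?thesis .
qed

end

section \<open>Maximal prime powers and reduced fractions\<close>

definition max_exp :: "nat \<Rightarrow> nat \<Rightarrow> nat" where
  "max_exp Q p = (GREATEST j. p ^ j \<le> Q)"

lemma max_exp:
  assumes "p \<ge> 2" "Q \<ge> 1"
  shows "p ^ max_exp Q p \<le> Q" and "p ^ j \<le> Q \<Longrightarrow> j \<le> max_exp Q p"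
proof -
  have bound: "j \<le> Q" if "p ^ j \<le> Q" for j
  proof -
    have "j < 2 ^ j" by (rule less_exp)
    also have "\<dots> \<le> p ^ j" using assms(1) by (intro power_mono) auto
    finally show ?thesis using that by simp
  qed
  show "p ^ max_exp Q p \<le> Q"
    unfolding max_exp_def by (rule GreatestI_nat[where k = 0 and b = Q]) (use assms bound in auto)
  show "j \<le> max_exp Q p" if "p ^ j \<le> Q"
    unfolding max_exp_def by (rule Greatest_le_nat[where b = Q]) (use that bound in auto)
qed

lemma frac_pairs_inj: "inj_on (\<lambda>(q,a). real a / real q) (frac_pairs Q)"
proof (rule inj_onI, clarify)
  fix q a q' a' assume mem: "(q,a) \<in> frac_pairs Q" "(q',a') \<in> frac_pairs Q"
    and eq: "real a / real q = real a' / real q'"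
  have pos: "q > 0" "q' > 0" and cop: "coprime a q" "coprime a' q'"
    using mem by (auto simp: frac_pairs_def)
  have "real (a * q') = real (a' * q)"
    using eq pos by (simp add: field_simps)
  then have e: "a * q' = a' * q" by linarith
  have "q dvd a * q'" unfolding e by simp
  then have "q dvd q'" using cop by (simp add: coprime_dvd_mult_right_iff coprime_commute)
  moreover have "q' dvd a' * q" unfolding e[symmetric] by simp
  then have "q' dvd q" using cop by (simp add: coprime_dvd_mult_right_iff coprime_commute)
  ultimately have "q = q'" by (rule dvd_antisym)
  then show "q = q' \<and> a = a'" using e pos by simp
qed

lemma two_power_card_primes_le:
  fixes T :: "nat set"
  assumes "finite T" "\<And>p. p \<in> T \<Longrightarrow> prime p \<and> p dvd q" "q > 0"
  shows "(\<Prod>p\<in>T. p) \<le> q" and "2 ^ card T \<le> q"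
proof -
  have "(\<Prod>p\<in>T. p) dvd q"
    using assms(1,2)
  proof (induction T rule: finite_induct)
    case (insert p T)
    then have "coprime p (\<Prod>p\<in>T. p)"
      by (intro prod_coprime_right) (metis insert_iff primes_coprime)
    with insert show ?case by (simp add: divides_mult)
  qed simp
  then show le: "(\<Prod>p\<in>T. p) \<le> q" using assms(3) by (rule dvd_imp_le)
  have "2 ^ card T = (\<Prod>p\<in>T. 2::nat)" by simp
  also have "\<dots> \<le> (\<Prod>p\<in>T. p)"
    using assms(2) by (intro prod_mono) (auto dest: prime_ge_2_nat)
  finally show "2 ^ card T \<le> q" using le by simp
qed

abbreviation large_primes :: "nat \<Rightarrow> nat \<Rightarrow> nat set" where
  "large_primes k Q \<equiv> {p. prime p \<and> 36 * k\<^sup>2 < p \<and> p \<le> Q}"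

text \<open>
  The primes up to \<open>36 * k\<^sup>2\<close> are absorbed into the modulus \<open>m0\<close>. Taking the maximal power of each
  larger prime as coordinate modulus replaces the weight \<open>1 / sqrt q\<close> by the larger \<open>1 / sqrt (rad q)\<close>.
\<close>

theorem local_energy_bound:
  fixes B :: "int set" and N Q k D :: nat and \<beta> \<epsilon> :: real
  defines "Pr \<equiv> large_primes k Q"
  assumes k: "even k" "k > 0" and Q: "Q \<ge> 1" "Q \<le> 2 ^ D"
    and D: "36 * (real k)\<^sup>2 * (\<Sum>p\<in>Pr. 1 / real p) \<le> real D * ln 2"
    and N: "2 * Q ^ (36 * k\<^sup>2) * (2 * (Q + 1) * Q) ^ (k * D) \<le> N"
    and B: "B \<subseteq> {a..<a + int N}"
    and \<beta>: "\<beta> > 0" and \<epsilon>: "\<epsilon> \<ge> 0" "3 / \<beta> \<le> (1 + \<epsilon>) ^ k"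
    and classes: "\<And>n z. 0 < n \<Longrightarrow> n \<le> Q ^ (36 * k\<^sup>2 + D) \<Longrightarrow>
       real (card {y \<in> B. int n dvd y - z}) \<le> \<beta> * real N / real n"
  shows "weighted_energy Q N B
     \<le> (1 + \<epsilon>) * \<beta>\<^sup>2"
proof -
  define Sm where "Sm = {p. prime p \<and> p \<le> 36 * k\<^sup>2}"
  define m where "m p = p ^ max_exp Q p" for p
  define m0 where "m0 = (\<Prod>p\<in>Sm. m p)"
  define w where "w p = 1 / sqrt (real p)" for p :: nat
  have fin_Pr: "finite Pr" unfolding Pr_def by simp
  have fin_Sm: "finite Sm" unfolding Sm_def by simp
  have prime: "prime p" if "p \<in> Pr \<union> Sm" for p using that by (auto simp: Pr_def Sm_def)
  have m_le: "m p \<le> Q" if "p \<in> Pr \<union> Sm" for p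
    unfolding m_def using prime[OF that] Q(1) by (intro max_exp(1)) (auto dest: prime_ge_2_nat)
  have m_pos: "m p > 0" if "p \<in> Pr \<union> Sm" for p
    unfolding m_def using prime[OF that] prime_gt_0_nat by simp
  have cop: "coprime (m p) (m q)" if "p \<in> Pr \<union> Sm" "q \<in> Pr \<union> Sm" "p \<noteq> q" for p q
    unfolding m_def using prime that by (intro coprime_power_left_iff[THEN iffD2] disjI1 coprime_power_right_iff[THEN iffD2] primes_coprime) auto
  have finB: "finite B" using B finite_subset by blast
  have N0: "N > 0"
  proof -
    have "0 < 2 * Q ^ (36 * k\<^sup>2) * (2 * (Q + 1) * Q) ^ (k * D)" using Q(1) by simp
    then show ?thesis using N by linarith
  qed
  interpret modulus_system Pr m m0 B N
  proof
    show "m0 > 0" unfolding m0_def using m_pos by (intro prod_pos) auto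
    show "coprime (m p) m0" if "p \<in> Pr" for p
      unfolding m0_def using that by (intro prod_coprime_right cop) (auto simp: Pr_def Sm_def)
  qed (use fin_Pr m_pos cop finB N0 in auto)
  have m0_le: "m0 \<le> Q ^ (36 * k\<^sup>2)"
  proof -
    have "m0 \<le> (\<Prod>p\<in>Sm. Q)" unfolding m0_def using m_le by (intro prod_mono) auto
    also have "\<dots> = Q ^ card Sm" by simp
    also have "card Sm \<le> card {1..36 * k\<^sup>2}"
      by (intro card_mono) (auto simp: Sm_def dest: prime_ge_1_nat)
    then have "Q ^ card Sm \<le> Q ^ (36 * k\<^sup>2)" using Q(1) by (intro power_increasing) auto
    finally show ?thesis .
  qed
  have dens_le: "dens T z \<le> \<beta>" if "T \<subseteq> Pr" "card T \<le> D" for T z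
  proof -
    have "(\<Prod>p\<in>T. m p) \<le> (\<Prod>p\<in>T. Q)" using m_le that by (intro prod_mono) auto
    also have "\<dots> \<le> Q ^ D" using that Q(1) by (simp add: power_increasing)
    finally have "modl T \<le> Q ^ (36 * k\<^sup>2 + D)"
      unfolding modl_def power_add using m0_le by (intro mult_mono) auto
    then have "real (card {y \<in> B. int (modl T) dvd y - z}) \<le> \<beta> * real N / real (modl T)"
      using classes modl_pos[OF that(1)] by blast
    then show ?thesis
      using modl_pos[OF that(1)] N0 by (simp add: dens_def field_simps)
  qed
  have w: "0 \<le> w p \<and> w p \<le> 1 \<and> 6 * real k * w p \<le> 1" if "p \<in> Pr" for p
  proof -
    have "36 * k\<^sup>2 \<le> p" using that by (simp add: Pr_def)
    then have "real (36 * k\<^sup>2) \<le> real p" by linarith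
    then have "(6 * real k)\<^sup>2 \<le> real p" by (simp add: power_mult_distrib)
    then have "6 * real k \<le> sqrt (real p)" by (rule real_le_rsqrt)
    moreover have "1 \<le> sqrt (real p)" using prime_ge_1_nat[OF prime] that by simp
    ultimately show ?thesis by (simp add: w_def divide_le_eq_1)
  qed
  have prod_w: "(\<Prod>p\<in>Pr. 1 + (6 * real k * w p)\<^sup>2) \<le> 2 ^ D"
  proof -
    have "(\<Prod>p\<in>Pr. 1 + (6 * real k * w p)\<^sup>2) \<le> (\<Prod>p\<in>Pr. exp ((6 * real k * w p)\<^sup>2))"
      by (intro prod_mono conjI exp_ge_add_one_self) auto
    also have "\<dots> = exp (\<Sum>p\<in>Pr. (6 * real k * w p)\<^sup>2)" by (rule exp_sum[OF fin_Pr, symmetric])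
    also have "(\<Sum>p\<in>Pr. (6 * real k * w p)\<^sup>2) = 36 * (real k)\<^sup>2 * (\<Sum>p\<in>Pr. 1 / real p)"
      by (simp add: w_def power_mult_distrib power_divide sum_distrib_left)
    also have "exp \<dots> \<le> exp (real D * ln 2)" using D by simp
    also have "\<dots> = 2 ^ D" by (simp add: exp_of_nat_mult)
    finally show ?thesis .
  qed
  have noise: "(\<Sum>y\<in>B. noise w D y) / real N \<le> (1 + \<epsilon>) * \<beta>\<^sup>2"
  proof (rule mean_noise_le[OF dens_le \<beta> w prod_w, where Q = Q])
    show "2 * m0 * (2 * (card Pr + 1) * Q) ^ (k * D) \<le> N"
    proof (rule order.trans[OF _ N])
      have "card Pr \<le> card {1..Q}"
        by (intro card_mono) (auto simp: Pr_def dest: prime_ge_1_nat)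
      then show "2 * m0 * (2 * (card Pr + 1) * Q) ^ (k * D) \<le> 2 * Q ^ (36 * k\<^sup>2) * (2 * (Q + 1) * Q) ^ (k * D)"
        using m0_le by (intro mult_mono power_mono) auto
    qed
    show "real (card B) \<le> \<beta> * real N"
      using classes[of 1 0] Q(1) by simp
  qed (use m_le Q(1) k B \<epsilon> in auto)
  let ?r = "\<lambda>(q,a). real a / real q"
  let ?R = "{\<theta> \<in> ratpts Pr. card (supp \<theta>) \<le> D}"
  have pt: "?r qa \<in> ?R \<and> 1 / sqrt (real (fst qa)) \<le> (\<Prod>p\<in>supp (?r qa). w p)"
    if "qa \<in> frac_pairs Q" for qa
  proof -
    obtain q a where qa: "qa = (q,a)" by (cases qa)
    with that have q: "1 \<le> q" "q \<le> Q" "a < q" "coprime a q"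
      by (auto simp: frac_pairs_def)
  let ?s = "supp (real a / real q)"
    define T where "T = {p \<in> Pr. p dvd q}"
    have T: "T \<subseteq> Pr" "finite T" using fin_Pr by (auto simp: T_def)
    have "q = (\<Prod>p\<in>prime_factors q. p ^ multiplicity p q)"
      using q(1) by (intro prime_factorization_nat) simp
    also have "\<dots> dvd (\<Prod>p\<in>prime_factors q. m p)"
    proof (intro prod_dvd_prod)
      fix p assume p: "p \<in> prime_factors q"
      then have "p ^ multiplicity p q \<le> Q"
        using multiplicity_dvd[of p q] q by (meson dvd_imp_le le_trans less_le_trans zero_less_one)
      then have "multiplicity p q \<le> max_exp Q p"
        using prime_ge_2_nat[OF in_prime_factors_imp_prime[OF p]] Q(1) by (intro max_exp(2))
      then show "p ^ multiplicity p q dvd m p" unfolding m_def by (rule le_imp_power_dvd)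
    qed
    also have "prime_factors q = (prime_factors q \<inter> Sm) \<union> T"
      using q by (auto simp: T_def Pr_def Sm_def prime_factors_dvd dest: dvd_imp_le)
    also have "(\<Prod>p\<in>(prime_factors q \<inter> Sm) \<union> T. m p) = (\<Prod>p\<in>prime_factors q \<inter> Sm. m p) * (\<Prod>p\<in>T. m p)"
      using T by (intro prod.union_disjoint) (auto simp: Sm_def T_def Pr_def)
    also have "\<dots> dvd modl T"
      unfolding modl_def unfolding m0_def by (intro mult_dvd_mono prod_dvd_prod_subset) (use T fin_Sm in auto)
    finally obtain d where "modl T = q * d" by auto
    then have "real a / real q * real (modl T) = of_int (int (a * d))" using q by simp
    then have "real a / real q * real (modl T) \<in> \<int>" by (metis Ints_of_int)
    then have "real a / real q \<in> ratpts T" using q by (simp add: ratpts_def)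
    then have mem: "real a / real q \<in> ratpts Pr" and supp: "?s \<subseteq> T"
      using ratpts_iff_supp[OF T(1)] by auto
    have primesT: "(\<Prod>p\<in>T. p) \<le> q" "2 ^ card T \<le> q"
      using q(1) T(2) by (auto intro!: two_power_card_primes_le simp: T_def Pr_def)
    \<comment> \<open>A denominator up to \<open>Q \<le> 2 ^ D\<close> has at most \<open>D\<close>
      prime factors, so the truncation discards none of the fractions that carry weight.\<close>
    have "(2::nat) ^ card T \<le> 2 ^ D" using primesT(2) q(2) Q(2) by linarith
    then have "card T \<le> D" by simp
    then have card: "card (?s) \<le> D"
      using card_mono[OF T(2) supp] by simp
    have "1 / sqrt (real q) \<le> 1 / sqrt (real (\<Prod>p\<in>T. p))"
    proof (intro divide_left_mono mult_pos_pos)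
      have "(\<Prod>p\<in>T. p) > 0" by (intro prod_pos) (auto simp: T_def Pr_def dest: prime_gt_0_nat)
      then show "0 < sqrt (real (\<Prod>p\<in>T. p))" by (simp only: real_sqrt_gt_0_iff of_nat_0_less_iff)
      show "sqrt (real (\<Prod>p\<in>T. p)) \<le> sqrt (real q)" using primesT(1) by (simp only: real_sqrt_le_iff of_nat_le_iff)
    qed (use q in auto)
    also have "\<dots> = (\<Prod>p\<in>T. w p)"
    proof -
      have "sqrt (real (\<Prod>p\<in>T. p)) = (\<Prod>p\<in>T. sqrt (real p))"
        using T(2) by (induction T rule: finite_induct) (auto simp: real_sqrt_mult)
      then show ?thesis by (simp add: w_def prod_dividef)
    qed
    also have "\<dots> \<le> (\<Prod>p\<in>?s. w p)"
    proof -
      have "(\<Prod>p\<in>T. w p) = (\<Prod>p\<in>?s. w p) * (\<Prod>p\<in>T - ?s. w p)"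
        using prod.subset_diff[OF supp T(2), of w] by (simp add: mult.commute)
      also have "\<dots> \<le> (\<Prod>p\<in>?s. w p) * 1"
        using w supp T(1) by (intro mult_left_mono prod_le_1 prod_nonneg) auto
      finally show ?thesis by simp
    qed
    finally show ?thesis using mem card by (simp add: qa)
  qed
  have "weighted_energy Q N B
     = (\<Sum>qa\<in>frac_pairs Q. 1 / sqrt (real (fst qa)) * energy (?r qa))"
    by (simp add: energy_def case_prod_unfold)
  also have "\<dots> \<le> (\<Sum>qa\<in>frac_pairs Q. (\<Prod>p\<in>supp (?r qa). w p) * energy (?r qa))"
    using pt by (intro sum_mono mult_right_mono) auto
  also have "\<dots> = (\<Sum>\<theta>\<in>?r ` frac_pairs Q. (\<Prod>p\<in>supp \<theta>. w p) * energy \<theta>)"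
    by (simp add: sum.reindex[OF frac_pairs_inj])
  also have "\<dots> \<le> (\<Sum>\<theta>\<in>?R. (\<Prod>p\<in>supp \<theta>. w p) * energy \<theta>)"
  proof (intro sum_mono2)
    show "finite ?R" using finite_ratpts[of Pr] by simp
    show "?r ` frac_pairs Q \<subseteq> ?R" using pt by blast
    show "0 \<le> (\<Prod>p\<in>supp \<theta>. w p) * energy \<theta>" for \<theta>
      using w supp_subset by (intro mult_nonneg_nonneg prod_nonneg) auto
  qed
  also have "\<dots> = (\<Sum>y\<in>B. noise w D y) / real N" by (rule mean_noise_eq[symmetric])
  also note noise
  finally show ?thesis .
qed

section \<open>Density increment\<close>

lemma card_primes_dyadic:
  assumes "J > 0"
  shows "J * card {p::nat. prime p \<and> 2 ^ J < p \<and> p \<le> 2 ^ Suc J} \<le> 2 * 2 ^ J"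
proof -
  define n :: nat where "n = 2 ^ J"
  define T where "T = {p. prime p \<and> n < p \<and> p \<le> 2 * n}"
  have fin: "finite T" by (simp add: T_def)
  \<comment> \<open>Chebyshev's argument: the primes between \<open>n\<close> and
    \<open>2 * n\<close> all divide the central binomial coefficient, which is at most
    \<open>2 ^ (2 * n)\<close>.\<close>
  have "p dvd (2 * n choose n)" if "p \<in> T" for p
  proof -
    have p: "prime p" "n < p" "p \<le> 2 * n" using that by (auto simp: T_def)
    have "fact n * fact n * (2 * n choose n) = (fact (2 * n) :: nat)"
      using binomial_fact_lemma[of n "2 * n"] by simp
    then have "p dvd fact n * fact n * (2 * n choose n)"
      using p by (simp add: prime_dvd_fact_iff)
    moreover have "\<not> p dvd fact n" using p by (simp add: prime_dvd_fact_iff)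
    ultimately show ?thesis using p(1) by (simp add: prime_dvd_mult_iff)
  qed
  then have "(\<Prod>p\<in>T. p) \<le> (2 * n choose n)"
    using fin by (intro two_power_card_primes_le(1)) (auto simp: T_def)
  also have "\<dots> \<le> 2 ^ (2 * n)" by (rule binomial_le_pow2)
  finally have "(\<Prod>p\<in>T. p) \<le> 2 ^ (2 * n)" .
  moreover have "n ^ card T \<le> (\<Prod>p\<in>T. p)"
    using prod_mono[of T "\<lambda>_. n" "\<lambda>p. p"] by (simp add: T_def)
  ultimately have "(2::nat) ^ (J * card T) \<le> 2 ^ (2 * n)"
    by (simp add: n_def power_mult)
  then have "J * card T \<le> 2 * n" by simp
  then show ?thesis by (simp add: T_def n_def)
qed

text \<open>The block between \<open>2 ^ J\<close> and \<open>2 ^ (J + 1)\<close> contains at most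
  \<open>2 * 2 ^ J / J\<close> primes and contributes at most \<open>2 / J\<close>; the 1/2 is the
  prime 2. Summing over blocks makes the growth doubly logarithmic.\<close>

lemma sum_prime_reciprocals_dyadic:
  assumes "J \<ge> 1"
  shows "(\<Sum>p | prime p \<and> p \<le> 2 ^ J. 1 / real p) \<le> 1 / 2 + 2 * harm (J - 1)"
  using assms
proof (induction J rule: nat_induct_at_least)
  case base
  have "{p::nat. prime p \<and> p \<le> 2 ^ 1} = {2}"
    by (auto dest: prime_ge_2_nat)
  then show ?case by (simp add: harm_def)
next
  case (Suc J)
  define T where "T = {p::nat. prime p \<and> 2 ^ J < p \<and> p \<le> 2 ^ Suc J}"
  let ?S = "\<Sum>p | prime p \<and> p \<le> 2 ^ J. 1 / real p"
  have "{p::nat. prime p \<and> p \<le> 2 ^ Suc J} = {p. prime p \<and> p \<le> 2 ^ J} \<union> T"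
    by (auto simp: T_def intro: order.trans)
  then have "(\<Sum>p | prime p \<and> p \<le> 2 ^ Suc J. 1 / real p)
     = ?S + (\<Sum>p\<in>T. 1 / real p)"
    by (simp only:) (rule sum.union_disjoint, auto simp: T_def)
  also have "(\<Sum>p\<in>T. 1 / real p) \<le> (\<Sum>p\<in>T. 1 / 2 ^ J)"
  proof (intro sum_mono divide_left_mono)
    fix p assume "p \<in> T"
    then have "2 ^ J \<le> p" "p > 0" by (auto simp: T_def)
    then show "2 ^ J \<le> real p" "0 < real p * 2 ^ J"
      by (simp_all add: numeral_power_le_of_nat_cancel_iff)
  qed simp
  also have "\<dots> = real (card T) / 2 ^ J" by simp
  also have "\<dots> \<le> 2 / real J"
  proof -
    have "J * card T \<le> 2 * 2 ^ J"
      unfolding T_def using Suc by (intro card_primes_dyadic) simp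
    then have "real (J * card T) \<le> real (2 * 2 ^ J)" by linarith
    then show ?thesis using Suc by (simp add: field_simps)
  qed
  also have "?S + 2 / real J \<le> 1 / 2 + 2 * harm (Suc J - 1)"
  proof -
    obtain i where i: "J = Suc i" using Suc(1) by (cases J) auto
    have "harm (Suc J - 1) = harm (J - 1) + 1 / real J"
      unfolding i by (simp add: harm_Suc divide_inverse)
    moreover have "?S \<le> 1 / 2 + 2 * harm (J - 1)"
      by (rule Suc(2))
    ultimately show ?thesis by (simp only: distrib_left)
  qed
  finally show ?case by simp
qed

lemma sum_prime_reciprocals_le:
  assumes "J \<ge> 1"
  shows "(\<Sum>p | prime p \<and> p \<le> 2 ^ J. 1 / real p) \<le> 3 + 2 * ln (real J)"
proof (cases "J = 1")
  case True
  then show ?thesis using sum_prime_reciprocals_dyadic[of 1] by (simp add: harm_def)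
next
  case False
  then have "harm (J - 1) \<le> 1 + ln (real (J - 1))" using assms by (intro harm_le_ln) auto
  also have "\<dots> \<le> 1 + ln (real J)" using False assms by simp
  finally show ?thesis using sum_prime_reciprocals_dyadic[OF assms] by simp
qed

text \<open>Without an increment five factors 101/100 are lost against the circle method: one is
  \<open>1 + \<epsilon>\<close>, two come from the square of \<beta>, and two from
  \<open>R \<le> 101 / 100 * X\<close>, which is why \<open>M^2\<close> is kept below
  \<open>X / 100\<close>. Their product is less than 17/16.\<close>

lemma dense_progression:
  fixes X M Q H N k D :: nat
  defines "Pr \<equiv> large_primes k Q"
  assumes A: "A \<subseteq> {1..int X}" "A \<noteq> {}"
    and no_sq: "sq_diff_free A"
    and pos: "M > 0" "N > 0" "X > 0"
    and M2: "100 * M\<^sup>2 \<le> X"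
    and Q: "1536 * (real X)\<^sup>2 \<le> real Q * (real (card A))\<^sup>2" "Q \<ge> 1" "Q \<le> 2 ^ D"
    and H: "real H * (1 + ln (real X)) * real Q \<le> (real M)\<^sup>2"
    and M: "17 * (1 + ln (real X)) * real Q \<le> 4 * real M"
    and NH: "32 * N \<le> H"
    and k: "even k" "k > 0"
    and D: "36 * (real k)\<^sup>2 * (\<Sum>p\<in>Pr. 1 / real p) \<le> real D * ln 2"
    and N: "2 * Q ^ (36 * k\<^sup>2) * (2 * (Q + 1) * Q) ^ (k * D) \<le> N"
    and \<beta>: "\<beta> = 101 / 100 * (real (card A) / real X)" "3 / \<beta> \<le> (101 / 100) ^ k"
  shows "\<exists>x n z. 0 < n \<and> n \<le> Q ^ (36 * k\<^sup>2 + D) \<and>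
     \<beta> * real N / real n < real (card {y \<in> A \<inter> window N x. int n dvd y - z})"
proof (rule ccontr)
  assume "\<not> ?thesis"
  then have classes: "real (card {y \<in> A \<inter> window N x. int n dvd y - z}) \<le> \<beta> * real N / real n"
    if "0 < n" "n \<le> Q ^ (36 * k\<^sup>2 + D)" for x n z
    using that by (meson not_le)
  define R where "R = X + M\<^sup>2"
  have fin: "finite A" using A finite_subset by blast
  have cA: "real (card A) > 0" using fin A by (simp add: card_gt_0_iff)
  have \<beta>0: "\<beta> > 0" using cA pos by (simp add: \<beta>)
  have "17 / 16 * (real (card A))\<^sup>2 \<le> real R * (\<Sum>x\<in>{1..int R}. weighted_energy Q N (A \<inter> window N x))"
    unfolding R_def using M2
    by (intro circle_method[OF A(1) no_sq pos(1,2) A(2) _ Q(1) H M NH]) simp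
  also have "\<dots> \<le> real R * (\<Sum>x\<in>{1..int R}. (1 + 1 / 100) * \<beta>\<^sup>2)"
  proof (intro mult_left_mono sum_mono)
    fix x
    have sub: "A \<inter> window N x \<subseteq> {x - int N + 1..<(x - int N + 1) + int N}"
      by (auto simp: window_def)
    have \<epsilon>: "3 / \<beta> \<le> (1 + 1 / 100) ^ k" using \<beta>(2) by simp
    show "weighted_energy Q N (A \<inter> window N x)
        \<le> (1 + 1 / 100) * \<beta>\<^sup>2"
      by (rule local_energy_bound[OF k Q(2,3) D[unfolded Pr_def] N sub \<beta>0 _ \<epsilon> classes]) simp_all
  qed simp
  also have "\<dots> = (real R)\<^sup>2 * (101 / 100 * \<beta>\<^sup>2)"
    by (simp add: power2_eq_square)
  also have "\<dots> \<le> (101 / 100 * real X)\<^sup>2 * (101 / 100 * \<beta>\<^sup>2)"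
  proof (intro mult_right_mono power_mono)
    have "100 * R \<le> 101 * X" using M2 by (simp add: R_def)
    then have "real (100 * R) \<le> real (101 * X)" by (rule of_nat_mono)
    then show "real R \<le> 101 / 100 * real X" by simp
  qed auto
  also have "\<dots> = (101 / 100) ^ 5 * (real (card A))\<^sup>2"
    using pos by (simp add: \<beta>(1) power_mult_distrib power_divide field_simps)
  finally have "17 / 16 * (real (card A))\<^sup>2 \<le> (101 / 100) ^ 5 * (real (card A))\<^sup>2" .
  then have "(17 / 16 :: real) \<le> (101 / 100) ^ 5"
    using cA by simp
  then show False by (simp add: power_divide)
qed

text \<open>Dilation by n^2 preserves squares, dilation by \<open>n\<close> need not. Among the
  \<open>n\<close> classes modulo n^2 inside the dense class modulo \<open>n\<close>, one has at
  least the average number of elements.\<close>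

lemma rescale_progression:
  fixes N n :: nat and A :: "int set"
  assumes no_sq: "sq_diff_free A"
    and n: "n > 0" and dense: "c / real n < real (card {y \<in> A \<inter> window N x. int n dvd y - z})"
  obtains A' where "A' \<subseteq> {1..int (N div n\<^sup>2 + 1)}"
    "sq_diff_free A'"
    "c / (real n)\<^sup>2 < real (card A')"
proof -
  let ?W = "A \<inter> window N x"
  let ?B = "{y \<in> ?W. int n dvd y - z}"
  have finW: "finite ?W" by simp
  have n2: "int n * int n = int (n\<^sup>2)" by (simp add: power2_eq_square)
  define S where "S i = {y \<in> ?W. int (n\<^sup>2) dvd y - (z + int i * int n)}" for i
  have cover: "?B \<subseteq> (\<Union>i<n. S i)"
  proof
    fix y assume y: "y \<in> ?B"
    then obtain t where t: "y - z = int n * t" by auto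
    define i where "i = nat (t mod int n)"
    have i: "i < n" "int i = t mod int n" using n by (auto simp: i_def nat_less_iff)
    have "t = int n * (t div int n) + int i" unfolding i(2) by simp
    then have "y - z = int n * (int n * (t div int n) + int i)" using t by simp
    then have "y - (z + int i * int n) = int (n\<^sup>2) * (t div int n)"
      unfolding n2[symmetric] by (simp add: algebra_simps)
    then have "int (n\<^sup>2) dvd y - (z + int i * int n)" by (rule dvdI)
    then have "y \<in> S i" using y by (simp add: S_def)
    then show "y \<in> (\<Union>i<n. S i)" using i(1) by blast
  qed
  have "\<exists>i<n. c / (real n)\<^sup>2 < real (card (S i))"
  proof (rule ccontr)
    assume "\<not> ?thesis"
    then have le: "real (card (S i)) \<le> c / (real n)\<^sup>2" if "i < n" for i using that by (meson not_le)
    have "card ?B \<le> card (\<Union>i<n. S i)"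
      using finW by (intro card_mono cover) (auto simp: S_def)
    also have "\<dots> \<le> (\<Sum>i<n. card (S i))" by (rule card_UN_le) simp
    finally have "real (card ?B) \<le> (\<Sum>i<n. real (card (S i)))"
      by (metis of_nat_le_iff of_nat_sum)
    also have "\<dots> \<le> (\<Sum>i<n. c / (real n)\<^sup>2)" using le by (intro sum_mono) auto
    also have "\<dots> = c / real n" using n by (simp add: power2_eq_square)
    finally show False using dense by simp
  qed
  then obtain i where i: "i < n" "c / (real n)\<^sup>2 < real (card (S i))" by blast
  define r where "r = z + int i * int n"
  define N2 where "N2 = int (n\<^sup>2)"
  have N2: "N2 > 0" using n by (simp add: N2_def)
  \<comment> \<open>Rounding down makes the index of every element of the window at least 1. As the
    window need not be aligned with multiples of n^2, the indices can reach one more than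
    \<open>N div n^2\<close>.\<close>
  define b where "b = (x - int N - r) div N2"
  define f where "f y = (y - r) div N2 - b" for y
  have y_eq: "y = r + N2 * (f y + b)" if "y \<in> S i" for y
    using that by (simp add: S_def f_def N2_def r_def)
  have bb: "N2 * b \<le> x - int N - r" "x - int N - r < N2 * b + N2"
    using N2 mult_div_mod_eq[of N2 "x - int N - r"] pos_mod_sign[OF N2, of "x - int N - r"]
      pos_mod_bound[OF N2, of "x - int N - r"] unfolding b_def by linarith+
  have range: "f y \<in> {1..int (N div n\<^sup>2 + 1)}" if y: "y \<in> S i" for y
  proof -
    have win: "x - int N < y" "y \<le> x" using y by (auto simp: S_def window_def)
    have e: "y = r + N2 * f y + N2 * b" using y_eq[OF y] distrib_left[of N2 "f y" b] by linarith
    have "0 < N2 * f y" using e win(1) bb(1) by linarith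
    then have "f y \<ge> 1" using N2 by (simp add: zero_less_mult_iff)
    moreover have "N2 * f y < int N + N2" using e win(2) bb(2) by linarith
    then have "N2 * (f y - 1) < int N" by (simp add: algebra_simps)
    then have "N2 * (f y - 1) div N2 \<le> int N div N2"
      using N2 by (intro zdiv_mono1) auto
    then have "f y - 1 \<le> int N div N2"
      using N2 by simp
    then have "f y \<le> int (N div n\<^sup>2 + 1)" by (simp add: N2_def zdiv_int)
    ultimately show ?thesis by simp
  qed
  have inj: "inj_on f (S i)"
  proof (rule inj_onI)
    fix y1 y2 assume y: "y1 \<in> S i" "y2 \<in> S i" "f y1 = f y2"
    show "y1 = y2"
      by (rule trans[OF y_eq[OF y(1)] trans[OF arg_cong[OF y(3), of "\<lambda>t. r + N2 * (t + b)"] y_eq[OF y(2), symmetric]]])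
  qed
  show thesis
  proof (rule that[of "f ` S i"])
    show "f ` S i \<subseteq> {1..int (N div n\<^sup>2 + 1)}" using range by blast
    show "c / (real n)\<^sup>2 < real (card (f ` S i))" using i(2) by (simp add: card_image[OF inj])
    show "\<not> (\<exists>a1\<in>f ` S i. \<exists>a2\<in>f ` S i. \<exists>s::int. s > 0 \<and> a1 - a2 = s ^ 2)"
    proof
      assume "\<exists>a1\<in>f ` S i. \<exists>a2\<in>f ` S i. \<exists>s::int. s > 0 \<and> a1 - a2 = s ^ 2"
      then obtain y1 y2 s where s: "y1 \<in> S i" "y2 \<in> S i" "s > 0" "f y1 - f y2 = s\<^sup>2" by blast
      have "y1 - y2 = N2 * (f y1 - f y2)"
        using y_eq[OF s(1)] y_eq[OF s(2)] distrib_left[of N2 "f y1" b] distrib_left[of N2 "f y2" b]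
          right_diff_distrib[of N2 "f y1" "f y2"] by linarith
      also have "\<dots> = (int n * s)\<^sup>2"
        unfolding s(4) N2_def by (simp add: power_mult_distrib)
      finally have "y1 - y2 = (int n * s)\<^sup>2" .
      moreover have "int n * s > 0" using n s(3) by simp
      moreover have "y1 \<in> A" "y2 \<in> A" using s by (auto simp: S_def)
      ultimately show False using no_sq by blast
    qed
  qed
qed

section \<open>Choice of parameters\<close>

text \<open>
  For density at least \<open>(200 / 201) ^ (n - 1)\<close> the parameters are
  \<open>k = 200 * n\<close>, \<open>Q = 2 ^ (11 * n)\<close> and \<open>D\<close> of order \<open>n\<^sup>2 * ln (n + 1)\<close>.
\<close>

lemma choose_lengths:
  fixes Y :: real and X Q n :: nat
  assumes n: "n \<ge> 1" and X: "real X = exp Y" and Q: "Q = 2 ^ (11 * n)" and Y: "Y \<ge> 216 * (real n)\<^sup>2"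
  obtains M H N :: nat where "M > 0" "100 * M\<^sup>2 \<le> X"
    "real H * (1 + ln (real X)) * real Q \<le> (real M)\<^sup>2"
    "17 * (1 + ln (real X)) * real Q \<le> 4 * real M"
    "32 * N \<le> H" "exp (Y - Y / (4 * real n)) \<le> real N"
proof -
  have n1: "real n \<ge> 1" using n by simp
  then have n2: "real n \<le> (real n)\<^sup>2" by (simp add: power2_eq_square)
  have Y0: "Y \<ge> 216" using Y n1 n2 by linarith
  have lnX: "ln (real X) = Y" by (simp add: X)
  have Q0: "real Q > 0" by (simp add: Q)
  \<comment> \<open>\<open>51200 = 400 * 128\<close>: since \<open>M \<ge> r / 20\<close>, the
    square of \<open>M\<close> is at least \<open>exp Y / 400\<close>. The factor 128 leaves
    \<open>H \<ge> 64 * V\<close> after rounding, and then \<open>N \<ge> 2 * V - 1 \<ge> V\<close>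
    after division by 32.\<close>
  define G where "G = 51200 * (1 + Y) * real Q"
  have G0: "G > 0" using Q0 Y0 by (simp add: G_def)
  have G_le: "G \<le> exp (Y / (4 * real n))"
  proof -
    have "(51200::real) \<le> 2 ^ 16" by simp
    also have "(2::real) ^ 16 \<le> exp 1 ^ 16" using exp_ge_add_one_self[of 1] by (intro power_mono) auto
    finally have a: "(51200::real) \<le> exp 16" by (simp add: exp_of_nat_mult[symmetric])
    have b: "1 + Y \<le> exp (Y / (8 * real n))"
    proof -
      define y where "y = Y / (8 * real n)"
      have y: "y \<ge> 0" using Y0 n1 by (simp add: y_def)
      have "Y * 128 * (real n)\<^sup>2 \<le> Y * Y"
        using Y Y0 n1 by (simp add: mult.assoc)
      then have "Y \<le> y\<^sup>2 / 2"
        using n1 by (simp add: y_def power_divide field_simps power2_eq_square)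
      moreover have "1 + y + y\<^sup>2 / 2 \<le> exp y" by (rule exp_lower_Taylor_quadratic[OF y])
      ultimately show ?thesis using y unfolding y_def by linarith
    qed
    have c: "real Q \<le> exp (11 * real n)"
    proof -
      have "real Q \<le> exp 1 ^ (11 * n)"
        unfolding Q using exp_ge_add_one_self[of 1] by (simp add: power_mono)
      then show ?thesis by (simp add: exp_of_nat_mult[symmetric])
    qed
    have "G \<le> exp 16 * exp (Y / (8 * real n)) * exp (11 * real n)"
      unfolding G_def using a b c Y0 by (intro mult_mono) auto
    also have "\<dots> = exp (16 + 11 * real n + Y / (8 * real n))" by (simp add: exp_add mult_ac)
    \<comment> \<open>Here \<open>216 = 8 * 16 + 8 * 11\<close> is used: half of the exponent
      \<open>Y / (4 * n)\<close> pays for 51200 and \<open>Q\<close>, the other half for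
      \<open>1 + Y\<close>.\<close>
    also have "16 + 11 * real n + Y / (8 * real n) \<le> Y / (4 * real n)"
    proof -
      have "(16 + 11 * real n) * (8 * real n) \<le> 216 * (real n)\<^sup>2"
        using n2 by (simp add: algebra_simps power2_eq_square)
      then have "(16 + 11 * real n) * (8 * real n) \<le> Y" using Y by (rule order.trans)
      moreover have "0 < 8 * real n" using n1 by simp
      ultimately have "16 + 11 * real n \<le> Y / (8 * real n)" by (simp only: pos_le_divide_eq)
      moreover have "Y / (4 * real n) = 2 * (Y / (8 * real n))" by simp
      ultimately show ?thesis by linarith
    qed
    then have "exp (16 + 11 * real n + Y / (8 * real n)) \<le> exp (Y / (4 * real n))"
      by (simp only: exp_le_cancel_iff)
    finally show ?thesis .
  qed
  have "Y / (4 * real n) \<le> Y / 4" using Y0 n1 by (intro divide_left_mono) auto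
  then have G4: "G \<le> exp (Y / 4)" using G_le by (meson exp_le_cancel_iff order.trans)
  also have "exp (Y / 4) \<le> exp (Y / 2)" using Y0 by simp
  finally have G2: "G \<le> exp (Y / 2)" .
  have G_ge: "51200 \<le> G"
  proof -
    have "1 \<le> real Q" by (simp add: Q)
    then have "51200 * 1 * 1 \<le> G" unfolding G_def using Y0 by (intro mult_mono) auto
    then show ?thesis by simp
  qed
  define V where "V = exp Y / G"
  have V_ge: "exp (Y - Y / (4 * real n)) \<le> V"
    unfolding V_def exp_diff using G_le G0 by (intro divide_left_mono) auto
  have V1: "V \<ge> 1"
  proof -
    have "exp (Y / 2) \<le> exp Y" using Y0 by simp
    then have "G \<le> exp Y" using G2 by linarith
    then show ?thesis using G0 by (simp add: V_def)
  qed
  define r where "r = exp (Y / 2)"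
  have rr: "r * r = exp Y" by (simp add: r_def exp_add[symmetric])
  have r: "r \<ge> 51200" using G2 G_ge by (simp add: r_def)
  define M where "M = nat \<lfloor>r / 10\<rfloor>"
  have M: "real M \<le> r / 10" "real M \<ge> r / 20"
    using r unfolding M_def by linarith+
  define E where "E = (1 + Y) * real Q"
  have E: "E > 0" "G = 51200 * E" using Y0 Q0 by (auto simp: E_def G_def)
  have M2: "(real M)\<^sup>2 \<ge> 128 * V * E"
  proof -
    have "(real M)\<^sup>2 \<ge> (r / 20)\<^sup>2" using M r by (intro power_mono) auto
    also have "(r / 20)\<^sup>2 = exp Y / 400" using rr by (simp add: power2_eq_square)
    also have "exp Y / 400 = 128 * V * E" using E by (simp add: V_def)
    finally show ?thesis .
  qed
  define H where "H = nat \<lfloor>(real M)\<^sup>2 / E\<rfloor>"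
  have ME: "(real M)\<^sup>2 / E \<ge> 128 * V" using M2 E by (simp add: pos_le_divide_eq)
  have H: "real H \<le> (real M)\<^sup>2 / E" "real H \<ge> 64 * V"
    using ME V1 unfolding H_def by linarith+
  define N where "N = H div 32"
  have "real N \<ge> real H / 32 - 1"
  proof -
    have "H = 32 * N + H mod 32" "H mod 32 < 32" by (simp_all add: N_def)
    then have "H \<le> 32 * N + 32" by linarith
    then have "real H \<le> real (32 * N + 32)" by (rule of_nat_mono)
    then show ?thesis by simp
  qed
  then have NV: "real N \<ge> V" using H V1 by linarith
  show thesis
  proof (rule that[of M H N])
    show "M > 0" using M r by (cases "M = 0") auto
    have "(10 * real M)\<^sup>2 \<le> r\<^sup>2" using M by (intro power_mono) auto
    then have "real (100 * M\<^sup>2) \<le> real X"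
      using rr by (simp add: X power2_eq_square power_mult_distrib)
    then show "100 * M\<^sup>2 \<le> X" by linarith
    have "real H * E \<le> (real M)\<^sup>2" using H(1) E by (simp add: pos_le_divide_eq)
    then show "real H * (1 + ln (real X)) * real Q \<le> (real M)\<^sup>2"
      unfolding lnX E_def by (simp add: mult.assoc)
    have "85 * E \<le> r" using G2 E unfolding r_def by linarith
    then have "17 * E \<le> 4 * real M" using M(2) by linarith
    then show "17 * (1 + ln (real X)) * real Q \<le> 4 * real M"
      unfolding lnX E_def by (simp only: mult.assoc)
    show "32 * N \<le> H" by (simp add: N_def)
    show "exp (Y - Y / (4 * real n)) \<le> real N" using V_ge NV by simp
  qed
qed

lemma ln_2_ge_half: "ln (2::real) \<ge> 1 / 2"
  using ln2_ge_two_thirds by linarith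

lemma choose_degree:
  fixes n k Q :: nat
  assumes n: "n \<ge> 1" and k: "k = 200 * n" and Q: "Q = 2 ^ (11 * n)"
  obtains D :: nat where "Q \<le> 2 ^ D"
    "36 * (real k)\<^sup>2 * (\<Sum>p\<in>large_primes k Q. 1 / real p) \<le> real D * ln 2"
    "real (Q ^ (36 * k\<^sup>2 + D)) \<le> exp (1000000000 * real n ^ 3 * ln (real n + 1))"
    "real (2 * Q ^ (36 * k\<^sup>2) * (2 * (Q + 1) * Q) ^ (k * D)) \<le> exp (1000000000000 * real n ^ 4 * ln (real n + 1))"
proof -
  let ?S = "\<Sum>p\<in>large_primes k Q. 1 / real p"
  define l where "l = ln (real n + 1)"
  define \<nu> where "\<nu> = real n"
  have \<nu>: "\<nu> \<ge> 1" using n by (simp add: \<nu>_def)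
  have l2: "ln 2 \<le> l" using n unfolding l_def by simp
  then have l: "l \<ge> 1 / 2" using ln_2_ge_half by linarith
  \<comment> \<open>\<open>43200000 = 36 * 200^2 * 15 * 2\<close>: here
    \<open>36 * k^2 = 36 * 200^2 * n^2\<close>, the reciprocals of the primes sum to at most
    \<open>15 * l\<close>, and 2 bounds \<open>1 / ln 2\<close>.\<close>
  define D where "D = nat \<lceil>43200000 * \<nu>\<^sup>2 * l\<rceil>"
  let ?K = "1 + 36 * k\<^sup>2 + 3 * (k * D)"
  have nl: "\<nu> * \<nu> * l \<ge> \<nu> / 2"
  proof -
    have "\<nu> * 1 * (1 / 2) \<le> \<nu> * \<nu> * l" using \<nu> l by (intro mult_mono) auto
    then show ?thesis by simp
  qed
  then have big: "\<nu>\<^sup>2 * l \<ge> \<nu> / 2" by (simp add: power2_eq_square)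
  have D_ge: "real D \<ge> 43200000 * \<nu>\<^sup>2 * l" unfolding D_def by linarith
  have D_le: "real D \<le> 86400000 * \<nu>\<^sup>2 * l"
    using big \<nu> unfolding D_def by linarith
  have lnQ: "ln (real Q) = 11 * \<nu> * ln 2" by (simp add: Q \<nu>_def ln_realpow)
  have ln2: "ln (2::real) \<le> 1" using ln_add_one_self_le_self[of 1] by simp
  then have lnQ_le: "ln (real Q) \<le> 11 * \<nu>"
    unfolding lnQ using \<nu> by (simp add: mult_left_le)
  have Q0: "real Q > 0" by (simp add: Q)
  have Q_exp: "real Q \<le> exp (11 * \<nu>)" using lnQ_le Q0 by (metis exp_le_cancel_iff exp_ln)
  have ksq: "real (36 * k\<^sup>2) = 1440000 * \<nu>\<^sup>2" by (simp add: k \<nu>_def power2_eq_square)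
  have \<nu>3: "\<nu> ^ 3 = \<nu> * \<nu>\<^sup>2" "\<nu> ^ 4 = \<nu> * \<nu> ^ 3" by (simp_all add: power_eq_if)
  have pw0: "\<nu>\<^sup>2 \<ge> 0" "\<nu> ^ 3 \<ge> 1" "\<nu> ^ 4 \<ge> \<nu> ^ 3"
    using \<nu> by (auto simp: one_le_power intro: power_increasing)
  show thesis
  proof (rule that[of D])
    have "real (11 * n) \<le> real D" using D_ge big \<nu> unfolding \<nu>_def by linarith
    then have "11 * n \<le> D" by linarith
    then show "Q \<le> 2 ^ D" unfolding Q by (intro power_increasing) auto
    have lnb: "ln (real (11 * n)) \<le> 4 * ln 2 + l"
    proof -
      have "ln (real (11 * n)) \<le> ln (2 ^ 4 * (real n + 1))" using n by simp
      also have "\<dots> = ln (2 ^ 4) + l" unfolding l_def by (rule ln_mult_pos) auto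
      also have "ln ((2::real) ^ 4) = 4 * ln 2" using ln_realpow[of 2 4] by simp
      finally show ?thesis .
    qed
    have "?S \<le> (\<Sum>p | prime p \<and> p \<le> 2 ^ (11 * n). 1 / real p)"
      unfolding Q by (intro sum_mono2) auto
    also have "\<dots> \<le> 3 + 2 * ln (real (11 * n))"
      using n by (intro sum_prime_reciprocals_le) simp
    finally have S: "?S \<le> 15 * l"
      using lnb l2 ln2_ge_two_thirds by linarith
    define s where "s = ?S"
    have "36 * (real k)\<^sup>2 * s = 1440000 * \<nu>\<^sup>2 * s" using ksq by simp
    also have "\<dots> \<le> 1440000 * \<nu>\<^sup>2 * (15 * l)" using S unfolding s_def by (intro mult_left_mono) auto
    also have "\<dots> \<le> real D * (1 / 2)" using D_ge by linarith
    also have "\<dots> \<le> real D * ln 2" using ln_2_ge_half by (intro mult_left_mono) auto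
    finally show "36 * (real k)\<^sup>2 * ?S \<le> real D * ln 2"
      unfolding s_def .
    have sumD: "1440000 * \<nu>\<^sup>2 + real D \<le> 89280000 * \<nu>\<^sup>2 * l"
    proof -
      have "\<nu>\<^sup>2 * (1 / 2) \<le> \<nu>\<^sup>2 * l" using l by (intro mult_left_mono) auto
      then show ?thesis using D_le by linarith
    qed
    have "real (Q ^ (36 * k\<^sup>2 + D)) \<le> exp (11 * \<nu>) ^ (36 * k\<^sup>2 + D)"
      unfolding of_nat_power using Q_exp by (intro power_mono) auto
    also have "\<dots> = exp (real (36 * k\<^sup>2 + D) * (11 * \<nu>))" by (rule exp_of_nat_mult[symmetric])
    also have "real (36 * k\<^sup>2 + D) * (11 * \<nu>) \<le> (89280000 * \<nu>\<^sup>2 * l) * (11 * \<nu>)"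
      unfolding of_nat_add ksq using sumD \<nu> by (intro mult_right_mono) auto
    also have "\<dots> \<le> 1000000000 * \<nu> ^ 3 * l"
      using \<nu> l by (simp add: \<nu>3 power2_eq_square mult_ac)
    finally show "real (Q ^ (36 * k\<^sup>2 + D)) \<le> exp (1000000000 * real n ^ 3 * ln (real n + 1))"
      by (simp add: \<nu>_def l_def)
    have "2 * (Q + 1) * Q \<le> Q ^ 3"
    proof -
      have "(2::nat) ^ 11 \<le> Q" unfolding Q using n by (intro power_increasing) auto
      then have "4 * Q \<le> Q * Q" "2 * (Q + 1) \<le> 4 * Q" by simp_all
      then have "2 * (Q + 1) \<le> Q * Q" by (rule order.trans[rotated])
      from mult_le_mono1[OF this, of Q] show ?thesis by (simp only: power3_eq_cube)
    qed
    then have "(2 * (Q + 1) * Q) ^ (k * D) \<le> (Q ^ 3) ^ (k * D)" by (rule power_mono) simp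
    moreover have "2 \<le> Q" unfolding Q using n by (intro self_le_power[of 2, THEN order.trans[rotated]]) auto
    ultimately have "2 * Q ^ (36 * k\<^sup>2) * (2 * (Q + 1) * Q) ^ (k * D) \<le> Q * Q ^ (36 * k\<^sup>2) * (Q ^ 3) ^ (k * D)"
      by (intro mult_mono) auto
    also have "\<dots> = Q ^ ?K"
      by (simp add: power_add power_mult)
    finally have "real (2 * Q ^ (36 * k\<^sup>2) * (2 * (Q + 1) * Q) ^ (k * D)) \<le> real (Q ^ ?K)"
      by (rule of_nat_mono)
    also have "\<dots> \<le> exp (11 * \<nu>) ^ ?K"
      unfolding of_nat_power using Q_exp by (intro power_mono) auto
    also have "\<dots> = exp (real ?K * (11 * \<nu>))"
      by (rule exp_of_nat_mult[symmetric])
    also have "real ?K = 1 + 1440000 * \<nu>\<^sup>2 + 600 * \<nu> * real D"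
      using ksq by (simp add: k \<nu>_def)
    also have "\<dots> \<le> 60000000000 * \<nu> ^ 3 * l"
    proof -
      have "600 * \<nu> * real D \<le> 600 * \<nu> * (86400000 * \<nu>\<^sup>2 * l)"
        using D_le \<nu> by (intro mult_left_mono) auto
      also have "\<dots> = 51840000000 * \<nu> ^ 3 * l" by (simp add: \<nu>3)
      finally have a: "600 * \<nu> * real D \<le> 51840000000 * \<nu> ^ 3 * l" .
      have "1 * \<nu>\<^sup>2 \<le> \<nu> * \<nu>\<^sup>2" using \<nu> by (intro mult_right_mono) auto
      then have b: "\<nu>\<^sup>2 \<le> \<nu> ^ 3" by (simp add: \<nu>3)
      have c: "\<nu> ^ 3 * (1 / 2) \<le> \<nu> ^ 3 * l" by (rule mult_left_mono) (use l \<nu> in auto)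
      show ?thesis using a b c pw0(2) by linarith
    qed
    then have "exp ((1 + 1440000 * \<nu>\<^sup>2 + 600 * \<nu> * real D) * (11 * \<nu>)) \<le> exp (60000000000 * \<nu> ^ 3 * l * (11 * \<nu>))"
      using \<nu> by (simp add: mult_right_mono)
    also have "\<dots> \<le> exp (1000000000000 * \<nu> ^ 4 * l)"
      using \<nu> l by (simp add: \<nu>3 mult_ac)
    finally show "real (2 * Q ^ (36 * k\<^sup>2) * (2 * (Q + 1) * Q) ^ (k * D)) \<le> exp (1000000000000 * real n ^ 4 * ln (real n + 1))"
      by (simp add: \<nu>_def l_def)
  qed
qed

section \<open>Iteration\<close>

text \<open>The window costs \<open>Y / (4 * n)\<close> in the logarithm of the length, and the
  square of the difference \<open>r\<close> costs as much again; together they give the factor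
  \<open>1 - 1 / (2 * n)\<close>. The constant 10 ^ 13 makes \<open>Y\<close> large enough for the
  period in \<open>hN\<close> and for the square of \<open>r\<close>.\<close>

lemma increment_step:
  fixes A :: "int set" and X n :: nat
  assumes A: "A \<subseteq> {1..int X}" "sq_diff_free A" and n: "n \<ge> 1"
    and dens: "real X \<le> (201 / 200) ^ (n - 1) * real (card A)"
    and X: "X > 0" "10000000000000 * real n ^ 4 * (ln (real n + 1))\<^sup>2 \<le> ln (real X)"
  obtains A' X' where "A' \<subseteq> {1..int X'}" "sq_diff_free A'" "X' > 0"
    "ln (real X) * (1 - 1 / (2 * real n)) \<le> ln (real X')"
    "201 / 200 * (real (card A) / real X) * real X' < real (card A')"
proof -
  define Y where "Y = ln (real X)"
  have XY: "real X = exp Y" using X by (simp add: Y_def)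
  define l where "l = ln (real n + 1)"
  define \<nu> where "\<nu> = real n"
  let ?z = "1000000000 * \<nu> ^ 3 * l"
  have \<nu>: "\<nu> \<ge> 1" using n by (simp add: \<nu>_def)
  have "ln 2 \<le> l" using n unfolding l_def by simp
  then have l: "l \<ge> 1 / 2" using ln_2_ge_half by linarith
  have \<nu>3: "\<nu> ^ 3 = \<nu> * \<nu>\<^sup>2" "\<nu> ^ 4 = \<nu> * \<nu> ^ 3" by (simp_all add: power_eq_if)
  have pw: "\<nu>\<^sup>2 \<ge> 1" "\<nu> ^ 4 \<ge> \<nu>\<^sup>2" "\<nu> ^ 4 \<ge> 1"
    using \<nu> by (auto simp: one_le_power intro: power_increasing)
  define K where "K = \<nu> ^ 4 * l"
  have K: "K \<ge> \<nu>\<^sup>2 / 2" "K \<ge> 1 / 2"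
    using mult_mono[OF pw(2) l] mult_mono[OF pw(3) l] pw by (simp_all add: K_def)
  have YK: "Y \<ge> 5 * 1000000000000 * K"
  proof -
    have "l * (1 / 2) \<le> l * l" using l by (intro mult_left_mono) auto
    then have "10000000000000 * \<nu> ^ 4 * (l * (1 / 2)) \<le> 10000000000000 * \<nu> ^ 4 * l\<^sup>2"
      unfolding power2_eq_square by (rule mult_left_mono) (use \<nu> in simp)
    moreover have "10000000000000 * \<nu> ^ 4 * l\<^sup>2 \<le> Y" using X(2) by (simp add: Y_def \<nu>_def l_def)
    moreover have "10000000000000 * \<nu> ^ 4 * (l * (1 / 2)) = 5 * 1000000000000 * K" by (simp add: K_def)
    ultimately show ?thesis by linarith
  qed
  have Y216: "Y \<ge> 216 * (real n)\<^sup>2" using YK K(1) zero_le_power2[of "real n"] unfolding \<nu>_def by linarith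
  have Y100: "Y \<ge> 100" using YK K(2) by linarith
  define k where "k = 200 * n"
  define Q :: nat where "Q = 2 ^ (11 * n)"
  obtain D where D: "Q \<le> 2 ^ D"
    "36 * (real k)\<^sup>2 * (\<Sum>p\<in>large_primes k Q. 1 / real p) \<le> real D * ln 2"
    "real (Q ^ (36 * k\<^sup>2 + D)) \<le> exp (1000000000 * real n ^ 3 * ln (real n + 1))"
    "real (2 * Q ^ (36 * k\<^sup>2) * (2 * (Q + 1) * Q) ^ (k * D)) \<le> exp (1000000000000 * real n ^ 4 * ln (real n + 1))"
    by (rule choose_degree[OF n k_def Q_def])
  obtain M H N where MHN: "M > 0" "100 * M\<^sup>2 \<le> X"
    "real H * (1 + ln (real X)) * real Q \<le> (real M)\<^sup>2"
    "17 * (1 + ln (real X)) * real Q \<le> 4 * real M"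
    "32 * N \<le> H" "exp (Y - Y / (4 * real n)) \<le> real N"
    by (rule choose_lengths[OF n XY Q_def Y216])
  have fin: "finite A" using A finite_subset by blast
  have cA: "real (card A) > 0"
  proof (rule ccontr)
    assume "\<not> ?thesis"
    then have "real (card A) = 0" by simp
    then show False using dens X by simp
  qed
  define \<alpha> where "\<alpha> = real (card A) / real X"
  have \<alpha>: "\<alpha> > 0" using cA X by (simp add: \<alpha>_def)
  have \<alpha>_ge: "1 / \<alpha> \<le> (201 / 200) ^ (n - 1)"
    using dens cA by (simp add: \<alpha>_def pos_divide_le_eq)
  have Y4: "Y / (4 * \<nu>) \<le> Y / 4" using \<nu> Y100 by (intro divide_left_mono) auto
  have "exp 0 < exp (Y - Y / (4 * real n))" using Y4 Y100 unfolding \<nu>_def by simp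
  then have N0: "N > 0" using MHN(6) by (cases "N = 0") auto
  have hQ: "1536 * (real X)\<^sup>2 \<le> real Q * (real (card A))\<^sup>2"
  proof -
    have "1536 * (real X)\<^sup>2 \<le> 1536 * ((201 / 200) ^ (n - 1) * real (card A))\<^sup>2"
      using dens by (intro mult_left_mono power_mono) auto
    also have "\<dots> = 1536 * ((201 / 200)\<^sup>2) ^ (n - 1) * (real (card A))\<^sup>2"
      by (simp add: power_mult_distrib power_mult[symmetric] mult.commute)
    \<comment> \<open>\<open>2048 = 2 ^ 11\<close> generously covers both 1536 and the square of
      201/200, which explains the exponent \<open>11 * n\<close> of \<open>Q\<close>.\<close>
    also have "\<dots> \<le> 2048 * 2048 ^ (n - 1) * (real (card A))\<^sup>2"
      by (intro mult_right_mono mult_mono power_mono) (auto simp: power2_eq_square)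
    also have "(2048::real) * 2048 ^ (n - 1) = 2048 ^ n" using n by (simp add: power_eq_if)
    also have "(2048::real) ^ n = real Q" by (simp add: Q_def power_mult)
    finally show ?thesis .
  qed
  have h\<beta>: "3 / (101 / 100 * \<alpha>) \<le> (101 / 100) ^ k"
  proof -
    have "3 / (101 / 100 * \<alpha>) \<le> 3 * (1 / \<alpha>)" using \<alpha> by (simp add: field_simps)
    also have "\<dots> \<le> 3 * (201 / 200) ^ (n - 1)" using \<alpha>_ge by simp
    also have "\<dots> \<le> 4 * 4 ^ (n - 1)" by (intro mult_mono power_mono) auto
    also have "\<dots> = 4 ^ n" using n by (simp add: power_eq_if)
    also have "\<dots> \<le> ((101 / 100) ^ 200) ^ n"
    proof (intro power_mono)
      \<comment> \<open>By Bernoulli's inequality 200 factors 101/100 exceed 4. This is why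
        \<open>k = 200 * n\<close>.\<close>
      have "1 + real 100 * (1 / 100 :: real) \<le> (1 + 1 / 100) ^ 100" by (rule Bernoulli_inequality) simp
      then have "(2::real) \<le> (101 / 100) ^ 100" by simp
      then have "(2::real)\<^sup>2 \<le> ((101 / 100) ^ 100)\<^sup>2" by (intro power_mono) auto
      then show "(4::real) \<le> (101 / 100) ^ 200" by (simp only: power_mult[symmetric]) simp
    qed simp
    finally show ?thesis by (simp add: k_def power_mult)
  qed
  have hN: "2 * Q ^ (36 * k\<^sup>2) * (2 * (Q + 1) * Q) ^ (k * D) \<le> N"
  proof -
    have "1000000000000 * \<nu> ^ 4 * l \<le> Y - Y / (4 * \<nu>)"
      using YK Y4 K(2) Y100 unfolding K_def by linarith
    then have "exp (1000000000000 * real n ^ 4 * ln (real n + 1)) \<le> exp (Y - Y / (4 * real n))"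
      unfolding \<nu>_def l_def by simp
    then have "real (2 * Q ^ (36 * k\<^sup>2) * (2 * (Q + 1) * Q) ^ (k * D)) \<le> real N"
      using D(4) MHN(6) by linarith
    then show ?thesis by linarith
  qed
  have "\<exists>x r z. 0 < r \<and> r \<le> Q ^ (36 * k\<^sup>2 + D) \<and>
     101 / 100 * \<alpha> * real N / real r < real (card {y \<in> A \<inter> window N x. int r dvd y - z})"
    using n \<alpha> cA by (intro dense_progression[OF A(1) _ A(2) MHN(1) N0 X(1) MHN(2) hQ _ D(1) MHN(3-5) _ _ D(2) hN _ h\<beta>])
       (auto simp: \<alpha>_def Q_def k_def)
  then obtain x r z where r: "0 < r" "r \<le> Q ^ (36 * k\<^sup>2 + D)"
     "101 / 100 * \<alpha> * real N / real r < real (card {y \<in> A \<inter> window N x. int r dvd y - z})"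
    by blast
  define X' where "X' = N div r\<^sup>2 + 1"
  obtain A' where A': "A' \<subseteq> {1..int X'}" "sq_diff_free A'"
    "101 / 100 * \<alpha> * real N / (real r)\<^sup>2 < real (card A')"
    unfolding X'_def by (rule rescale_progression[OF A(2) r(1,3)])
  define W where "W = real N / (real r)\<^sup>2"
  have r0: "real r > 0" using r by simp
  have W_le: "W \<le> real X'"
  proof -
    have "N < r\<^sup>2 * X'"
      unfolding X'_def using dividend_less_times_div[of "r\<^sup>2" N] r(1) by simp
    then have "real N \<le> real (r\<^sup>2 * X')" by linarith
    then show ?thesis using r0 by (simp add: W_def pos_divide_le_eq mult.commute)
  qed
  have X'_le: "real X' \<le> W + 1"
    using of_nat_div_le_of_nat[of N "r\<^sup>2", where ?'a = real] by (simp add: X'_def W_def)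
  have W_exp: "exp (Y - Y / (2 * \<nu>)) \<le> W"
  proof -
    have r_exp: "real r \<le> exp ?z"
      using r(2) D(3) unfolding \<nu>_def l_def by (meson of_nat_mono order.trans)
    have "(real r)\<^sup>2 \<le> exp ?z * exp ?z"
      unfolding power2_eq_square using r_exp by (intro mult_mono) auto
    also have "\<dots> = exp (2 * ?z)" by (simp add: exp_add[symmetric])
    also have "2 * ?z \<le> Y / (4 * \<nu>)"
    proof -
      have "2 * ?z * (4 * \<nu>) = 8 * 1000000000 * K" by (simp add: K_def \<nu>3)
      also have "\<dots> \<le> Y" using YK K(2) by linarith
      finally show ?thesis using \<nu> by (simp add: pos_le_divide_eq)
    qed
    then have "exp (2 * ?z) \<le> exp (Y / (4 * \<nu>))" by simp
    finally have "(real r)\<^sup>2 \<le> exp (Y / (4 * \<nu>))" .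
    have "exp (Y - Y / (2 * \<nu>)) * (real r)\<^sup>2 \<le> exp (Y - Y / (2 * \<nu>)) * exp (Y / (4 * \<nu>))"
      using \<open>(real r)\<^sup>2 \<le> exp (Y / (4 * \<nu>))\<close> by (intro mult_left_mono) auto
    also have "\<dots> = exp (Y - Y / (2 * \<nu>) + Y / (4 * \<nu>))" by (rule exp_add[symmetric])
    also have "Y - Y / (2 * \<nu>) + Y / (4 * \<nu>) = Y - Y / (4 * \<nu>)" using \<nu> by (simp add: field_simps)
    also have "exp (Y - Y / (4 * \<nu>)) \<le> real N" using MHN(6) by (simp add: \<nu>_def)
    finally show ?thesis using r0 by (simp add: W_def pos_le_divide_eq)
  qed
  have W201: "W \<ge> 201"
  proof -
    have "Y / (2 * \<nu>) \<le> Y / 2" using \<nu> Y100 by (intro divide_left_mono) auto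
    then have "1 + 20 + 20\<^sup>2 / 2 \<le> exp (Y - Y / (2 * \<nu>))"
      using exp_lower_Taylor_quadratic[of 20] Y100 exp_le_cancel_iff[of 20 "Y - Y / (2 * \<nu>)"] by linarith
    then show ?thesis using W_exp by simp
  qed
  show thesis
  proof (rule that[OF A'(1,2)])
    show "X' > 0" by (simp add: X'_def)
    have "exp (Y - Y / (2 * \<nu>)) \<le> real X'" using W_exp W_le by linarith
    then have "Y - Y / (2 * \<nu>) \<le> ln (real X')"
      by (simp add: X'_def ln_ge_iff)
    then show "ln (real X) * (1 - 1 / (2 * real n)) \<le> ln (real X')"
      by (simp add: Y_def \<nu>_def right_diff_distrib)
    \<comment> \<open>Rounding the rescaled length up by at most 1 is paid for by weakening 101/100
      to 201/200, which requires exactly \<open>W \<ge> 201\<close>.\<close>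
    have "201 / 200 * real X' \<le> 101 / 100 * W" using X'_le W201 by linarith
    then have "\<alpha> * (201 / 200 * real X') \<le> \<alpha> * (101 / 100 * W)"
      using \<alpha> by (intro mult_left_mono) auto
    also have "\<dots> < real (card A')" using A'(3) by (simp add: W_def mult_ac)
    finally show "201 / 200 * (real (card A) / real X) * real X' < real (card A')"
      by (simp add: \<alpha>_def mult_ac)
  qed
qed

text \<open>Each increment lowers \<open>n\<close> by one. From \<open>n + 1\<close> to
  \<open>n\<close> the threshold for \<open>ln X\<close> shrinks by a factor of at most
  \<open>1 - 1 / (n + 1)\<close>, whereas \<open>ln X\<close> keeps at least the proportion
  \<open>1 - 1 / (2 * (n + 1))\<close>. Being above the threshold is therefore inherited and the
  iteration costs no further power of \<open>n\<close>. For \<open>n = 1\<close> the density is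
  already 1 and cannot increase.\<close>

theorem no_dense_sq_diff_free:
  assumes "n \<ge> 1" "A \<subseteq> {1..int X}" "sq_diff_free A" "X > 0"
    "real X \<le> (201 / 200) ^ (n - 1) * real (card A)"
  shows "ln (real X) < 10000000000000 * real n ^ 4 * (ln (real n + 1))\<^sup>2"
  using assms
proof (induction n arbitrary: A X rule: nat_induct_at_least)
  case base
  show ?case
  proof (rule ccontr)
    assume "\<not> ?case"
    then have big: "10000000000000 * real 1 ^ 4 * (ln (real 1 + 1))\<^sup>2 \<le> ln (real X)" by simp
    obtain A' X' where A': "A' \<subseteq> {1..int X'}" "X' > 0"
      "201 / 200 * (real (card A) / real X) * real X' < real (card A')"
      by (rule increment_step[OF base(1,2) order.refl base(4,3) big]) blast
    define t where "t = real (card A) / real X"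
    have "1 \<le> t" using base by (simp add: t_def)
    then have "201 / 200 * 1 * real X' \<le> 201 / 200 * t * real X'"
      by (intro mult_right_mono mult_left_mono) auto
    then have "real X' < real (card A')" using A'(2,3) unfolding t_def[symmetric] by linarith
    moreover have "card A' \<le> X'" using card_mono[OF _ A'(1)] by simp
    ultimately show False by simp
  qed
next
  case (Suc n)
  show ?case
  proof (rule ccontr)
    assume "\<not> ?case"
    then have big: "10000000000000 * real (Suc n) ^ 4 * (ln (real (Suc n) + 1))\<^sup>2 \<le> ln (real X)" by simp
    obtain A' X' where A': "A' \<subseteq> {1..int X'}" "sq_diff_free A'" "X' > 0"
      "ln (real X) * (1 - 1 / (2 * real (Suc n))) \<le> ln (real X')"
      "201 / 200 * (real (card A) / real X) * real X' < real (card A')"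
      by (rule increment_step[OF Suc.prems(1,2) _ Suc.prems(4,3) big]) (use Suc.hyps in auto)
    have X0: "real X > 0" using Suc.prems by simp
    have d: "real X \<le> (201 / 200) * (201 / 200) ^ (n - 1) * real (card A)"
      using Suc.prems(4) Suc.hyps by (simp add: power_eq_if)
    have "real X * real X' \<le> (201 / 200) * (201 / 200) ^ (n - 1) * real (card A) * real X'"
      using d by (intro mult_right_mono) auto
    also have "\<dots> = (201 / 200) ^ (n - 1) * (201 / 200 * (real (card A) / real X) * real X') * real X"
      using X0 by simp
    also have "\<dots> \<le> (201 / 200) ^ (n - 1) * real (card A') * real X"
      using A'(5) by (intro mult_right_mono mult_left_mono) auto
    finally have "real X' \<le> (201 / 200) ^ (n - 1) * real (card A')"
      using X0 by (simp add: mult.commute)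
    then have IH: "ln (real X') < 10000000000000 * real n ^ 4 * (ln (real n + 1))\<^sup>2"
      by (rule Suc.IH[OF A'(1,2,3)])
    define \<mu> where "\<mu> = real (Suc n)"
    have \<mu>: "\<mu> \<ge> 2" "real n = \<mu> - 1" using Suc.hyps by (auto simp: \<mu>_def)
    have lnX0: "ln (real X) \<ge> 0" using Suc.prems by (simp add: Suc_leI)
    have "10000000000000 * real n ^ 4 * (ln (real n + 1))\<^sup>2 \<le> 10000000000000 * (real n * \<mu> ^ 3) * (ln (\<mu> + 1))\<^sup>2"
    proof (intro mult_mono power_mono)
      have "real n ^ 4 = real n * real n ^ 3" by (simp add: power_eq_if)
      also have "\<dots> \<le> real n * \<mu> ^ 3" using \<mu> by (intro mult_left_mono power_mono) auto
      finally show "real n ^ 4 \<le> real n * \<mu> ^ 3" .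
    qed (use \<mu> in auto)
    also have "\<dots> = (10000000000000 * \<mu> ^ 4 * (ln (\<mu> + 1))\<^sup>2) * (real n / \<mu>)"
      using \<mu> by (simp add: power_eq_if)
    also have "\<dots> \<le> ln (real X) * (1 - 1 / (2 * \<mu>))"
    proof (intro mult_mono)
      show "10000000000000 * \<mu> ^ 4 * (ln (\<mu> + 1))\<^sup>2 \<le> ln (real X)" using big by (simp add: \<mu>_def)
      show "real n / \<mu> \<le> 1 - 1 / (2 * \<mu>)" using \<mu> by (simp add: field_simps)
    qed (use lnX0 \<mu> in auto)
    also have "\<dots> \<le> ln (real X')" using A'(4) by (simp add: \<mu>_def)
    finally show False using IH by simp
  qed
qed

text \<open>The set is disjoint from its translate by 1, since 1 is a square. This keeps the
  logarithm of the inverse density away from 0.\<close>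

lemma card_sq_diff_free_le_half:
  assumes "A \<subseteq> {1..int X}" "sq_diff_free A"
  shows "2 * card A \<le> X + 1"
proof -
  have fin: "finite A" using assms finite_subset by blast
  have "A \<inter> (\<lambda>a. a + 1) ` A = {}"
  proof (rule ccontr)
    assume "A \<inter> (\<lambda>a. a + 1) ` A \<noteq> {}"
    then obtain a where "a \<in> A" "a + 1 \<in> A" by auto
    moreover have "(a + 1) - a = 1 ^ 2" by simp
    ultimately show False using assms(2) zero_less_one by blast
  qed
  then have "card (A \<union> (\<lambda>a. a + 1) ` A) = card A + card A"
    using fin by (simp add: card_Un_disjoint card_image inj_on_def)
  moreover have "A \<union> (\<lambda>a. a + 1) ` A \<subseteq> {1..int X + 1}" using assms(1) by fastforce
  then have "card (A \<union> (\<lambda>a. a + 1) ` A) \<le> card {1..int X + 1}" by (intro card_mono) auto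
  ultimately show ?thesis by simp
qed

text \<open>The hypothesis contains \<Lambda> also inside a logarithm. Assuming the conclusion false
  gives the crude bound \<open>207 * \<Lambda> \<le> Y\<close> first, so that this logarithm may be
  replaced by \<open>ln Y\<close>; its square then cancels against \<open>b ^ 4\<close>. The powers
  of ten give the strict inequality: \<open>207 / 10 ^ 24\<close> is below
  \<open>1 / 10 ^ 21\<close>, whose fourth power outweighs \<open>2 * 10 ^ 13\<close>.\<close>

lemma final_numerics:
  fixes \<Lambda> Y :: real
  assumes Y: "Y \<ge> 2" and \<Lambda>: "\<Lambda> \<ge> 1 / 2"
    and bound: "Y \<le> 2 * (10000000000000 * (207 * \<Lambda>) ^ 4 * (ln (207 * \<Lambda>))\<^sup>2)"
  shows "1 / (1000000000000000000000000) * Y powr (1/4) * (ln Y) powr (-1/2) \<le> \<Lambda>"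
proof (rule ccontr)
  assume "\<not> ?thesis"
  then have less: "\<Lambda> < 1 / (1000000000000000000000000) * Y powr (1/4) * (ln Y) powr (-1/2)" by simp
  have "ln 2 \<le> ln Y" using Y by simp
  then have lnY: "ln Y \<ge> 1 / 2" using ln_2_ge_half by linarith
  define a b where "a = Y powr (1/4)" and "b = (ln Y) powr (-1/2)"
  have a4: "a ^ 4 = Y" using Y by (simp add: a_def powr_power)
  have b2: "b\<^sup>2 = 1 / ln Y" using lnY by (simp add: b_def powr_minus_divide powr_half_sqrt power_divide)
  have a1: "a \<ge> 1" unfolding a_def using Y by (simp add: ge_one_powr_ge_zero)
  have b0: "b \<ge> 0" by (simp add: b_def)
  have "b\<^sup>2 \<le> 2\<^sup>2"
  proof -
    have "1 / ln Y \<le> 1 / (1 / 2)" using lnY by (intro divide_left_mono) auto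
    then show ?thesis unfolding b2 by simp
  qed
  then have "b \<le> 2" by (rule power2_le_imp_le) simp
  have ab: "207 * \<Lambda> \<le> 1 / 1000000000000000000000 * (a * b)"
  proof -
    have "0 \<le> a * b" using a1 b0 by simp
    moreover have "\<Lambda> < 1 / 1000000000000000000000000 * (a * b)" using less by (simp add: a_def b_def)
    ultimately show ?thesis by linarith
  qed
  also have "\<dots> \<le> 1 / 1000000000000000000000 * (a * 2)" using \<open>b \<le> 2\<close> a1 by (intro mult_left_mono) auto
  also have "\<dots> \<le> a" using a1 by simp
  also have "a \<le> a ^ 4" using a1 by (intro self_le_power) auto
  finally have le: "207 * \<Lambda> \<le> Y" using a4 by simp
  have l1: "ln (207 * \<Lambda>) \<ge> 0" using \<Lambda> by simp
  have "ln (207 * \<Lambda>) \<le> ln Y" using le \<Lambda> by simp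
  then have "(ln (207 * \<Lambda>))\<^sup>2 \<le> (ln Y)\<^sup>2" using l1 by (intro power_mono) auto
  moreover have "(207 * \<Lambda>) ^ 4 \<le> (1 / 1000000000000000000000 * (a * b)) ^ 4" using ab \<Lambda> by (intro power_mono) auto
  ultimately have "2 * (10000000000000 * (207 * \<Lambda>) ^ 4 * (ln (207 * \<Lambda>))\<^sup>2)
      \<le> 2 * (10000000000000 * (1 / 1000000000000000000000 * (a * b)) ^ 4 * (ln Y)\<^sup>2)"
    by (intro mult_left_mono mult_mono) auto
  also have "\<dots> = 2 * 10000000000000 / (1000000000000000000000) ^ 4 * (a ^ 4 * ((b\<^sup>2)\<^sup>2 * (ln Y)\<^sup>2))"
    by (simp add: power_mult_distrib power_divide power_mult[symmetric])
  also have "(b\<^sup>2)\<^sup>2 * (ln Y)\<^sup>2 = 1" unfolding b2 using lnY by (simp add: power_divide)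
  also have "2 * 10000000000000 / (1000000000000000000000) ^ 4 * (a ^ 4 * 1) < Y"
    unfolding a4 using Y by simp
  finally show False using bound by simp
qed

theorem theorem1p1:
  shows "\<exists>c::real. c > 0 \<and>
    (\<forall>(X::real) (A::int set).
       X \<ge> 10 \<longrightarrow>
       A \<subseteq> {1..\<lfloor>X\<rfloor>} \<longrightarrow>
       \<not> (\<exists>a1\<in>A. \<exists>a2\<in>A. \<exists>n::int. n > 0 \<and> a1 - a2 = n ^ 2) \<longrightarrow>
       real (card A) \<le> X * exp (- c * (ln X) powr (1/4) * (ln (ln X)) powr (-1/2)))"
proof (intro exI[of _ "1 / 1000000000000000000000000"] conjI allI impI)
  fix X :: real and A :: "int set"
  assume X: "X \<ge> 10" and A: "A \<subseteq> {1..\<lfloor>X\<rfloor>}" and no_sq: "sq_diff_free A"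
  define Z where "Z = nat \<lfloor>X\<rfloor>"
  have Z: "real Z \<le> X" "X \<le> real Z + 1" "real Z \<ge> 10" "int Z = \<lfloor>X\<rfloor>"
  proof -
    have "\<lfloor>X\<rfloor> \<ge> 10" using X by (simp add: le_floor_iff)
    then show eq: "int Z = \<lfloor>X\<rfloor>" by (simp add: Z_def)
    then have "real Z = of_int \<lfloor>X\<rfloor>" by (metis of_int_of_nat_eq)
    with \<open>\<lfloor>X\<rfloor> \<ge> 10\<close> show "real Z \<le> X" "X \<le> real Z + 1" "real Z \<ge> 10" by linarith+
  qed
  have AZ: "A \<subseteq> {1..int Z}" using A Z(4) by simp
  show "real (card A) \<le> X * exp (- (1 / 1000000000000000000000000) * (ln X) powr (1/4) * (ln (ln X)) powr (-1/2))"
  proof (cases "card A = 0")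
    case True
    then show ?thesis using X by simp
  next
    case False
    then have cA: "real (card A) > 0" by simp
    define \<Lambda> where "\<Lambda> = ln (X / real (card A))"
    have A_eq: "real (card A) = X * exp (- \<Lambda>)"
      using X cA by (simp add: \<Lambda>_def exp_minus)
    have \<Lambda>_half: "\<Lambda> \<ge> 1 / 2"
    proof -
      have "real (2 * card A) \<le> real (Z + 1)"
        using card_sq_diff_free_le_half[OF AZ no_sq] by (rule of_nat_mono)
      \<comment> \<open>From \<open>X \<ge> 10\<close> follows
        \<open>Z + 1 \<le> 11 / 10 * X\<close>.\<close>
      then have "real (card A) * (20 / 11) \<le> X" using Z X by simp
      then have "20 / 11 \<le> X / real (card A)" using cA by (simp add: pos_le_divide_eq mult.commute)
      moreover have "exp (1 / 2 :: real) \<le> 20 / 11"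
      proof -
        have "exp (1 / 2 :: real) \<le> 1 + 1 / 2 + (1 / 2)\<^sup>2" by (rule exp_bound) auto
        then show ?thesis by (simp add: power2_eq_square)
      qed
      ultimately have "exp (1 / 2) \<le> X / real (card A)" by linarith
      moreover have "0 < X / real (card A)" using X cA by simp
      ultimately show ?thesis unfolding \<Lambda>_def by (simp only: ln_ge_iff)
    qed
    \<comment> \<open>201 is the reciprocal of the lower bound \<open>1 / 201\<close> for
      \<open>ln (201 / 200)\<close>, and the added 1 matches the exponent \<open>n - 1\<close>. With
      rounding, \<open>n + 1 \<le> 201 * \<Lambda> + 3\<close>, and
      \<open>\<Lambda> \<ge> 1 / 2\<close> turns this into \<open>207 * \<Lambda>\<close>.\<close>
    define n where "n = nat \<lceil>201 * \<Lambda>\<rceil> + 1"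
    have n: "n \<ge> 1" "real (n - 1) \<ge> 201 * \<Lambda>" "real n + 1 \<le> 207 * \<Lambda>"
      using \<Lambda>_half unfolding n_def by linarith+
    have "exp \<Lambda> \<le> (201 / 200) ^ (n - 1)"
    proof -
      have "1 / 201 \<le> ln (201 / 200 :: real)"
        using ln_add_one_self_le_self2[of "- (1 / 201)"] ln_div[of 200 201] ln_div[of 201 200] by simp
      then have "\<Lambda> \<le> real (n - 1) * ln (201 / 200)"
        using n(2) \<Lambda>_half mult_mono[of "201 * \<Lambda>" "real (n - 1)" "1 / 201" "ln (201 / 200)"] by simp
      then have "exp \<Lambda> \<le> exp (real (n - 1) * ln (201 / 200))" by simp
      also have "\<dots> = (201 / 200) ^ (n - 1)" by (simp add: exp_of_nat_mult)
      finally show ?thesis .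
    qed
    moreover have "exp \<Lambda> = X / real (card A)" using X cA by (simp add: \<Lambda>_def)
    ultimately have "X \<le> (201 / 200) ^ (n - 1) * real (card A)"
      using cA by (simp add: pos_divide_le_eq)
    then have "real Z \<le> (201 / 200) ^ (n - 1) * real (card A)" using Z by linarith
    then have main: "ln (real Z) < 10000000000000 * real n ^ 4 * (ln (real n + 1))\<^sup>2"
      using Z(3) by (intro no_dense_sq_diff_free[OF n(1) AZ no_sq]) auto
    also have "\<dots> \<le> 10000000000000 * (207 * \<Lambda>) ^ 4 * (ln (207 * \<Lambda>))\<^sup>2"
      using n \<Lambda>_half by (intro mult_mono power_mono) auto
    finally have "ln (real Z) \<le> 10000000000000 * (207 * \<Lambda>) ^ 4 * (ln (207 * \<Lambda>))\<^sup>2" by simp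
    moreover have "ln X \<le> 2 * ln (real Z)"
    proof -
      have "2 * real Z \<le> real Z * real Z" using Z(3) by (intro mult_right_mono) auto
      then have "X \<le> real Z * real Z" using Z by linarith
      then have "ln X \<le> ln (real Z * real Z)" using X by simp
      then show ?thesis using Z(3) by (simp add: ln_mult)
    qed
    ultimately have bound: "ln X \<le> 2 * (10000000000000 * (207 * \<Lambda>) ^ 4 * (ln (207 * \<Lambda>))\<^sup>2)" by linarith
    have "ln X \<ge> 2"
    proof -
      have "exp (2::real) = exp 1 * exp 1" by (simp add: exp_add[symmetric])
      also have "\<dots> \<le> 3 * 3" using exp_le by (intro mult_mono) auto
      finally have "exp 2 \<le> X" using X by simp
      then show ?thesis using X by (simp add: ln_ge_iff)
    qed
    then have "1 / (1000000000000000000000000) * (ln X) powr (1/4) * (ln (ln X)) powr (-1/2) \<le> \<Lambda>"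
      by (rule final_numerics[OF _ \<Lambda>_half bound])
    then have "exp (- \<Lambda>) \<le> exp (- (1 / 1000000000000000000000000) * (ln X) powr (1/4) * (ln (ln X)) powr (-1/2))"
      by simp
    then show ?thesis unfolding A_eq using X by (intro mult_left_mono) auto
  qed
qed simp

end
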